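(* Let $X$ be a compact metric space, $\mathcal{F}=(f_t)_{t\in\mathbb{R}}$ a continuous flow on $X$, $\varphi:X\to\mathbb{R}$ continuous, and $\lambda:X\to[0,\infty)$ bounded and lower semicontinuous. Let $\mu$ be the unique equilibrium state of $(X,\mathcal{F},\varphi)$, and suppose that $\mu(\lambda^{-1}(0))<\frac12$. If the entropy map is upper semicontinuous on the product system $(X\times X,\mathcal{F}\times\mathcal{F})$, then $P(\tilde B_\infty,\Phi)<2P(\varphi)$, where $\Phi(x,y)=\varphi(x)+\varphi(y)$, $\tilde\lambda(x,y)=\lambda(x)\lambda(y)$ and $\tilde B_\infty=\bigcap_{t\in\mathbb{R}}(f_t\times f_t)\tilde\lambda^{-1}(0)$.
   Context: $h_\mu$ of a flow is the entropy of its time-one map; $P_\mu(\varphi)=h_\mu+\int\varphi\,d\mu$ for a flow-invariant Borel probability $\mu$; $\mu$ is an equilibrium state if $P_\mu(\varphi)=P(\varphi)$, the topological pressure. For a compact flow-invariant set $A$, $P(A,\varphi)$ is the topological pressure of the flow restricted to $A$ ($P(\emptyset,\cdot)=-\infty$), and likewise for subsets of $X\times X$ with the flow $\mathcal{F}\times\mathcal{F}=(f_t\times f_t)_t$ and potential $\Phi$. The entropy map of a flow is $\nu\mapsto h_\nu$ on flow-invariant Borel probability measures with the weak$^*$ topology. *)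

theory Defs
  imports "HOL-Probability.Probability"
begin

section \<open>Continuous flows and their invariant measures\<close>

definition continuous_flow :: "(real \<Rightarrow> 'a::topological_space \<Rightarrow> 'a) \<Rightarrow> bool" where
  "continuous_flow f \<longleftrightarrow>
     continuous_on UNIV (\<lambda>(t, x). f t x) \<and>
     (\<forall>x. f 0 x = x) \<and>
     (\<forall>s t x. f (s + t) x = f s (f t x))"

definition product_flow :: "(real \<Rightarrow> 'a \<Rightarrow> 'a) \<Rightarrow> real \<Rightarrow> 'a \<times> 'a \<Rightarrow> 'a \<times> 'a" where
  "product_flow f t = map_prod (f t) (f t)"

definition invariant_measures ::
  "(real \<Rightarrow> 'a::topological_space \<Rightarrow> 'a) \<Rightarrow> 'a measure set" where
  "invariant_measures f =
     {\<nu>. prob_space \<nu> \<and> sets \<nu> = sets borel \<and> (\<forall>t. distr \<nu> borel (f t) = \<nu>)}"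

text \<open>The weak\<open>*\<close> topology on the set of invariant measures: the coarsest one for which
  integration of each continuous real function is continuous. All spaces it is used for are
  compact, so no boundedness of \<open>g\<close> is required.\<close>

definition weak_star_topology ::
  "(real \<Rightarrow> 'a::topological_space \<Rightarrow> 'a) \<Rightarrow> 'a measure topology" where
  "weak_star_topology f = topology_generated_by
     {{\<nu> \<in> invariant_measures f. (\<integral>x. g x \<partial>\<nu>) \<in> U} | (g :: 'a \<Rightarrow> real) U.
        continuous_on UNIV g \<and> open U}"

lemma topspace_weak_star_topology: "topspace (weak_star_topology f) = invariant_measures f"
proof -
  have "invariant_measures f \<in> {{\<nu> \<in> invariant_measures f. (\<integral>x. g x \<partial>\<nu>) \<in> U} | (g :: 'a \<Rightarrow> real) U.
      continuous_on UNIV g \<and> open U}"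
    by (rule CollectI, rule exI[of _ "\<lambda>_. 0"], rule exI[of _ UNIV]) auto
  then show ?thesis
    unfolding weak_star_topology_def topology_generated_by_topspace by blast
qed

definition lower_semicontinuous :: "('a::topological_space \<Rightarrow> real) \<Rightarrow> bool" where
  "lower_semicontinuous g \<longleftrightarrow> (\<forall>c. open {x. c < g x})"

definition upper_semicontinuous_map :: "'b topology \<Rightarrow> ('b \<Rightarrow> ereal) \<Rightarrow> bool" where
  "upper_semicontinuous_map T g \<longleftrightarrow> (\<forall>c. openin T {x \<in> topspace T. g x < c})"

section \<open>Measure-theoretic entropy\<close>

text \<open>A finite measurable partition is given by a measurable labelling \<open>p\<close> with finitely many
  values, its atoms being the fibres of \<open>p\<close>. The join of the preimages of the partition under
  \<open>T\<^sup>0, \<dots>, T\<^sup>n\<^sup>-\<^sup>1\<close> is then the partition into the fibres of the \<open>n\<close>-step itinerary.\<close>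

definition finite_labellings :: "'a measure \<Rightarrow> ('a \<Rightarrow> nat) set" where
  "finite_labellings \<nu> = {p. p \<in> measurable \<nu> (count_space UNIV) \<and> finite (range p)}"

definition itinerary :: "('a \<Rightarrow> 'a) \<Rightarrow> ('a \<Rightarrow> nat) \<Rightarrow> nat \<Rightarrow> 'a \<Rightarrow> nat list" where
  "itinerary T p n x = map (\<lambda>i. p ((T ^^ i) x)) [0..<n]"

definition partition_entropy :: "'a measure \<Rightarrow> ('a \<Rightarrow> 'b) \<Rightarrow> real" where
  "partition_entropy \<nu> p = prob_space.entropy \<nu> (exp 1) (count_space (p ` space \<nu>)) p"

lemma partition_entropy_eq:
  assumes "prob_space \<nu>" "simple_function \<nu> p"
  shows "partition_entropy \<nu> p =
    - (\<Sum>v\<in>p ` space \<nu>. measure \<nu> (p -` {v} \<inter> space \<nu>) * ln (measure \<nu> (p -` {v} \<inter> space \<nu>)))"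
proof -
  interpret prob_space \<nu> by fact
  interpret information_space \<nu> "exp 1" by unfold_locales simp
  show ?thesis
    unfolding partition_entropy_def
    using entropy_simple_distributed[OF simple_distributedI[OF assms(2) measure_nonneg refl]]
    by (simp add: log_def)
qed

text \<open>For a \<open>T\<close>-invariant \<open>\<nu>\<close> the limit exists by subadditivity.\<close>

definition entropy_wrt_partition :: "'a measure \<Rightarrow> ('a \<Rightarrow> 'a) \<Rightarrow> ('a \<Rightarrow> nat) \<Rightarrow> real" where
  "entropy_wrt_partition \<nu> T p = lim (\<lambda>n. partition_entropy \<nu> (itinerary T p n) / real n)"

definition ks_entropy :: "'a measure \<Rightarrow> ('a \<Rightarrow> 'a) \<Rightarrow> ereal" where
  "ks_entropy \<nu> T = (SUP p\<in>finite_labellings \<nu>. ereal (entropy_wrt_partition \<nu> T p))"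

definition flow_entropy :: "(real \<Rightarrow> 'a \<Rightarrow> 'a) \<Rightarrow> 'a measure \<Rightarrow> ereal" where
  "flow_entropy f \<nu> = ks_entropy \<nu> (f 1)"

definition measure_pressure ::
  "(real \<Rightarrow> 'a \<Rightarrow> 'a) \<Rightarrow> ('a \<Rightarrow> real) \<Rightarrow> 'a measure \<Rightarrow> ereal" where
  "measure_pressure f \<phi> \<nu> = flow_entropy f \<nu> + ereal (\<integral>x. \<phi> x \<partial>\<nu>)"

section \<open>Topological pressure\<close>

definition bowen_dist :: "(real \<Rightarrow> 'a::metric_space \<Rightarrow> 'a) \<Rightarrow> real \<Rightarrow> 'a \<Rightarrow> 'a \<Rightarrow> real" where
  "bowen_dist f t x y = (SUP s\<in>{0..t}. dist (f s x) (f s y))"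

definition separated_sets ::
  "(real \<Rightarrow> 'a::metric_space \<Rightarrow> 'a) \<Rightarrow> 'a set \<Rightarrow> real \<Rightarrow> real \<Rightarrow> 'a set set" where
  "separated_sets f A t \<delta> =
     {E. finite E \<and> E \<subseteq> A \<and> (\<forall>x\<in>E. \<forall>y\<in>E. x \<noteq> y \<longrightarrow> \<delta> < bowen_dist f t x y)}"

text \<open>The logarithm of the partition function \<open>\<Lambda>\<close>, the supremum of
  \<open>\<Sum>x\<in>E. exp (\<integral>\<^sub>0\<^sup>t \<phi> (f\<^sub>s x) ds)\<close> over the \<open>(t, \<delta>)\<close>-separated sets \<open>E\<close>. Since \<open>ln\<close> is
  increasing it is taken inside the supremum. Leaving out \<open>E = {}\<close>, for which the sum is
  \<open>0\<close>, only matters for empty \<open>A\<close>, where the value is \<open>-\<infinity>\<close>, that is, \<open>ln 0\<close>.\<close>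

definition log_partition_function ::
  "(real \<Rightarrow> 'a::metric_space \<Rightarrow> 'a) \<Rightarrow> 'a set \<Rightarrow> ('a \<Rightarrow> real) \<Rightarrow> real \<Rightarrow> real \<Rightarrow> ereal" where
  "log_partition_function f A \<phi> \<delta> t =
     (SUP E\<in>separated_sets f A t \<delta> - {{}}.
        ereal (ln (\<Sum>x\<in>E. exp (integral {0..t} (\<lambda>s. \<phi> (f s x))))))"

definition pressure_at_scale ::
  "(real \<Rightarrow> 'a::metric_space \<Rightarrow> 'a) \<Rightarrow> 'a set \<Rightarrow> ('a \<Rightarrow> real) \<Rightarrow> real \<Rightarrow> ereal" where
  "pressure_at_scale f A \<phi> \<delta> =
     Limsup at_top (\<lambda>t. log_partition_function f A \<phi> \<delta> t / ereal t)"

text \<open>The pressure is the limit of \<open>pressure_at_scale\<close> as \<open>\<delta>\<close> decreases to \<open>0\<close>, which is a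
  supremum because \<open>pressure_at_scale\<close> increases as \<open>\<delta>\<close> decreases. For invariant \<open>A\<close> this
  is the pressure of the flow restricted to \<open>A\<close>: only orbits of points of \<open>A\<close> occur.\<close>

definition topological_pressure ::
  "(real \<Rightarrow> 'a::metric_space \<Rightarrow> 'a) \<Rightarrow> 'a set \<Rightarrow> ('a \<Rightarrow> real) \<Rightarrow> ereal" where
  "topological_pressure f A \<phi> = (SUP \<delta>\<in>{0<..}. pressure_at_scale f A \<phi> \<delta>)"

lemma topological_pressure_empty: "topological_pressure f {} \<phi> = -\<infinity>"
proof -
  have *: "separated_sets f {} t \<delta> - {{}} = {}" for t \<delta>
    by (auto simp: separated_sets_def)
  have "Limsup at_top (\<lambda>t. -\<infinity> / ereal t) = Limsup at_top (\<lambda>t::real. -\<infinity>)"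
    by (rule Limsup_eq) (auto intro: eventually_mono[OF eventually_gt_at_top[of 0]])
  then have "pressure_at_scale f {} \<phi> \<delta> = -\<infinity>" for \<delta>
    by (simp add: pressure_at_scale_def log_partition_function_def * bot_ereal_def Limsup_const)
  then show ?thesis
    by (simp add: topological_pressure_def)
qed

definition equilibrium_state ::
  "(real \<Rightarrow> 'a::metric_space \<Rightarrow> 'a) \<Rightarrow> ('a \<Rightarrow> real) \<Rightarrow> 'a measure \<Rightarrow> bool" where
  "equilibrium_state f \<phi> \<nu> \<longleftrightarrow>
     \<nu> \<in> invariant_measures f \<and> measure_pressure f \<phi> \<nu> = topological_pressure f UNIV \<phi>"

end

theory Submission
  imports Defs
begin

text \<open>Suppose \<open>P(B, \<Phi>) \<ge> 2 P(\<phi>)\<close>. Misiurewicz's construction on the compact invariant set \<open>B\<close> yields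
  invariant measures carried by \<open>B\<close> whose pressures approach \<open>P(B, \<Phi>)\<close>, and by upper semicontinuity
  a weak\<open>*\<close> limit point \<open>\<nu>\<close> of them satisfies \<open>P\<^sub>\<nu>(\<Phi>) \<ge> P(B, \<Phi>)\<close>. The entropy of \<open>\<nu>\<close> is at most the sum of
  the entropies of its marginals, and each marginal has pressure at most \<open>P(\<phi>)\<close>, so both marginals are
  equilibrium states, hence equal to \<open>\<mu>\<close>. Since \<open>\<lambda>(x) \<lambda>(y) = 0\<close> on \<open>B\<close>, this gives
  \<open>1 = \<nu>(B) \<le> 2 \<mu>(\<lambda>\<^sup>-\<^sup>1(0)) < 1\<close>. If \<open>P(\<phi>) = \<infinity>\<close>, then \<open>(\<mu> + \<nu>') / 2\<close> is an equilibrium state for each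
  invariant \<open>\<nu>'\<close>, so \<open>\<mu>\<close> is the only invariant measure.\<close>

section \<open>Entropy of finite partitions\<close>

text \<open>The contradiction needs a measure of large pressure carried by \<open>B\<close>, and
  then equality in a sum of two bounds. So both halves of the variational principle are proved:
  existence for the closed invariant set \<open>B\<close>, and the upper bound for the flow on the
  whole space. Upper semicontinuity enters at a single point. At a fixed scale \<delta> the
  construction already yields the full pressure bound, because the entropies of one partition with
  null boundary converge; only letting \<delta> tend to 0 requires control of the entropy map
  itself. Measures carried by \<open>B\<close> keep this property in weak limits because
  nonnegativity and lower semicontinuity of \<open>lam\<close> make its zero set, hence
  \<open>B\<close>, closed. When the two marginal pressures are at most P and their sum is at least
  2 P, each equals P provided that P is a real number. It exceeds -\<infinity> since entropies are
  nonnegative, but it may be \<infinity>, where nothing cancels; this is why uniqueness has to be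
  exploited differently in that case.\<close>

lemma simple_function_mass_sum:
  assumes "prob_space \<nu>" "simple_function \<nu> W"
  shows "measure \<nu> ((\<lambda>x. g (W x)) -` {v} \<inter> space \<nu>) =
    (\<Sum>w\<in>{w\<in>W ` space \<nu>. g w = v}. measure \<nu> (W -` {w} \<inter> space \<nu>))"
proof -
  interpret prob_space \<nu> by fact
  have fin: "finite (W ` space \<nu>)" using assms(2) by (rule simple_functionD)
  have "(\<lambda>x. g (W x)) -` {v} \<inter> space \<nu> = (\<Union>w\<in>{w\<in>W ` space \<nu>. g w = v}. W -` {w} \<inter> space \<nu>)"
    by auto
  then show ?thesis
    using fin simple_functionD(2)[OF assms(2)]
    by (simp only:) (intro finite_measure_finite_Union, auto simp: disjoint_family_on_def)
qed

text \<open>Indexing by the values of the finer \<open>W\<close> puts the entropies of several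
  functions of \<open>W\<close> under one sum, where they can be combined term by term.\<close>

lemma partition_entropy_comp:
  assumes "prob_space \<nu>" "simple_function \<nu> W"
  shows "partition_entropy \<nu> (\<lambda>x. g (W x)) =
    - (\<Sum>w\<in>W ` space \<nu>. measure \<nu> (W -` {w} \<inter> space \<nu>) *
        ln (measure \<nu> ((\<lambda>x. g (W x)) -` {g w} \<inter> space \<nu>)))"
proof -
  have fin: "finite (W ` space \<nu>)" using assms(2) by (rule simple_functionD)
  let ?m = "\<lambda>w. measure \<nu> (W -` {w} \<inter> space \<nu>)"
  let ?M = "\<lambda>v. measure \<nu> ((\<lambda>x. g (W x)) -` {v} \<inter> space \<nu>)"
  have sf: "simple_function \<nu> (\<lambda>x. g (W x))"
    using simple_function_compose[OF assms(2), of g] by (simp add: comp_def)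
  have "(\<Sum>v\<in>(\<lambda>x. g (W x)) ` space \<nu>. ?M v * ln (?M v)) =
      (\<Sum>v\<in>g ` W ` space \<nu>. \<Sum>w\<in>{w\<in>W ` space \<nu>. g w = v}. ?m w * ln (?M (g w)))"
    by (rule sum.cong)
       (auto simp: image_image simple_function_mass_sum[OF assms, of g] sum_distrib_right intro!: sum.cong)
  also have "\<dots> = (\<Sum>w\<in>W ` space \<nu>. ?m w * ln (?M (g w)))"
    using sum.image_gen[OF fin, of _ g] by (metis (no_types))
  finally show ?thesis
    using partition_entropy_eq[OF assms(1) sf] by simp
qed

text \<open>The hypothesis says that the fibres of \<open>W\<close> refine those of
  \<open>V\<close>. Then \<open>V\<close> factors through \<open>W\<close> on the space by choice of
  representatives, and data processing applies.\<close>

lemma partition_entropy_mono: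
  assumes "prob_space \<nu>" "simple_function \<nu> W"
    and "\<And>x y. x \<in> space \<nu> \<Longrightarrow> y \<in> space \<nu> \<Longrightarrow> W x = W y \<Longrightarrow> V x = V y"
  shows "partition_entropy \<nu> V \<le> partition_entropy \<nu> W"
proof -
  interpret prob_space \<nu> by fact
  interpret information_space \<nu> "exp 1" by unfold_locales simp
  define g where "g w = V (SOME x. x \<in> space \<nu> \<and> W x = w)" for w
  have V: "V x = (g \<circ> W) x" if "x \<in> space \<nu>" for x
  proof -
    have "\<exists>y. y \<in> space \<nu> \<and> W y = W x" using that by blast
    from someI_ex[OF this] show ?thesis
      unfolding g_def comp_def using assms(3)[OF that] by metis
  qed
  have sg: "simple_function \<nu> (g \<circ> W)" using assms(2) by (rule simple_function_compose)
  have sV: "simple_function \<nu> V"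
    using sg by (subst simple_function_cong[OF V]) auto
  have im: "V ` space \<nu> = (g \<circ> W) ` space \<nu>" using V by (auto simp: image_iff)
  have pre: "V -` {v} \<inter> space \<nu> = (g \<circ> W) -` {v} \<inter> space \<nu>" for v using V by auto
  have "partition_entropy \<nu> V = partition_entropy \<nu> (g \<circ> W)"
    unfolding partition_entropy_eq[OF assms(1) sV] partition_entropy_eq[OF assms(1) sg] im pre ..
  also have "\<dots> \<le> partition_entropy \<nu> W"
    unfolding partition_entropy_def by (rule entropy_data_processing[OF assms(2)])
  finally show ?thesis .
qed

lemma partition_entropy_cong:
  assumes "prob_space \<nu>" "simple_function \<nu> W" "simple_function \<nu> V"
    and "\<And>x y. x \<in> space \<nu> \<Longrightarrow> y \<in> space \<nu> \<Longrightarrow> W x = W y \<longleftrightarrow> V x = V y"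
  shows "partition_entropy \<nu> V = partition_entropy \<nu> W"
  using assms by (intro antisym partition_entropy_mono) auto

text \<open>The difference of the two sides is the conditional mutual information of
  \<open>X\<close> and \<open>Y\<close> given \<open>Z\<close>, which is nonnegative.\<close>

lemma partition_entropy_submodular:
  assumes "prob_space \<nu>" and X: "simple_function \<nu> X" and Y: "simple_function \<nu> Y"
    and Z: "simple_function \<nu> Z"
  shows "partition_entropy \<nu> (\<lambda>x. (X x, Y x, Z x)) + partition_entropy \<nu> Z \<le>
    partition_entropy \<nu> (\<lambda>x. (X x, Z x)) + partition_entropy \<nu> (\<lambda>x. (Y x, Z x))"
proof -
  interpret prob_space \<nu> by fact
  interpret information_space \<nu> "exp 1" by unfold_locales simp
  let ?W = "\<lambda>x. (X x, Y x, Z x)"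
  have W: "simple_function \<nu> ?W" by (intro simple_function_Pair X Y Z)
  note sd = simple_distributedI[OF _ measure_nonneg refl]
  let ?P = "\<lambda>V v. prob (V -` {v} \<inter> space \<nu>)"
  \<comment> \<open>An atom of positive mass has marginals of positive mass, so the logarithm of the
    quotient splits; atoms of mass 0 contribute 0.\<close>
  have pos: "?P (\<lambda>x. g (?W x)) (g w) > 0" if "?P ?W w > 0" for w and g :: "_ \<Rightarrow> 'e"
  proof -
    have "?P ?W w \<le> ?P (\<lambda>x. g (?W x)) (g w)"
      using simple_functionD(2)[OF simple_function_compose[OF W, of g]]
      by (intro finite_measure_mono) (auto simp: comp_def)
    then show ?thesis using that by linarith
  qed
  have "0 \<le> conditional_mutual_information (exp 1) (count_space (X ` space \<nu>))
      (count_space (Y ` space \<nu>)) (count_space (Z ` space \<nu>)) X Y Z"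
    by (rule conditional_mutual_information_nonneg[OF X Y Z])
  also have "\<dots> = (\<Sum>(x, y, z)\<in>?W ` space \<nu>. ?P ?W (x, y, z) * log (exp 1) (?P ?W (x, y, z) /
      (?P (\<lambda>x. (X x, Z x)) (x, z) * (?P (\<lambda>x. (Y x, Z x)) (y, z) / ?P Z z))))"
    by (rule conditional_mutual_information_eq) (intro sd simple_function_Pair X Y Z)+
  also have "\<dots> = (\<Sum>w\<in>?W ` space \<nu>. ?P ?W w * ln (?P ?W w) + ?P ?W w * ln (?P Z (snd (snd w)))
      - ?P ?W w * ln (?P (\<lambda>x. (X x, Z x)) (fst w, snd (snd w)))
      - ?P ?W w * ln (?P (\<lambda>x. (Y x, Z x)) (snd w)))"
  proof (rule sum.cong[OF refl])
    fix w assume "w \<in> ?W ` space \<nu>"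
    obtain x y z where w: "w = (x, y, z)" by (cases w) auto
    show "(case w of (x, y, z) \<Rightarrow> ?P ?W (x, y, z) * log (exp 1) (?P ?W (x, y, z) /
      (?P (\<lambda>x. (X x, Z x)) (x, z) * (?P (\<lambda>x. (Y x, Z x)) (y, z) / ?P Z z)))) =
      ?P ?W w * ln (?P ?W w) + ?P ?W w * ln (?P Z (snd (snd w)))
      - ?P ?W w * ln (?P (\<lambda>x. (X x, Z x)) (fst w, snd (snd w)))
      - ?P ?W w * ln (?P (\<lambda>x. (Y x, Z x)) (snd w))"
    proof (cases "?P ?W w > 0")
      case True
      then show ?thesis
        using pos[OF True, of "\<lambda>(x, y, z). z"] pos[OF True, of "\<lambda>(x, y, z). (x, z)"]
          pos[OF True, of "\<lambda>(x, y, z). (y, z)"]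
        by (simp add: w log_def ln_div ln_mult algebra_simps)
    next
      case False
      then have "?P ?W w = 0" using measure_nonneg[of \<nu>] by (metis less_eq_real_def)
      then show ?thesis by (simp add: w)
    qed
  qed
  also have "\<dots> = - partition_entropy \<nu> ?W - partition_entropy \<nu> Z
      + partition_entropy \<nu> (\<lambda>x. (X x, Z x)) + partition_entropy \<nu> (\<lambda>x. (Y x, Z x))"
    using partition_entropy_comp[OF assms(1) W, of "\<lambda>w. w"]
      partition_entropy_comp[OF assms(1) W, of "\<lambda>w. snd (snd w)"]
      partition_entropy_comp[OF assms(1) W, of "\<lambda>w. (fst w, snd (snd w))"]
      partition_entropy_comp[OF assms(1) W, of snd]
    by (simp add: sum.distrib sum_subtractf)
  finally show ?thesis by linarith
qed

lemma partition_entropy_const: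
  assumes "prob_space \<nu>" shows "partition_entropy \<nu> (\<lambda>_. c) = 0"
proof -
  interpret prob_space \<nu> by fact
  show ?thesis
    using not_empty prob_space by (subst partition_entropy_eq[OF assms]) (auto simp: image_constant_conv)
qed

lemma partition_entropy_nonneg:
  assumes "prob_space \<nu>" "simple_function \<nu> X"
  shows "0 \<le> partition_entropy \<nu> X"
  using partition_entropy_mono[OF assms, of "\<lambda>_. ()"] partition_entropy_const[OF assms(1), of "()"] by simp

lemma partition_entropy_Pair_le:
  assumes "prob_space \<nu>" and X: "simple_function \<nu> X" and Y: "simple_function \<nu> Y"
  shows "partition_entropy \<nu> (\<lambda>x. (X x, Y x)) \<le> partition_entropy \<nu> X + partition_entropy \<nu> Y"
proof -
  interpret prob_space \<nu> by fact
  note c = partition_entropy_const[OF assms(1), of "()"]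
  have "partition_entropy \<nu> (\<lambda>x. (X x, Y x, ())) = partition_entropy \<nu> (\<lambda>x. (X x, Y x))"
    "partition_entropy \<nu> (\<lambda>x. (X x, ())) = partition_entropy \<nu> X"
    "partition_entropy \<nu> (\<lambda>x. (Y x, ())) = partition_entropy \<nu> Y"
    by (rule partition_entropy_cong[OF assms(1)]; auto intro!: simple_function_Pair X Y)+
  then show ?thesis
    using partition_entropy_submodular[OF assms, of "\<lambda>_. ()"] c by simp
qed

lemma partition_entropy_le_card:
  assumes "prob_space \<nu>" "simple_function \<nu> X"
  shows "partition_entropy \<nu> X \<le> ln (real (card (X ` space \<nu>)))"
proof -
  interpret prob_space \<nu> by fact
  interpret information_space \<nu> "exp 1" by unfold_locales simp
  show ?thesis
    using entropy_le_card[OF simple_distributedI[OF assms(2) measure_nonneg refl]]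
    by (simp add: partition_entropy_def log_def)
qed

text \<open>Empty fibres contribute \<open>0 * ln 0 = 0\<close>. A common index set allows different
  labellings and measures to be compared.\<close>

lemma partition_entropy_eq_superset:
  assumes "prob_space \<nu>" "simple_function \<nu> p" "finite S" "p ` space \<nu> \<subseteq> S"
  shows "partition_entropy \<nu> p =
    - (\<Sum>v\<in>S. measure \<nu> (p -` {v} \<inter> space \<nu>) * ln (measure \<nu> (p -` {v} \<inter> space \<nu>)))"
proof -
  have "p -` {v} \<inter> space \<nu> = {}" if "v \<in> S - p ` space \<nu>" for v using that by auto
  then show ?thesis
    unfolding partition_entropy_eq[OF assms(1,2)]
    using assms(3,4) by (intro arg_cong[where f=uminus] sum.mono_neutral_left) auto
qed

text \<open>The convex function \<open>u * ln u\<close> lies above its tangent at \<open>v\<close>;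
  this is \<open>ln x \<le> x - 1\<close> at \<open>x = v / u\<close>. Concavity of entropy and the
  Gibbs inequality both rest on it.\<close>

lemma mult_ln_ge_tangent:
  assumes "0 \<le> u" "0 < (v::real)"
  shows "u * ln v + u - v \<le> u * ln u"
proof (cases "u = 0")
  case True
  with assms show ?thesis by simp
next
  case False
  with assms have u: "u > 0" by simp
  have "ln v - ln u \<le> v / u - 1"
    using ln_le_minus_one[of "v / u"] u assms by (simp add: ln_div)
  then have "u * (ln v - ln u) \<le> u * (v / u - 1)" using u by (intro mult_left_mono) auto
  then show ?thesis using u by (simp add: algebra_simps)
qed

text \<open>Jensen's inequality for \<open>u * ln u\<close>, applied to each atom
  separately.\<close>

lemma partition_entropy_concave:
  assumes M: "prob_space M" "simple_function M p"
    and N: "\<And>i. i \<in> I \<Longrightarrow> prob_space (N i)" "\<And>i. i \<in> I \<Longrightarrow> sets (N i) = sets M"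
    and I: "finite I" "\<And>i. i \<in> I \<Longrightarrow> 0 \<le> w i" "(\<Sum>i\<in>I. w i) = 1"
    and mix: "\<And>A. A \<in> sets M \<Longrightarrow> measure M A = (\<Sum>i\<in>I. w i * measure (N i) A)"
  shows "(\<Sum>i\<in>I. w i * partition_entropy (N i) p) \<le> partition_entropy M p"
proof -
  have sp: "space (N i) = space M" if "i \<in> I" for i using N(2)[OF that] by (rule sets_eq_imp_space_eq)
  have sf: "simple_function (N i) p" if "i \<in> I" for i
    using M(2) sp[OF that] N(2)[OF that] by (simp add: simple_function_def)
  define S where "S = p ` space M"
  have finS: "finite S" using M(2) unfolding S_def by (rule simple_functionD)
  define m where "m v = measure M (p -` {v} \<inter> space M)" for v
  define a where "a i v = measure (N i) (p -` {v} \<inter> space M)" for i v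
  have m: "m v = (\<Sum>i\<in>I. w i * a i v)" for v
    unfolding m_def a_def by (rule mix[OF simple_functionD(2)[OF M(2)]])
  have v: "m v * ln (m v) \<le> (\<Sum>i\<in>I. w i * (a i v * ln (a i v)))" for v
  proof (cases "m v = 0")
    case True
    then have "\<forall>i\<in>I. w i * a i v = 0"
      using m[of v] I(2) sum_nonneg_eq_0_iff[OF I(1), of "\<lambda>i. w i * a i v"] by (simp add: a_def)
    then have "(\<Sum>i\<in>I. w i * (a i v * ln (a i v))) = 0" by (intro sum.neutral) auto
    with True show ?thesis by simp
  next
    case False
    then have pos: "m v > 0" unfolding m_def using measure_nonneg[of M] by (simp add: order_less_le)
    \<comment> \<open>The tangent is taken at the mean \<open>m v\<close>; as the weights sum to 1,
      its linear part \<open>a i v - m v\<close> averages to 0.\<close>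
    have "m v * ln (m v) = (\<Sum>i\<in>I. w i * (a i v * ln (m v) + a i v - m v))"
    proof -
      have "(\<Sum>i\<in>I. w i * (a i v * ln (m v) + a i v - m v)) =
        (\<Sum>i\<in>I. w i * a i v) * ln (m v) + (\<Sum>i\<in>I. w i * a i v) - (\<Sum>i\<in>I. w i) * m v"
        by (simp add: sum.distrib sum_subtractf algebra_simps sum_distrib_left sum_distrib_right)
      also have "\<dots> = m v * ln (m v)" by (simp only: m[symmetric] I)
      finally show ?thesis ..
    qed
    also have "\<dots> \<le> (\<Sum>i\<in>I. w i * (a i v * ln (a i v)))"
      using I pos by (intro sum_mono mult_left_mono mult_ln_ge_tangent) (auto simp: a_def)
    finally show ?thesis .
  qed
  have "(\<Sum>i\<in>I. w i * partition_entropy (N i) p) = (\<Sum>i\<in>I. - (\<Sum>v\<in>S. w i * (a i v * ln (a i v))))"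
    using partition_entropy_eq[OF N(1) sf]
    by (intro sum.cong) (auto simp: sp S_def a_def sum_distrib_left)
  also have "\<dots> = - (\<Sum>v\<in>S. \<Sum>i\<in>I. w i * (a i v * ln (a i v)))"
    by (subst sum.swap) (simp add: sum_negf)
  also have "\<dots> \<le> - (\<Sum>v\<in>S. m v * ln (m v))" using v by (auto intro!: sum_mono)
  also have "\<dots> = partition_entropy M p"
    unfolding partition_entropy_eq[OF M] S_def m_def ..
  finally show ?thesis .
qed

text \<open>\<open>ln y \<le> y - 1\<close> at \<open>y = 1 / sqrt x\<close>. It serves as an
  explicit modulus of continuity of \<open>x * ln x\<close> at 0.\<close>

lemma minus_mult_ln_le_sqrt:
  fixes x :: real
  assumes "0 \<le> x"
  shows "- x * ln x \<le> 2 * sqrt x"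
proof (cases "x = 0")
  case False
  then have x: "0 < x" using assms by simp
  have "ln (1 / sqrt x) \<le> 1 / sqrt x - 1" using x by (intro ln_le_minus_one) auto
  moreover have "ln (1 / sqrt x) = - (ln x / 2)" using x by (simp add: ln_div ln_sqrt)
  ultimately have "- ln x \<le> 2 * (1 / sqrt x)" by simp
  then have "x * (- ln x) \<le> x * (2 * (1 / sqrt x))" using x by (intro mult_left_mono) auto
  also have "\<dots> = 2 * (x / sqrt x)" by simp
  also have "\<dots> = 2 * sqrt x" using x by (simp only: real_div_sqrt)
  finally show ?thesis by simp
qed simp

text \<open>The conditional entropy of \<open>p\<close> given \<open>p'\<close> is small when the
  two rarely differ: every off-diagonal cell of the joint partition has tiny mass, and every
  diagonal cell nearly fills its atom of \<open>p'\<close>. The bound \<delta> depends on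
  \<open>k\<close> and \<epsilon> alone, so it may be fixed before \<open>p'\<close> is
  constructed.\<close>

lemma partition_entropy_close:
  assumes "0 < (\<epsilon>::real)"
  obtains \<delta> where "0 < \<delta>"
    "\<And>\<nu> (p :: 'a \<Rightarrow> nat) p'. prob_space \<nu> \<Longrightarrow> simple_function \<nu> p \<Longrightarrow> simple_function \<nu> p' \<Longrightarrow>
      p ` space \<nu> \<subseteq> {..<k} \<Longrightarrow> p' ` space \<nu> \<subseteq> {..<k} \<Longrightarrow>
      measure \<nu> {x\<in>space \<nu>. p x \<noteq> p' x} < \<delta> \<Longrightarrow>
      partition_entropy \<nu> (\<lambda>x. (p x, p' x)) \<le> partition_entropy \<nu> p' + \<epsilon>"
proof -
  \<comment> \<open>At most \<open>k * k\<close> cells cost \<open>2 * sqrt \<delta>\<close> each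
    and \<open>k\<close> diagonal cells cost \<delta> each, with \<delta> at most
    \<open>sqrt \<delta>\<close>; the final 1 keeps \<open>K\<close> positive.\<close>
  define K where "K = real k + 2 * real k * real k + 1"
  have K: "K > 0" unfolding K_def by (intro add_nonneg_pos) auto
  define \<delta> where "\<delta> = min 1 ((\<epsilon> / K)\<^sup>2)"
  have \<delta>: "0 < \<delta>" "\<delta> \<le> 1" using K assms by (auto simp: \<delta>_def)
  have sq: "sqrt \<delta> \<le> \<epsilon> / K"
    using K assms by (intro real_le_lsqrt) (auto simp: \<delta>_def)
  have dsq: "\<delta> \<le> sqrt \<delta>" using \<delta> by (intro real_le_rsqrt) (auto simp: power2_eq_square mult_le_one)
  have small: "- x * ln x \<le> 2 * sqrt \<delta>" if "0 \<le> x" "x < \<delta>" for x :: real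
    using minus_mult_ln_le_sqrt[OF that(1)] real_sqrt_le_mono[of x \<delta>] that(2) by linarith
  show ?thesis
  proof (rule that[OF \<delta>(1)])
    fix \<nu> :: "'a measure" and p p' :: "'a \<Rightarrow> nat"
    assume \<nu>: "prob_space \<nu>" and p: "simple_function \<nu> p" and p': "simple_function \<nu> p'"
      and pk: "p ` space \<nu> \<subseteq> {..<k}" "p' ` space \<nu> \<subseteq> {..<k}"
      and ne: "measure \<nu> {x\<in>space \<nu>. p x \<noteq> p' x} < \<delta>"
    interpret prob_space \<nu> by fact
    let ?W = "\<lambda>x. (p x, p' x)"
    have W: "simple_function \<nu> ?W" by (intro simple_function_Pair p p')
    define m where "m a b = prob (?W -` {(a, b)} \<inter> space \<nu>)" for a b
    define n where "n b = prob (p' -` {b} \<inter> space \<nu>)" for b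
    have "{x\<in>space \<nu>. p x \<noteq> p' x} = ?W -` {(a, b). a \<noteq> b} \<inter> space \<nu>" by auto
    then have D: "{x\<in>space \<nu>. p x \<noteq> p' x} \<in> events" by (simp only: simple_functionD(2)[OF W])
    have off: "- m a b * ln (m a b) \<le> 2 * sqrt \<delta>" if "a \<noteq> b" for a b
    proof (rule small)
      show "0 \<le> m a b" by (simp add: m_def)
      have "m a b \<le> measure \<nu> {x\<in>space \<nu>. p x \<noteq> p' x}"
        unfolding m_def using that by (intro finite_measure_mono D) auto
      with ne show "m a b < \<delta>" by simp
    qed
    \<comment> \<open>The tangent inequality at \<open>n b\<close> gives the term
      \<open>n b - m b b\<close>, at most \<delta>; the remaining
      \<open>(n b - m b b) * ln (n b)\<close> has the favourable sign because \<open>n b\<close> is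
      at most 1.\<close>
    have diag: "- m b b * ln (m b b) \<le> - n b * ln (n b) + \<delta>" for b
    proof -
      have le: "m b b \<le> n b" unfolding m_def n_def
        by (intro finite_measure_mono) (auto intro: simple_functionD(2)[OF p'])
      have "n b \<le> m b b + measure \<nu> {x\<in>space \<nu>. p x \<noteq> p' x}"
        unfolding n_def m_def
        by (rule order_trans[OF finite_measure_mono measure_Un_le])
           (auto intro: D simple_functionD(2)[OF W])
      then have ge: "n b - m b b \<le> \<delta>" using ne by simp
      show ?thesis
      proof (cases "n b = 0")
        case True
        then have "m b b = 0" using le measure_nonneg[of \<nu>] unfolding m_def by (metis antisym)
        then show ?thesis using True \<delta> by simp
      next
        case False
        then have pos: "n b > 0" unfolding n_def by (simp add: zero_less_measure_iff)
        have ln: "ln (n b) \<le> 0" using pos by (simp add: n_def)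
        have "m b b * ln (n b) + m b b - n b \<le> m b b * ln (m b b)"
          by (rule mult_ln_ge_tangent) (use pos in \<open>auto simp: m_def\<close>)
        moreover have "(n b - m b b) * ln (n b) \<le> 0" using le ln by (intro mult_nonneg_nonpos) auto
        ultimately show ?thesis using ge by (simp add: algebra_simps)
      qed
    qed
    have "partition_entropy \<nu> ?W = - (\<Sum>v\<in>{..<k} \<times> {..<k}. m (fst v) (snd v) * ln (m (fst v) (snd v)))"
      unfolding m_def using pk by (subst partition_entropy_eq_superset[OF \<nu> W]) auto
    also have "\<dots> = (\<Sum>a<k. \<Sum>b<k. - m a b * ln (m a b))"
      by (simp add: sum.cartesian_product sum_negf split_beta')
    also have "\<dots> \<le> (\<Sum>a<k. \<Sum>b<k. 2 * sqrt \<delta> + (if a = b then - n b * ln (n b) + \<delta> else 0))"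
    proof (intro sum_mono)
      fix a b show "- m a b * ln (m a b) \<le> 2 * sqrt \<delta> + (if a = b then - n b * ln (n b) + \<delta> else 0)"
        using off[of a b] diag[of b] \<delta>(1) by (cases "a = b") (auto intro: add_increasing)
    qed
    also have "\<dots> = real k * real k * (2 * sqrt \<delta>) + real k * \<delta> - (\<Sum>b<k. n b * ln (n b))"
      by (simp add: sum.distrib sum.delta sum_negf sum_subtractf)
    finally have "partition_entropy \<nu> ?W \<le>
      real k * real k * (2 * sqrt \<delta>) + real k * \<delta> - (\<Sum>b<k. n b * ln (n b))" .
    moreover have "- (\<Sum>b<k. n b * ln (n b)) = partition_entropy \<nu> p'"
      unfolding n_def using pk by (subst partition_entropy_eq_superset[OF \<nu> p']) auto
    moreover have "real k * real k * (2 * sqrt \<delta>) + real k * \<delta> \<le> K * sqrt \<delta>"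
    proof -
      have "real k * \<delta> \<le> real k * sqrt \<delta>" using dsq by (intro mult_left_mono) auto
      moreover have "0 \<le> sqrt \<delta>" using \<delta> by simp
      ultimately have "real k * \<delta> \<le> real k * sqrt \<delta> + sqrt \<delta>" by linarith
      then show ?thesis by (simp add: K_def algebra_simps)
    qed
    moreover have "K * sqrt \<delta> \<le> \<epsilon>" using sq K by (simp add: field_simps)
    ultimately show "partition_entropy \<nu> ?W \<le> partition_entropy \<nu> p' + \<epsilon>" by linarith
  qed
qed

section \<open>Entropy of a measure-preserving map\<close>

text \<open>Fekete's lemma: the limit is the infimum of \<open>a n / n\<close> over positive
  \<open>n\<close>, which exists because \<open>a\<close> is nonnegative.\<close>

lemma fekete_nonneg:
  fixes a :: "nat \<Rightarrow> real"
  assumes sub: "\<And>m n. a (m + n) \<le> a m + a n" and nn: "\<And>n. 0 \<le> a n"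
  shows "convergent (\<lambda>n. a n / real n)"
proof -
  define l where "l = (INF n\<in>{0<..}. a n / real n)"
  have bdd: "bdd_below ((\<lambda>n. a n / real n) ` {0<..})"
    using nn by (intro bdd_belowI[of _ 0]) auto
  have le: "l \<le> a n / real n" if "n > 0" for n
    unfolding l_def using that by (intro cINF_lower bdd) auto
  have mult: "a (k * n) \<le> real k * a n + a 0" for k n
  proof (induction k)
    case (Suc k)
    then show ?case using sub[of n "k * n"] by (simp add: algebra_simps)
  qed simp
  have "(\<lambda>n. a n / real n) \<longlonglongrightarrow> l"
  proof (rule LIMSEQ_I)
    fix e :: real assume e: "e > 0"
    have "\<exists>N\<in>{0<..}. a N / real N < l + e / 2"
      using cINF_less_iff[OF _ bdd, of "l + e / 2"] e unfolding l_def by auto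
    then obtain N where N: "N > 0" "a N / real N < l + e / 2" by auto
    \<comment> \<open>Absorbs the remainder \<open>n mod N\<close> together with the
      \<open>a 0\<close> of the previous bound, uniformly in \<open>n\<close>.\<close>
    define C where "C = Max (a ` {..N}) + a 0"
    have C: "a r + a 0 \<le> C" if "r < N" for r unfolding C_def using that by (auto intro!: Max_ge)
    have C0: "C \<ge> 0" using C[of 0] N nn[of 0] by simp
    obtain M :: nat where M: "real M > 2 * C / e" using reals_Archimedean2 by blast
    show "\<exists>n0. \<forall>n\<ge>n0. norm (a n / real n - l) < e"
    proof (intro exI allI impI)
      fix n assume n: "n \<ge> Suc M"
      then have n0: "n > 0" by simp
      have "a n = a (n div N * N + n mod N)" by simp
      also have "\<dots> \<le> real (n div N) * a N + a 0 + a (n mod N)"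
        using sub[of "n div N * N" "n mod N"] mult[of "n div N" N] by linarith
      also have "\<dots> \<le> real (n div N) * a N + C" using C[of "n mod N"] N by simp
      also have "real (n div N) * a N \<le> (real n / real N) * a N"
        using nn by (intro mult_right_mono of_nat_div_le_of_nat) auto
      finally have "a n \<le> real n * (a N / real N) + C" by simp
      then have "a n / real n \<le> (real n * (a N / real N) + C) / real n"
        by (intro divide_right_mono) auto
      also have "\<dots> = a N / real N + C / real n" using n0 by (simp add: add_divide_distrib)
      also have "C / real n < e / 2"
      proof -
        have "real M < real n" using n by simp
        with M have "2 * C / e < real n" by linarith
        then show ?thesis using e n0 by (simp add: field_simps)
      qed
      finally have "a n / real n < l + e" using N by simp
      then show "norm (a n / real n - l) < e" using le[OF n0] by simp
    qed
  qed
  then show ?thesis by (rule convergentI)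
qed

lemma partition_entropy_distr:
  assumes "prob_space \<nu>" "g \<in> measurable \<nu> N" "simple_function N p"
  shows "partition_entropy (distr \<nu> N g) p = partition_entropy \<nu> (\<lambda>x. p (g x))"
proof -
  interpret prob_space \<nu> by fact
  have g: "g x \<in> space N" if "x \<in> space \<nu>" for x using assms(2) that by (rule measurable_space)
  have sf: "simple_function \<nu> (\<lambda>x. p (g x))"
    using simple_function_comp[OF assms(2,3)] by (simp add: comp_def)
  have sf': "simple_function (distr \<nu> N g) p" using assms(3) by (simp add: simple_function_def)
  have "measure (distr \<nu> N g) (p -` {v} \<inter> space N) = measure \<nu> ((\<lambda>x. p (g x)) -` {v} \<inter> space \<nu>)" for v
    using g by (subst measure_distr[OF assms(2) simple_functionD(2)[OF assms(3)]])
      (auto intro!: arg_cong[where f="measure \<nu>"])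
  moreover have "(\<lambda>x. p (g x)) ` space \<nu> \<subseteq> p ` space N" using g by auto
  ultimately show ?thesis
    using partition_entropy_eq_superset[OF assms(1) sf simple_functionD(1)[OF assms(3)]]
    by (subst partition_entropy_eq[OF prob_space_distr[OF assms(2)] sf']) auto
qed

lemma itinerary_add:
  "itinerary T p (m + n) x = itinerary T p m x @ itinerary T p n ((T ^^ m) x)"
  by (induction n) (auto simp: itinerary_def funpow_add add.commute[of m])

lemma finite_labelling_simple:
  "p \<in> finite_labellings \<nu> \<Longrightarrow> simple_function \<nu> p"
  unfolding finite_labellings_def simple_function_def
  by (auto intro: measurable_sets finite_subset[OF image_mono[OF subset_UNIV]])

lemma finite_labelling_bounded:
  assumes "p \<in> finite_labellings \<nu>"
  obtains k where "range p \<subseteq> {..<k}"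
  using assms finite_nat_set_iff_bounded[of "range p"] by (auto simp: finite_labellings_def)

locale measure_preserving = prob_space M for M :: "'a measure" +
  fixes T :: "'a \<Rightarrow> 'a"
  assumes T_measurable: "T \<in> measurable M M" and T_distr: "distr M M T = M"
begin

lemma funpow_measurable: "(T ^^ i) \<in> measurable M M"
  by (induction i) (auto intro: measurable_compose[OF _ T_measurable] simp: comp_def)

lemma funpow_distr: "distr M M (T ^^ i) = M"
proof (induction i)
  case 0
  then show ?case by (simp add: distr_id id_def)
next
  case (Suc i)
  have "distr M M (T ^^ Suc i) = distr (distr M M (T ^^ i)) M T"
    by (simp add: distr_distr[OF T_measurable funpow_measurable])
  then show ?case using Suc T_distr by (simp only:)
qed

lemma simple_function_funpow: "simple_function M p \<Longrightarrow> simple_function M (\<lambda>x. p ((T ^^ i) x))"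
  using simple_function_comp[OF funpow_measurable, of p i] by (simp add: comp_def)

lemma partition_entropy_funpow:
  assumes "simple_function M p"
  shows "partition_entropy M (\<lambda>x. p ((T ^^ i) x)) = partition_entropy M p"
  using partition_entropy_distr[OF prob_space_axioms funpow_measurable assms, of i] by (simp add: funpow_distr)

lemma simple_function_itinerary:
  assumes "simple_function M p" shows "simple_function M (itinerary T p n)"
proof (induction n)
  case 0
  then show ?case by (simp add: itinerary_def)
next
  case (Suc n)
  have "itinerary T p (Suc n) = (\<lambda>(l, a). l @ [a]) \<circ> (\<lambda>x. (itinerary T p n x, p ((T ^^ n) x)))"
    by (auto simp: itinerary_def)
  then show ?case
    by (simp only:) (intro simple_function_compose simple_function_Pair Suc simple_function_funpow assms)
qed

lemma itinerary_entropy_subadditive: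
  assumes "simple_function M p"
  shows "partition_entropy M (itinerary T p (m + n)) \<le>
    partition_entropy M (itinerary T p m) + partition_entropy M (itinerary T p n)"
proof -
  note i = simple_function_itinerary[OF assms]
  have "partition_entropy M (itinerary T p (m + n)) \<le>
      partition_entropy M (\<lambda>x. (itinerary T p m x, itinerary T p n ((T ^^ m) x)))"
    by (rule partition_entropy_mono[OF prob_space_axioms])
       (auto simp: itinerary_add intro!: simple_function_Pair i simple_function_funpow[OF i])
  also have "\<dots> \<le> partition_entropy M (itinerary T p m) + partition_entropy M (\<lambda>x. itinerary T p n ((T ^^ m) x))"
    by (intro partition_entropy_Pair_le prob_space_axioms i simple_function_funpow)
  finally show ?thesis by (simp add: partition_entropy_funpow[OF i])
qed

text \<open>Fekete's lemma turns the \<open>lim\<close> in \<open>entropy_wrt_partition\<close>, an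
  unspecified value without convergence, into a genuine limit.\<close>

lemma entropy_wrt_partition_lim:
  assumes "simple_function M p"
  shows "(\<lambda>n. partition_entropy M (itinerary T p n) / real n) \<longlonglongrightarrow> entropy_wrt_partition M T p"
  using fekete_nonneg[OF itinerary_entropy_subadditive[OF assms]
      partition_entropy_nonneg[OF prob_space_axioms simple_function_itinerary[OF assms]]]
  unfolding entropy_wrt_partition_def by (simp add: convergent_LIMSEQ_iff)

lemma entropy_wrt_partition_nonneg:
  "simple_function M p \<Longrightarrow> 0 \<le> entropy_wrt_partition M T p"
  by (rule LIMSEQ_le_const[OF entropy_wrt_partition_lim])
     (auto intro!: exI[of _ 0] divide_nonneg_nonneg partition_entropy_nonneg prob_space_axioms
       simple_function_itinerary)

text \<open>The bracket is the conditional entropy of \<open>p\<close> given \<open>q\<close>, paid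
  once per step. The induction runs on the joint itinerary, because the new symbol of
  \<open>p\<close> has to be conditioned on the symbol of \<open>q\<close> at the same time.\<close>

lemma itinerary_entropy_compare:
  assumes p: "simple_function M p" and q: "simple_function M q"
  shows "partition_entropy M (itinerary T p n) \<le> partition_entropy M (itinerary T q n) +
    real n * (partition_entropy M (\<lambda>x. (p x, q x)) - partition_entropy M q)"
proof -
  note ip = simple_function_itinerary[OF p] and iq = simple_function_itinerary[OF q]
  note P = prob_space_axioms
  let ?H = "partition_entropy M"
  have "?H (\<lambda>x. (itinerary T p n x, itinerary T q n x)) \<le> ?H (itinerary T q n) +
    real n * (?H (\<lambda>x. (p x, q x)) - ?H q)"
  proof (induction n)
    case 0
    then show ?case by (simp add: itinerary_def partition_entropy_const[OF P])
  next
    case (Suc n)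
    let ?P = "itinerary T p n" and ?Q = "itinerary T q n"
    let ?a = "\<lambda>x. p ((T ^^ n) x)" and ?b = "\<lambda>x. q ((T ^^ n) x)"
    note a = simple_function_funpow[OF p, of n] and b = simple_function_funpow[OF q, of n]
    note ip = simple_function_itinerary[OF p, of n] and iq = simple_function_itinerary[OF q, of n]
    note sf = ip iq a b simple_function_Pair
    \<comment> \<open>In terms of conditional entropies, \<open>1\<close> says that
      \<open>?a\<close> given \<open>?b\<close> and the past costs no more than \<open>?a\<close>
      given \<open>?b\<close>, and \<open>2\<close> that \<open>?b\<close> given \<open>?P\<close>
      and \<open>?Q\<close> costs no more than \<open>?b\<close> given \<open>?Q\<close>.\<close>
    have 1: "?H (\<lambda>x. (?a x, (?P x, ?Q x), ?b x)) + ?H ?b \<le> ?H (\<lambda>x. (?a x, ?b x)) + ?H (\<lambda>x. ((?P x, ?Q x), ?b x))"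
      by (intro partition_entropy_submodular P sf)
    have 2: "?H (\<lambda>x. (?P x, ?b x, ?Q x)) + ?H ?Q \<le> ?H (\<lambda>x. (?P x, ?Q x)) + ?H (\<lambda>x. (?b x, ?Q x))"
      by (intro partition_entropy_submodular P sf)
    have 3: "?H (\<lambda>x. (itinerary T p (Suc n) x, itinerary T q (Suc n) x)) \<le> ?H (\<lambda>x. (?a x, (?P x, ?Q x), ?b x))"
      by (rule partition_entropy_mono[OF P]) (intro sf, auto simp: itinerary_def)
    have 4: "?H (\<lambda>x. ((?P x, ?Q x), ?b x)) \<le> ?H (\<lambda>x. (?P x, ?b x, ?Q x))"
      by (rule partition_entropy_mono[OF P]) (auto intro!: sf)
    have 5: "?H (\<lambda>x. (?b x, ?Q x)) \<le> ?H (itinerary T q (Suc n))"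
      by (rule partition_entropy_mono[OF P simple_function_itinerary[OF q]]) (auto simp: itinerary_def)
    have 6: "?H ?b = ?H q" by (rule partition_entropy_funpow[OF q])
    have 7: "?H (\<lambda>x. (?a x, ?b x)) = ?H (\<lambda>x. (p x, q x))"
      using partition_entropy_funpow[OF simple_function_Pair[OF p q], of n] by simp
    from 1 2 3 4 5 6 7 Suc show ?case by (simp add: algebra_simps)
  qed
  moreover have "?H (itinerary T p n) \<le> ?H (\<lambda>x. (itinerary T p n x, itinerary T q n x))"
    by (rule partition_entropy_mono[OF P simple_function_Pair[OF ip iq]]) auto
  ultimately show ?thesis by linarith
qed

lemma entropy_wrt_partition_compare:
  assumes p: "simple_function M p" and q: "simple_function M q"
  shows "entropy_wrt_partition M T p \<le> entropy_wrt_partition M T q +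
    (partition_entropy M (\<lambda>x. (p x, q x)) - partition_entropy M q)" (is "_ \<le> _ + ?d")
proof (rule LIMSEQ_le[OF entropy_wrt_partition_lim[OF p]])
  show "(\<lambda>n. partition_entropy M (itinerary T q n) / real n + ?d) \<longlonglongrightarrow> entropy_wrt_partition M T q + ?d"
    by (intro tendsto_add entropy_wrt_partition_lim[OF q] tendsto_const)
  have "partition_entropy M (itinerary T p n) / real n \<le> partition_entropy M (itinerary T q n) / real n + ?d"
    if "n \<ge> 1" for n
  proof -
    have "partition_entropy M (itinerary T p n) / real n \<le>
       (partition_entropy M (itinerary T q n) + real n * ?d) / real n"
      by (intro divide_right_mono itinerary_entropy_compare p q) auto
    then show ?thesis using that by (simp add: add_divide_distrib)
  qed
  then show "\<exists>N. \<forall>n\<ge>N. partition_entropy M (itinerary T p n) / real n \<le>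
     partition_entropy M (itinerary T q n) / real n + ?d" by blast
qed

end

section \<open>Weak convergence on compact metric spaces\<close>

definition borel_prob :: "'a::topological_space measure \<Rightarrow> bool" where
  "borel_prob \<nu> \<longleftrightarrow> prob_space \<nu> \<and> sets \<nu> = sets borel"

text \<open>Convergence of sequences suffices throughout, by the sequential compactness below;
  \<open>weak_star_eventually\<close> makes the link with \<open>weak_star_topology\<close>.\<close>

definition weakly_converges :: "(nat \<Rightarrow> 'a::topological_space measure) \<Rightarrow> 'a measure \<Rightarrow> bool" where
  "weakly_converges N \<nu> \<longleftrightarrow>
    (\<forall>g :: 'a \<Rightarrow> real. continuous_on UNIV g \<longrightarrow> (\<lambda>k. \<integral>x. g x \<partial>N k) \<longlonglongrightarrow> (\<integral>x. g x \<partial>\<nu>))"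

lemma borel_probD:
  assumes "borel_prob \<nu>"
  shows "prob_space \<nu>" "sets \<nu> = sets borel" "space \<nu> = UNIV"
  using assms sets_eq_imp_space_eq[of \<nu> borel] by (auto simp: borel_prob_def)

lemma compact_range_bounded:
  fixes g :: "'a::topological_space \<Rightarrow> real"
  assumes "compact (UNIV :: 'a set)" "continuous_on UNIV g"
  obtains K where "K > 0" "\<And>x. \<bar>g x\<bar> \<le> K"
proof -
  have "bounded (range g)" by (intro compact_imp_bounded compact_continuous_image assms)
  then show ?thesis using that by (auto simp: bounded_pos)
qed

lemma continuous_borel_integrable:
  fixes g :: "'a::topological_space \<Rightarrow> real"
  assumes "compact (UNIV :: 'a set)" "continuous_on UNIV g" "borel_prob \<nu>"
  shows "integrable \<nu> g"
proof -
  interpret prob_space \<nu> using assms by (simp add: borel_probD)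
  obtain K where "\<And>x. \<bar>g x\<bar> \<le> K" using compact_range_bounded[OF assms(1,2)] by blast
  then show ?thesis
    using borel_measurable_continuous_onI[OF assms(2)]
    by (intro integrable_const_bound[of _ K])
       (auto simp: measurable_cong_sets[OF borel_probD(2)[OF assms(3)] refl])
qed

text \<open>Continuous functions decreasing to the indicator of a closed nonempty \<open>C\<close>.
  For empty \<open>C\<close> the convention \<open>infdist x {} = 0\<close> makes them constantly 1,
  so each use treats that case apart.\<close>

definition cutoff :: "'a::metric_space set \<Rightarrow> nat \<Rightarrow> 'a \<Rightarrow> real" where
  "cutoff C n x = max 0 (1 - real n * infdist x C)"

lemma cutoff_continuous: "continuous_on UNIV (cutoff C n)"
  unfolding cutoff_def by (intro continuous_intros)

lemma cutoff_bounds: "0 \<le> cutoff C n x" "cutoff C n x \<le> 1" "x \<in> C \<Longrightarrow> cutoff C n x = 1"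
  by (auto simp: cutoff_def infdist_nonneg)

lemma cutoff_integral_tendsto:
  assumes C: "closed C" "C \<noteq> {}" and \<nu>: "borel_prob \<nu>"
  shows "(\<lambda>n. \<integral>x. cutoff C n x \<partial>\<nu>) \<longlonglongrightarrow> measure \<nu> C"
proof -
  interpret prob_space \<nu> using \<nu> by (simp add: borel_probD)
  note [measurable_cong] = borel_probD(2)[OF \<nu>]
  have [measurable]: "cutoff C n \<in> borel_measurable borel" for n
    by (intro borel_measurable_continuous_onI cutoff_continuous)
  have [measurable]: "C \<in> sets borel" using C by auto
  have "(\<lambda>n. \<integral>x. cutoff C n x \<partial>\<nu>) \<longlonglongrightarrow> (\<integral>x. indicator C x \<partial>\<nu>)"
  proof (rule integral_dominated_convergence[where w="\<lambda>_. 1"])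
    show "AE x in \<nu>. (\<lambda>n. cutoff C n x) \<longlonglongrightarrow> indicator C x"
    proof (rule AE_I2)
      fix x
      show "(\<lambda>n. cutoff C n x) \<longlonglongrightarrow> indicator C x"
      proof (cases "x \<in> C")
        case False
        then have pos: "infdist x C > 0" using C in_closed_iff_infdist_zero[of C x] infdist_nonneg[of x C] by simp
        obtain n0 :: nat where "real n0 > 1 / infdist x C" using reals_Archimedean2 by blast
        then have n0: "real n0 * infdist x C > 1" using pos by (simp add: field_simps)
        have "eventually (\<lambda>n. cutoff C n x = 0) sequentially"
        proof (rule eventually_sequentiallyI[of n0])
          fix n assume "n0 \<le> n"
          then have "real n0 * infdist x C \<le> real n * infdist x C" using pos by (intro mult_right_mono) auto
          then show "cutoff C n x = 0" using n0 by (simp add: cutoff_def)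
        qed
        then show ?thesis using False by (simp add: tendsto_eventually)
      qed (simp add: cutoff_bounds)
    qed
  qed (auto simp: cutoff_bounds)
  then show ?thesis by (simp add: borel_probD[OF \<nu>])
qed

text \<open>Limits of cutoff integrals recover the measure of closed sets, an intersection-stable
  generator of the Borel sets.\<close>

lemma borel_prob_eqI:
  fixes \<nu> \<nu>' :: "'a::metric_space measure"
  assumes \<nu>: "borel_prob \<nu>" "borel_prob \<nu>'"
    and eq: "\<And>g :: 'a \<Rightarrow> real. continuous_on UNIV g \<Longrightarrow> (\<integral>x. g x \<partial>\<nu>) = (\<integral>x. g x \<partial>\<nu>')"
  shows "\<nu> = \<nu>'"
proof -
  interpret a: prob_space \<nu> using \<nu> by (simp add: borel_probD)
  interpret b: prob_space \<nu>' using \<nu> by (simp add: borel_probD)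
  have m: "measure \<nu> C = measure \<nu>' C" if "closed C" for C
  proof (cases "C = {}")
    case False
    show ?thesis
      using cutoff_integral_tendsto[OF that False \<nu>(1)] cutoff_integral_tendsto[OF that False \<nu>(2)]
        eq[OF cutoff_continuous] by (simp add: LIMSEQ_unique)
  qed simp
  have s: "sets borel = sigma_sets UNIV (Collect closed :: 'a set set)"
    by (subst borel_eq_closed) simp
  show ?thesis
  proof (rule measure_eqI_generator_eq[where E="Collect closed" and \<Omega>=UNIV and A="\<lambda>_. UNIV"])
    show "Int_stable (Collect closed :: 'a set set)" by (auto simp: Int_stable_def)
  qed (use m s \<nu> in \<open>auto simp: borel_probD a.emeasure_eq_measure b.emeasure_eq_measure\<close>)
qed

section \<open>Portmanteau inequalities for closed sets, open sets and sets with null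
  boundary\<close>

lemma weakly_converges_closed:
  fixes \<nu> :: "'a::metric_space measure"
  assumes comp: "compact (UNIV :: 'a set)"
    and N: "\<And>k. borel_prob (N k)" and \<nu>: "borel_prob \<nu>" and w: "weakly_converges N \<nu>"
    and C: "closed C" and e: "e > 0"
  shows "eventually (\<lambda>k. measure (N k) C < measure \<nu> C + e) sequentially"
proof (cases "C = {}")
  case False
  have "eventually (\<lambda>n. (\<integral>x. cutoff C n x \<partial>\<nu>) < measure \<nu> C + e) sequentially"
    using e by (intro order_tendstoD[OF cutoff_integral_tendsto[OF C False \<nu>]]) simp
  then obtain n where n: "(\<integral>x. cutoff C n x \<partial>\<nu>) < measure \<nu> C + e"
    using eventually_happens'[OF sequentially_bot] by blast
  have "eventually (\<lambda>k. (\<integral>x. cutoff C n x \<partial>N k) < measure \<nu> C + e) sequentially"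
    using w cutoff_continuous[of C n] n unfolding weakly_converges_def by (intro order_tendstoD(2)) auto
  moreover have "measure (N k) C \<le> (\<integral>x. cutoff C n x \<partial>N k)" for k
  proof -
    interpret prob_space "N k" using N by (simp add: borel_probD)
    have "measure (N k) C = (\<integral>x. indicator C x \<partial>N k)"
      using N[of k] C by (simp add: borel_probD)
    also have "\<dots> \<le> (\<integral>x. cutoff C n x \<partial>N k)"
      using N[of k] C
      by (intro integral_mono continuous_borel_integrable[OF comp cutoff_continuous N] integrable_real_indicator)
         (auto simp: borel_probD cutoff_bounds indicator_def emeasure_eq_measure)
    finally show ?thesis .
  qed
  ultimately show ?thesis by (elim eventually_mono) (rule le_less_trans)
qed (use e in simp)

lemma weakly_converges_closed_carrier:
  fixes \<nu> :: "'a::metric_space measure"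
  assumes comp: "compact (UNIV :: 'a set)"
    and N: "\<And>k. borel_prob (N k)" and \<nu>: "borel_prob \<nu>" and w: "weakly_converges N \<nu>"
    and C: "closed C" "\<And>k. measure (N k) C = 1"
  shows "measure \<nu> C = 1"
proof -
  interpret prob_space \<nu> by (rule borel_probD(1)[OF \<nu>])
  have "1 \<le> measure \<nu> C + e" if "e > 0" for e
    using eventually_happens'[OF sequentially_bot weakly_converges_closed[OF comp N \<nu> w C(1) that]] C(2)
    by auto
  then have "1 \<le> measure \<nu> C" by (rule field_le_epsilon)
  then show ?thesis using prob_le_1[of C] by simp
qed

lemma weakly_converges_open:
  fixes \<nu> :: "'a::metric_space measure"
  assumes comp: "compact (UNIV :: 'a set)"
    and N: "\<And>k. borel_prob (N k)" and \<nu>: "borel_prob \<nu>" and w: "weakly_converges N \<nu>"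
    and U: "open U" and e: "e > 0"
  shows "eventually (\<lambda>k. measure \<nu> U - e < measure (N k) U) sequentially"
proof -
  have c: "measure \<rho> (- U) = 1 - measure \<rho> U" if "borel_prob \<rho>" for \<rho>
  proof -
    interpret prob_space \<rho> using that by (simp add: borel_probD)
    show ?thesis using prob_compl[of U] U that by (simp add: borel_probD Compl_eq_Diff_UNIV)
  qed
  have "eventually (\<lambda>k. measure (N k) (- U) < measure \<nu> (- U) + e) sequentially"
    by (rule weakly_converges_closed[OF comp N \<nu> w _ e]) (use U in auto)
  then show ?thesis by (simp add: c[OF N] c[OF \<nu>] algebra_simps)
qed

text \<open>\<open>U\<close> and \<open>V\<close> are open sets inside \<open>A\<close> and inside
  its complement that together carry all the mass, so the open-set inequality for both bounds the
  measure of \<open>A\<close> from below and from above.\<close>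

lemma weakly_converges_null_boundary:
  fixes \<nu> :: "'a::metric_space measure"
  assumes comp: "compact (UNIV :: 'a set)"
    and N: "\<And>k. borel_prob (N k)" and \<nu>: "borel_prob \<nu>" and w: "weakly_converges N \<nu>"
    and A: "A \<in> sets borel" and U: "open U" "U \<subseteq> A" and V: "open V" "V \<inter> A = {}"
    and UV: "measure \<nu> (U \<union> V) = 1"
  shows "(\<lambda>k. measure (N k) A) \<longlonglongrightarrow> measure \<nu> A"
proof (rule LIMSEQ_I)
  fix e :: real assume e: "e > 0"
  have UV': "measure \<rho> (U \<union> V) = measure \<rho> U + measure \<rho> V"
      "measure \<rho> U \<le> measure \<rho> A" "measure \<rho> A + measure \<rho> V \<le> 1" if "borel_prob \<rho>" for \<rho>
  proof -
    interpret prob_space \<rho> using that by (simp add: borel_probD)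
    note [simp] = borel_probD[OF that]
    show "measure \<rho> (U \<union> V) = measure \<rho> U + measure \<rho> V"
      using U V by (intro finite_measure_Union) auto
    show "measure \<rho> U \<le> measure \<rho> A" using U A by (intro finite_measure_mono) auto
    have "measure \<rho> A + measure \<rho> V = measure \<rho> (A \<union> V)"
      using V A by (intro finite_measure_Union[symmetric]) auto
    then show "measure \<rho> A + measure \<rho> V \<le> 1" by simp
  qed
  have "eventually (\<lambda>k. norm (measure (N k) A - measure \<nu> A) < e) sequentially"
    using weakly_converges_open[OF comp N \<nu> w U(1) e] weakly_converges_open[OF comp N \<nu> w V(1) e]
  proof eventually_elim
    case (elim k)
    then show ?case using UV'[OF N[of k]] UV'[OF \<nu>] UV by (simp add: abs_if)
  qed
  then show "\<exists>k0. \<forall>k\<ge>k0. norm (measure (N k) A - measure \<nu> A) < e"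
    by (simp add: eventually_sequentially)
qed

text \<open>Regularity, by induction over the generated \<sigma>-algebra. Asking for the closed and
  the open approximation at once makes the claim symmetric under complements.\<close>

lemma borel_closed_open_approx:
  fixes \<nu> :: "'a::metric_space measure"
  assumes \<nu>: "borel_prob \<nu>" and A: "A \<in> sets borel" and e: "e > 0"
  shows "\<exists>C U. closed C \<and> open U \<and> C \<subseteq> A \<and> A \<subseteq> U \<and> measure \<nu> (U - C) < e"
proof -
  interpret prob_space \<nu> using \<nu> by (simp add: borel_probD)
  note [simp] = borel_probD[OF \<nu>]
  have "A \<in> sigma_sets UNIV {S. open S}" using A by (simp add: borel_def)
  then show ?thesis using e
  proof (induction arbitrary: e rule: sigma_sets.induct)
    case (Basic U)
    then have U: "open U" by simp
    show ?case
    \<comment> \<open>For \<open>U = UNIV\<close> the distance to the empty complement is 0 by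
      convention, and the sets \<open>C n\<close> below would be empty.\<close>
    proof (cases "U = UNIV")
      case True
      then show ?thesis using Basic by (intro exI[of _ UNIV]) auto
    next
      case False
      then have ne: "- U \<noteq> {}" by auto
      define C where "C n = {x. infdist x (- U) \<ge> 1 / real (Suc n)}" for n
      have cl: "closed (C n)" for n
        unfolding C_def by (intro closed_Collect_le continuous_intros)
      have sub: "C n \<subseteq> U" for n
      proof
        fix x assume "x \<in> C n"
        then have "infdist x (- U) > 0" by (auto simp: C_def intro: less_le_trans[rotated])
        then show "x \<in> U" using infdist_zero[of x "- U"] by (cases "x \<in> U") auto
      qed
      have "(\<lambda>n. measure \<nu> (U - C n)) \<longlonglongrightarrow> measure \<nu> (\<Inter>n. U - C n)"
      proof (rule finite_Lim_measure_decseq)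
        show "range (\<lambda>n. U - C n) \<subseteq> events" using U cl by auto
        show "decseq (\<lambda>n. U - C n)"
        proof (intro decseq_SucI Diff_mono order_refl)
          fix n
          have "1 / real (Suc (Suc n)) \<le> 1 / real (Suc n)" by (intro divide_left_mono) auto
          then show "C n \<subseteq> C (Suc n)" unfolding C_def by (auto simp del: of_nat_Suc)
        qed
      qed
      moreover have "(\<Inter>n. U - C n) = {}"
      proof -
        have "\<exists>n. x \<in> C n" if "x \<in> U" for x
        proof -
          have "infdist x (- U) > 0"
            using that U ne in_closed_iff_infdist_zero[of "- U" x] infdist_nonneg[of x "- U"]
            by (auto simp: less_le)
          then obtain n where "1 / real (Suc n) < infdist x (- U)" by (meson nat_approx_posE)
          then show ?thesis by (auto simp: C_def intro!: exI[of _ n])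
        qed
        then show ?thesis by auto
      qed
      ultimately have "(\<lambda>n. measure \<nu> (U - C n)) \<longlonglongrightarrow> 0" by (simp only: measure_empty)
      then have "eventually (\<lambda>n. measure \<nu> (U - C n) < e) sequentially"
        using Basic(2) by (rule order_tendstoD(2))
      then obtain n where "measure \<nu> (U - C n) < e"
        using eventually_happens'[OF sequentially_bot] by blast
      then show ?thesis using cl sub U by blast
    qed
  next
    case Empty
    then show ?case by (intro exI[of _ "{}"]) auto
  next
    case (Compl A)
    from Compl.IH[OF Compl.prems] obtain C U where
      "closed C" "open U" "C \<subseteq> A" "A \<subseteq> U" "measure \<nu> (U - C) < e" by blast
    moreover have "- C - (- U) = U - C" by auto
    ultimately show ?case
      by (intro exI[of _ "- U"] exI[of _ "- C"]) (auto simp: Compl_eq_Diff_UNIV[symmetric])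
  next
    case (Union A)
    \<comment> \<open>The errors sum to \<open>e / 2\<close>. The other half is spent on replacing
      the infinite union of the \<open>C i\<close>, which may fail to be closed, by a finite
      one.\<close>
    have "\<forall>i. \<exists>C U. closed C \<and> open U \<and> C \<subseteq> A i \<and> A i \<subseteq> U \<and> measure \<nu> (U - C) < e / 2 * (1/2) ^ Suc i"
      by (intro allI Union.IH) (use Union.prems in simp)
    then obtain C U where CU: "\<And>i. closed (C i)" "\<And>i. open (U i)" "\<And>i. C i \<subseteq> A i" "\<And>i. A i \<subseteq> U i"
      "\<And>i. measure \<nu> (U i - C i) < e / 2 * (1/2) ^ Suc i" by metis
    define W where "W = (\<Union>i. U i)"
    define D where "D n = (\<Union>i<n. C i)" for n
    have m: "C i \<in> events" "U i \<in> events" "D n \<in> events" "W \<in> events" for i n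
      using CU by (auto simp: D_def W_def)
    have lim: "(\<lambda>n. measure \<nu> (W - D n)) \<longlonglongrightarrow> measure \<nu> (\<Inter>n. W - D n)"
    proof (rule finite_Lim_measure_decseq)
      show "range (\<lambda>n. W - D n) \<subseteq> events" using m by auto
      show "decseq (\<lambda>n. W - D n)" by (force simp: decseq_def D_def)
    qed
    have "measure \<nu> (\<Inter>n. W - D n) \<le> e / 2"
    proof -
      have s: "(\<lambda>i. e / 2 * (1/2) ^ Suc i) sums (e / 2 * 1)"
        by (intro sums_mult power_half_series)
      have sm: "summable (\<lambda>i. measure \<nu> (U i - C i))"
        by (rule summable_comparison_test'[OF sums_summable[OF s], of 0]) (use CU(5) in \<open>auto simp: less_imp_le\<close>)
      have "measure \<nu> (\<Inter>n. W - D n) \<le> measure \<nu> (\<Union>i. U i - C i)"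
      proof (intro finite_measure_mono subsetI)
        fix x assume x: "x \<in> (\<Inter>n. W - D n)"
        then obtain i where "x \<in> U i" by (auto simp: W_def)
        moreover have "x \<notin> C i" using x by (force simp: D_def)
        ultimately show "x \<in> (\<Union>i. U i - C i)" by auto
      qed (use m in auto)
      also have "\<dots> \<le> (\<Sum>i. measure \<nu> (U i - C i))"
        by (intro finite_measure_subadditive_countably) (use m sm in auto)
      also have "\<dots> \<le> (\<Sum>i. e / 2 * (1/2) ^ Suc i)"
        by (intro suminf_le sm sums_summable[OF s]) (use CU(5) in \<open>auto simp: less_imp_le\<close>)
      also have "\<dots> = e / 2" using s by (simp add: sums_iff)
      finally show ?thesis .
    qed
    then have "measure \<nu> (\<Inter>n. W - D n) < e" using Union.prems by linarith
    then have "eventually (\<lambda>n. measure \<nu> (W - D n) < e) sequentially"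
      by (rule order_tendstoD(2)[OF lim])
    then obtain n where "measure \<nu> (W - D n) < e"
      using eventually_happens'[OF sequentially_bot] by blast
    moreover have "closed (D n)" "open W" using CU by (auto simp: D_def W_def)
    moreover have "D n \<subseteq> \<Union> (range A)" "\<Union> (range A) \<subseteq> W"
      using CU(3,4) unfolding D_def W_def by blast+
    ultimately show ?case by blast
  qed
qed

text \<open>At the first differing digit \<open>n\<close> the sums differ by
  \<open>1 / 3 ^ n\<close>, while all later digits together change this by at most half as much. In
  base 2 the tail could cancel the difference.\<close>

lemma ternary_digits_eq:
  fixes a b :: "nat \<Rightarrow> real"
  assumes a: "\<And>i. a i \<in> {0, 1}" and b: "\<And>i. b i \<in> {0, 1}"
    and close: "\<bar>(\<Sum>i. a i / 3 ^ i) - (\<Sum>i. b i / 3 ^ i)\<bar> < 1 / (2 * 3 ^ M)"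
    and m: "m \<le> M"
  shows "a m = b m"
proof (rule ccontr)
  assume "a m \<noteq> b m"
  define n where "n = (LEAST i. a i \<noteq> b i)"
  have n: "a n \<noteq> b n" "n \<le> m"
    unfolding n_def by (rule LeastI, fact, rule Least_le, fact)
  have n_less: "a i = b i" if "i < n" for i
    using not_less_Least[OF that[unfolded n_def]] by blast
  define d where "d i = a i - b i" for i
  have d: "\<bar>d i\<bar> \<le> 1" for i using a[of i] b[of i] by (auto simp: d_def)
  have g: "summable (\<lambda>i. (1/3::real) ^ i)" by (intro summable_geometric) simp
  have sm: "summable (\<lambda>i. c i / 3 ^ i)" if "\<And>i. \<bar>c i\<bar> \<le> 1" for c :: "nat \<Rightarrow> real"
    by (rule summable_comparison_test'[OF g, of 0])
       (use that in \<open>auto simp: power_one_over divide_simps\<close>)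
  have a1: "\<bar>a i\<bar> \<le> 1" and b1: "\<bar>b i\<bar> \<le> 1" for i using a[of i] b[of i] by auto
  have "(\<Sum>i. a i / 3 ^ i) - (\<Sum>i. b i / 3 ^ i) = (\<Sum>i. d i / 3 ^ i)"
    by (subst suminf_diff[OF sm sm]) (auto simp: a1 b1 d_def diff_divide_distrib)
  also have "\<dots> = (\<Sum>i. d (i + Suc n) / 3 ^ (i + Suc n)) + (\<Sum>i<Suc n. d i / 3 ^ i)"
    by (rule suminf_split_initial_segment[OF sm[OF d]])
  also have "(\<Sum>i<Suc n. d i / 3 ^ i) = d n / 3 ^ n"
    using n_less by (simp add: d_def)
  finally have eq: "(\<Sum>i. a i / 3 ^ i) - (\<Sum>i. b i / 3 ^ i) =
    (\<Sum>i. d (i + Suc n) / 3 ^ (i + Suc n)) + d n / 3 ^ n" .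
  have "norm (\<Sum>i. d (i + Suc n) / 3 ^ (i + Suc n)) \<le> (\<Sum>i. (1/3) ^ i * (1 / 3 ^ Suc n))"
  proof (rule norm_suminf_le)
    fix i
    have "\<bar>d (i + Suc n)\<bar> / 3 ^ (i + Suc n) \<le> 1 / 3 ^ (i + Suc n)" by (intro divide_right_mono d) auto
    then show "norm (d (i + Suc n) / 3 ^ (i + Suc n)) \<le> (1/3) ^ i * (1 / 3 ^ Suc n)"
      by (simp add: power_add power_one_over)
  qed (intro summable_mult2 g)
  also have "\<dots> = 1 / (2 * 3 ^ n)"
    by (subst suminf_mult2[symmetric]) (auto simp: suminf_geometric g)
  finally have tail: "\<bar>\<Sum>i. d (i + Suc n) / 3 ^ (i + Suc n)\<bar> \<le> 1 / (2 * 3 ^ n)" by simp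
  have "\<bar>d n / 3 ^ n\<bar> = 1 / 3 ^ n" using a[of n] b[of n] n(1) by (auto simp: d_def)
  moreover have "1 / 3 ^ n = 2 * (1 / (2 * 3 ^ n) :: real)" by simp
  ultimately have "1 / (2 * 3 ^ n) \<le> \<bar>(\<Sum>i. a i / 3 ^ i) - (\<Sum>i. b i / 3 ^ i)\<bar>"
    using tail unfolding eq by linarith
  moreover have "1 / (2 * 3 ^ M) \<le> (1 / (2 * 3 ^ n) :: real)"
    using n(2) m by (intro divide_left_mono mult_left_mono power_increasing) auto
  ultimately show False using close by linarith
qed

text \<open>The next two lemmas embed a compact metric space into \<open>\<real>\<close> by a Borel map with continuous inverse,
  so that weak\<open>*\<close> compactness can be read off from Helly's selection theorem on the line. The code
  of \<open>x\<close> has only the ternary digits \<open>0\<close> and \<open>1\<close>, so nearby codes agree in their leading digits.\<close>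

lemma compact_borel_coding:
  assumes comp: "compact (UNIV :: ('a::metric_space) set)"
  obtains s :: "'a::metric_space \<Rightarrow> real" where "s \<in> borel_measurable borel" "\<And>x. s x \<in> {0..3/2}"
    "\<And>\<epsilon>. \<epsilon> > 0 \<Longrightarrow> \<exists>\<gamma>>0. \<forall>x y. \<bar>s x - s y\<bar> < \<gamma> \<longrightarrow> dist x y < \<epsilon>"
proof -
  have "\<exists>F. finite F \<and> (UNIV :: 'a set) \<subseteq> (\<Union>x\<in>F. ball x (1 / real (Suc n)))" for n
  proof -
    have "\<forall>e>0. \<exists>k. finite k \<and> (UNIV :: 'a set) \<subseteq> (\<Union>x\<in>k. ball x e)"
      using comp unfolding compact_eq_totally_bounded by blast
    from this[rule_format, of "1 / real (Suc n)"] show ?thesis by simp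
  qed
  then have "\<forall>n. \<exists>F. finite F \<and> (UNIV :: 'a set) \<subseteq> (\<Union>x\<in>F. ball x (1 / real (Suc n)))" by blast
  from choice[OF this] obtain F :: "nat \<Rightarrow> 'a set" where F: "\<And>n. finite (F n)"
    "\<And>n. UNIV \<subseteq> (\<Union>x\<in>F n. ball x (1 / real (Suc n)))" by blast
  define D where "D = (\<Union>n. (\<lambda>x. ball x (1 / real (Suc n))) ` F n)"
  have cD: "countable D" unfolding D_def using F(1) by (intro countable_UN countable_image) (auto intro: countable_finite)
  \<comment> \<open>Any point of the type shows that \<open>F 0\<close>, and with it
    \<open>D\<close>, is nonempty, as the enumeration by \<open>from_nat_into\<close>
    requires.\<close>
  have "undefined \<in> (\<Union>x\<in>F 0. ball x (1 / real (Suc 0)))" using F(2)[of 0] by (rule subsetD) (rule UNIV_I)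
  then obtain c where "c \<in> F 0" by blast
  then have "ball c (1 / real (Suc 0)) \<in> D" unfolding D_def by (intro UN_I[of 0] imageI) auto
  then have neD: "D \<noteq> {}" by auto
  define A where "A = from_nat_into D"
  have rA: "range A = D" unfolding A_def by (rule range_from_nat_into[OF neD cD])
  have oA: "open (A i)" for i
  proof -
    have "A i \<in> D" using rA by auto
    then show ?thesis by (auto simp: D_def)
  qed
  define s where "s x = (\<Sum>i. indicator (A i) x / 3 ^ i :: real)" for x
  have g: "summable (\<lambda>i. (1/3::real) ^ i)" by (intro summable_geometric) simp
  have le: "indicator (A i) x / 3 ^ i \<le> (1/3::real) ^ i" for i x
    by (auto simp: indicator_def power_one_over)
  have sm: "summable (\<lambda>i. indicator (A i) x / 3 ^ i :: real)" for x
    by (rule summable_comparison_test'[OF g, of 0]) (use le in auto)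
  show ?thesis
  proof
    have [measurable]: "A i \<in> sets borel" for i using oA by auto
    show "s \<in> borel_measurable borel" unfolding s_def by measurable
    fix x
    have "s x \<le> (\<Sum>i. (1/3) ^ i)" unfolding s_def by (intro suminf_le le sm g)
    also have "\<dots> = 3/2" by (subst suminf_geometric) auto
    finally show "s x \<in> {0..3/2}" unfolding s_def using sm by (auto intro!: suminf_nonneg)
  next
    fix \<epsilon> :: real assume "\<epsilon> > 0"
    then obtain n where n: "1 / real (Suc n) < \<epsilon> / 2" using nat_approx_posE[of "\<epsilon> / 2"] by auto
    define ix where "ix B = (SOME i. A i = B)" for B
    have ix: "A (ix B) = B" if "B \<in> (\<lambda>x. ball x (1 / real (Suc n))) ` F n" for B
    proof -
      have "B \<in> range A" using that unfolding rA D_def by blast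
      then have "\<exists>i. A i = B" by auto
      then show ?thesis unfolding ix_def by (rule someI_ex)
    qed
    \<comment> \<open>Codes agreeing in the digits up to \<open>M\<close> put both points into the
      same balls of the \<open>n\<close>-th cover.\<close>
    define M where "M = Max (insert 0 (ix ` (\<lambda>x. ball x (1 / real (Suc n))) ` F n))"
    show "\<exists>\<gamma>>0. \<forall>x y. \<bar>s x - s y\<bar> < \<gamma> \<longrightarrow> dist x y < \<epsilon>"
    proof (intro exI[of _ "1 / (2 * 3 ^ M)"] conjI allI impI)
      fix x y assume xy: "\<bar>s x - s y\<bar> < 1 / (2 * 3 ^ M)"
      obtain c where c: "c \<in> F n" "x \<in> ball c (1 / real (Suc n))" using F(2)[of n] by blast
      define i where "i = ix (ball c (1 / real (Suc n)))"
      have i: "A i = ball c (1 / real (Suc n))" unfolding i_def using c by (intro ix) auto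
      have "i \<le> M" unfolding M_def i_def using c F(1) by (intro Max_ge) auto
      have "indicator (A i) x = (indicator (A i) y :: real)"
        by (rule ternary_digits_eq[OF _ _ _ \<open>i \<le> M\<close>]) (use xy in \<open>auto simp: s_def indicator_def\<close>)
      then have "y \<in> ball c (1 / real (Suc n))" using c by (auto simp: i indicator_def split: if_splits)
      then have "dist x y < 1 / real (Suc n) + 1 / real (Suc n)"
        using c dist_triangle_less_add[of x c "1 / real (Suc n)" y "1 / real (Suc n)"] by (simp add: dist_commute)
      then show "dist x y < \<epsilon>" using n by simp
    qed simp
  qed
qed

lemma compact_decoding:
  fixes s :: "'a::metric_space \<Rightarrow> real"
  assumes comp: "compact (UNIV :: 'a set)"
    and s: "\<And>\<epsilon>. \<epsilon> > 0 \<Longrightarrow> \<exists>\<gamma>>0. \<forall>x y. \<bar>s x - s y\<bar> < \<gamma> \<longrightarrow> dist x y < \<epsilon>"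
  obtains \<pi> :: "real \<Rightarrow> 'a" where "continuous_on (closure (range s)) \<pi>" "\<And>x. \<pi> (s x) = x"
proof -
  \<comment> \<open>\<open>R r y\<close> says that \<open>r\<close> is a limit of codes of points
    tending to \<open>y\<close>. Compactness gives such a \<open>y\<close> for \<open>r\<close> in
    the closure, and \<open>close\<close> gives uniqueness and continuity at once.\<close>
  define R where "R r y \<longleftrightarrow> (\<exists>u. (\<lambda>n. s (u n)) \<longlonglongrightarrow> r \<and> u \<longlonglongrightarrow> y)" for r y
  define \<pi> where "\<pi> r = (SOME y. R r y)" for r
  have ex: "R r (\<pi> r)" if r: "r \<in> closure (range s)" for r
  proof -
    obtain v where v: "\<And>n. v n \<in> range s" "v \<longlonglongrightarrow> r" using r by (auto simp: closure_sequential)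
    define u where "u n = inv s (v n)" for n
    have u: "s (u n) = v n" for n unfolding u_def by (rule f_inv_into_f[OF v(1)])
    have "seq_compact (UNIV :: 'a set)" using comp by (simp add: compact_eq_seq_compact_metric)
    then obtain y \<rho> where \<rho>: "strict_mono (\<rho> :: nat \<Rightarrow> nat)" "(u \<circ> \<rho>) \<longlonglongrightarrow> y"
      by (rule seq_compactE[of _ u]) auto
    have "(v \<circ> \<rho>) \<longlonglongrightarrow> r" using v(2) \<rho>(1) by (rule LIMSEQ_subseq_LIMSEQ)
    then have "R r y"
      unfolding R_def using \<rho>(2) by (intro exI[of _ "u \<circ> \<rho>"]) (simp add: comp_def u)
    then show ?thesis unfolding \<pi>_def by (rule someI)
  qed
  have close: "dist y y' \<le> \<epsilon>"
    if R: "R r y" "R r' y'" and \<gamma>: "\<gamma> > 0" "\<forall>x y. \<bar>s x - s y\<bar> < \<gamma> \<longrightarrow> dist x y < \<epsilon>" and rr: "\<bar>r - r'\<bar> < \<gamma>"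
    for r r' y y' \<epsilon> \<gamma>
  proof -
    obtain u u' where u: "(\<lambda>n. s (u n)) \<longlonglongrightarrow> r" "u \<longlonglongrightarrow> y" "(\<lambda>n. s (u' n)) \<longlonglongrightarrow> r'" "u' \<longlonglongrightarrow> y'"
      using R by (auto simp: R_def)
    have "(\<lambda>n. \<bar>s (u n) - s (u' n)\<bar>) \<longlonglongrightarrow> \<bar>r - r'\<bar>" by (intro tendsto_intros u)
    then have "eventually (\<lambda>n. \<bar>s (u n) - s (u' n)\<bar> < \<gamma>) sequentially" using rr by (rule order_tendstoD)
    then have "eventually (\<lambda>n. dist (u n) (u' n) \<le> \<epsilon>) sequentially"
      by eventually_elim (use \<gamma> in \<open>auto intro: less_imp_le\<close>)
    moreover have "(\<lambda>n. dist (u n) (u' n)) \<longlonglongrightarrow> dist y y'" by (intro tendsto_intros u)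
    ultimately show ?thesis by (intro tendsto_upperbound) auto
  qed
  show ?thesis
  proof
    show "continuous_on (closure (range s)) \<pi>"
      unfolding continuous_on_iff
    proof (intro ballI allI impI)
      fix r and \<epsilon> :: real assume r: "r \<in> closure (range s)" and "\<epsilon> > 0"
      then obtain \<gamma> where \<gamma>: "\<gamma> > 0" "\<forall>x y. \<bar>s x - s y\<bar> < \<gamma> \<longrightarrow> dist x y < \<epsilon> / 2"
        using s[of "\<epsilon> / 2"] by auto
      then have "dist (\<pi> r') (\<pi> r) \<le> \<epsilon> / 2" if "r' \<in> closure (range s)" "dist r' r < \<gamma>" for r'
        using close[OF ex[OF that(1)] ex[OF r] \<gamma>] that(2) by (simp add: dist_real_def)
      then show "\<exists>d>0. \<forall>r'\<in>closure (range s). dist r' r < d \<longrightarrow> dist (\<pi> r') (\<pi> r) < \<epsilon>"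
        using \<open>\<epsilon> > 0\<close> \<open>\<gamma> > 0\<close> by (intro exI[of _ \<gamma>]) force
    qed
    fix x
    have "R (s x) x" unfolding R_def by (intro exI[of _ "\<lambda>_. x"]) auto
    moreover have "R (s x) (\<pi> (s x))" by (rule ex, rule subsetD[OF closure_subset]) simp
    ultimately have le: "dist (\<pi> (s x)) x \<le> \<epsilon>" if pos: "\<epsilon> > 0" for \<epsilon>
    proof -
      obtain \<gamma> where \<gamma>: "\<gamma> > 0" "\<forall>x y. \<bar>s x - s y\<bar> < \<gamma> \<longrightarrow> dist x y < \<epsilon>" using s[OF pos] by blast
      show ?thesis by (rule close[OF \<open>R (s x) (\<pi> (s x))\<close> \<open>R (s x) x\<close> \<gamma>]) (use \<gamma> in simp)
    qed
    have "dist (\<pi> (s x)) x \<le> 0" by (rule field_le_epsilon) (use le in simp)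
    then show "\<pi> (s x) = x" by simp
  qed
qed

text \<open>The laws of the codes live in one bounded interval, hence are tight. A limit law on the
  line is carried by the closure \<open>K\<close> of the set of codes and is transported back by
  \<open>\<pi>\<close>, which is continuous there.\<close>

theorem weak_compactness:
  fixes N :: "nat \<Rightarrow> 'a::metric_space measure"
  assumes comp: "compact (UNIV :: 'a set)" and N: "\<And>k. borel_prob (N k)"
  obtains r \<nu> where "strict_mono (r :: nat \<Rightarrow> nat)" "borel_prob \<nu>" "weakly_converges (\<lambda>k. N (r k)) \<nu>"
proof -
  obtain s :: "'a \<Rightarrow> real" where s: "s \<in> borel_measurable borel" "\<And>x. s x \<in> {0..3/2}"
    "\<And>\<epsilon>. \<epsilon> > 0 \<Longrightarrow> \<exists>\<gamma>>0. \<forall>x y. \<bar>s x - s y\<bar> < \<gamma> \<longrightarrow> dist x y < \<epsilon>"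
    using compact_borel_coding[OF comp] by blast
  define K where "K = closure (range s)"
  obtain \<pi> where \<pi>: "continuous_on K \<pi>" "\<And>x. \<pi> (s x) = x"
    using compact_decoding[OF comp s(3)] unfolding K_def by blast
  have K: "closed K" "range s \<subseteq> K" "K \<noteq> {}" by (auto simp: K_def closure_subset)
  have sN: "s \<in> borel_measurable (N k)" for k
    using s(1) by (simp add: measurable_cong_sets[OF borel_probD(2)[OF N] refl])
  define L where "L k = distr (N k) borel s" for k
  have L: "real_distribution (L k)" for k
  proof -
    interpret prob_space "N k" using N by (simp add: borel_probD)
    show ?thesis unfolding L_def by (rule real_distribution_distr[OF sN])
  qed
  have "tight L"
    unfolding tight_def
  proof (intro conjI allI impI L)
    fix \<epsilon> :: real assume "\<epsilon> > 0"
    have "measure (L k) {-1<..2} = 1" for k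
    proof -
      interpret prob_space "N k" using N by (simp add: borel_probD)
      have "s x \<in> {-1<..2}" for x using s(2)[of x] by simp
      then have "s -` {-1<..2} = UNIV" by blast
      then show ?thesis unfolding L_def
        using prob_space borel_probD(3)[OF N[of k]] by (subst measure_distr[OF sN]) auto
    qed
    then show "\<exists>a b. a < b \<and> (\<forall>n. 1 - \<epsilon> < measure (L n) {a<..b})"
      using \<open>\<epsilon> > 0\<close> by (intro exI[of _ "-1"] exI[of _ 2]) auto
  qed
  from tight_imp_convergent_subsubsequence[OF this, of id] obtain r \<rho> where
    r: "strict_mono r" and \<rho>: "real_distribution \<rho>" and w: "weak_conv_m (L \<circ> r) \<rho>"
    by (auto simp: strict_mono_id)
  interpret \<rho>: real_distribution \<rho> by fact
  have conv: "(\<lambda>k. \<integral>x. h (s x) \<partial>N (r k)) \<longlonglongrightarrow> (\<integral>x. h x \<partial>\<rho>)"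
    if h: "continuous_on UNIV h" "\<And>x. norm (h x) \<le> B" for h :: "real \<Rightarrow> real" and B
  proof -
    have "(\<lambda>k. \<integral>x. h x \<partial>(L \<circ> r) k) \<longlonglongrightarrow> (\<integral>x. h x \<partial>\<rho>)"
    proof (rule weak_conv_imp_integral_bdd_continuous_conv[OF _ \<rho> w])
      show "isCont h x" for x using h(1) by (simp add: continuous_on_eq_continuous_at)
    qed (use L h(2) in auto)
    moreover have "(\<integral>x. h x \<partial>(L \<circ> r) k) = (\<integral>x. h (s x) \<partial>N (r k))" for k
      unfolding L_def comp_def
      by (rule integral_distr[OF sN borel_measurable_continuous_onI[OF h(1)]])
    ultimately show ?thesis by simp
  qed
  have AEK: "AE x in \<rho>. x \<in> K"
  proof -
    \<comment> \<open>A bounded continuous test function that vanishes on all codes; its integral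
      against the limit law is therefore 0, and its zero set is \<open>K\<close>.\<close>
    let ?h = "\<lambda>x. min 1 (infdist x K)"
    have ch: "continuous_on UNIV ?h" by (intro continuous_intros)
    have "(\<lambda>k. \<integral>x. ?h (s x) \<partial>N (r k)) \<longlonglongrightarrow> (\<integral>x. ?h x \<partial>\<rho>)"
      by (rule conv[OF ch, of 1]) (auto simp: infdist_nonneg)
    moreover have "?h (s x) = 0" for x using infdist_zero[of "s x" K] K(2) by (simp add: range_subsetD)
    ultimately have "(\<integral>x. ?h x \<partial>\<rho>) = 0" by (simp add: LIMSEQ_const_iff)
    moreover have "integrable \<rho> ?h"
      using borel_measurable_continuous_onI[OF ch]
      by (intro \<rho>.integrable_const_bound[of _ 1]) (auto simp: infdist_nonneg)
    ultimately have "AE x in \<rho>. ?h x = 0"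
      by (subst (asm) integral_nonneg_eq_0_iff_AE) (auto simp: infdist_nonneg)
    then show ?thesis
      by eventually_elim (use K in \<open>auto simp: in_closed_iff_infdist_zero min_def split: if_splits\<close>)
  qed
  define p where "p x = (if x \<in> K then \<pi> x else undefined)" for x
  have p: "p \<in> borel_measurable borel"
    unfolding p_def
    by (intro borel_measurable_continuous_on_if \<pi>(1)) (use K in auto)
  have p\<rho>: "p \<in> measurable \<rho> borel" using p by simp
  define \<nu> where "\<nu> = distr \<rho> borel p"
  have \<nu>: "borel_prob \<nu>" unfolding borel_prob_def \<nu>_def using \<rho>.prob_space_distr[OF p\<rho>] by simp
  have "weakly_converges (\<lambda>k. N (r k)) \<nu>"
    unfolding weakly_converges_def
  proof (intro allI impI)
    fix g :: "'a \<Rightarrow> real" assume g: "continuous_on UNIV g"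
    obtain B where B: "B > 0" "\<And>x. \<bar>g x\<bar> \<le> B" using compact_range_bounded[OF comp g] by blast
    have "continuous_on K (\<lambda>x. g (\<pi> x))"
      by (rule continuous_on_compose2[OF g \<pi>(1)]) auto
    moreover have "closedin (top_of_set UNIV) K" using K by simp
    \<comment> \<open>Weak convergence on the line tests functions defined everywhere, whereas
      \<open>g\<close> composed with \<open>\<pi>\<close> is continuous on \<open>K\<close>
      only.\<close>
    ultimately obtain h where h: "continuous_on UNIV h" "\<And>x. x \<in> K \<Longrightarrow> h x = g (\<pi> x)" "\<And>x. norm (h x) \<le> B"
      by (rule Tietze[of K "\<lambda>x. g (\<pi> x)" UNIV B]) (use B in auto)
    have "(\<integral>x. g x \<partial>\<nu>) = (\<integral>x. g (p x) \<partial>\<rho>)"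
      unfolding \<nu>_def by (rule integral_distr[OF p\<rho> borel_measurable_continuous_onI[OF g]])
    also have "\<dots> = (\<integral>x. h x \<partial>\<rho>)"
    proof (rule integral_cong_AE)
      show "AE x in \<rho>. g (p x) = h x"
        using AEK by eventually_elim (simp add: p_def h)
    qed (use measurable_compose[OF p\<rho> borel_measurable_continuous_onI[OF g]]
        borel_measurable_continuous_onI[OF h(1)] in auto)
    finally have "(\<lambda>k. \<integral>x. h (s x) \<partial>N (r k)) \<longlonglongrightarrow> (\<integral>x. g x \<partial>\<nu>)" using conv[OF h(1,3)] by simp
    moreover have "h (s x) = g x" for x using K(2) by (subst h(2)) (auto simp: \<pi>)
    ultimately show "(\<lambda>k. \<integral>x. g x \<partial>N (r k)) \<longlonglongrightarrow> (\<integral>x. g x \<partial>\<nu>)" by simp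
  qed
  with r \<nu> show ?thesis by (rule that)
qed

section \<open>Partitions of compact metric spaces\<close>

lemma compact_closed_separated:
  fixes K C :: "'a::metric_space set"
  assumes K: "compact K" and C: "closed C" and disj: "K \<inter> C = {}"
  shows "\<exists>d>0. \<forall>x\<in>K. \<forall>y\<in>C. d \<le> dist x y"
proof (cases "K = {} \<or> C = {}")
  case False
  have "continuous_on K (\<lambda>x. infdist x C)" by (intro continuous_intros)
  then obtain x where x: "x \<in> K" "\<And>y. y \<in> K \<Longrightarrow> infdist x C \<le> infdist y C"
    using continuous_attains_inf[OF K] False by blast
  have "infdist x C > 0"
    using False x(1) disj in_closed_iff_infdist_zero[OF C] infdist_nonneg[of x C] by (force simp: less_le)
  moreover have "infdist x C \<le> dist y z" if "y \<in> K" "z \<in> C" for y z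
    using x(2)[OF that(1)] infdist_le[OF that(2), of y] by linarith
  ultimately show ?thesis by blast
qed (auto intro: exI[of _ 1])

lemma disjoint_compacts_separated:
  fixes C :: "nat \<Rightarrow> 'a::metric_space set"
  assumes "\<And>i. compact (C i)" "\<And>i j. i \<noteq> j \<Longrightarrow> C i \<inter> C j = {}"
  shows "\<exists>d>0. \<forall>i<k. \<forall>j<k. i \<noteq> j \<longrightarrow> (\<forall>x\<in>C i. \<forall>y\<in>C j. d \<le> dist x y)"
proof -
  have "\<exists>d>0. i \<noteq> j \<longrightarrow> (\<forall>x\<in>C i. \<forall>y\<in>C j. d \<le> dist x y)" for i j
  proof (cases "i = j")
    case False
    then show ?thesis
      using compact_closed_separated[of "C i" "C j"] assms compact_imp_closed by blast
  qed (auto intro: exI[of _ 1])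
  then have "\<forall>i. \<exists>f. \<forall>j. f j > 0 \<and> (i \<noteq> j \<longrightarrow> (\<forall>x\<in>C i. \<forall>y\<in>C j. f j \<le> dist x y))"
    by (intro allI choice)
  from choice[OF this] obtain d where
    d: "\<And>i j. d i j > 0" "\<And>i j x y. i \<noteq> j \<Longrightarrow> x \<in> C i \<Longrightarrow> y \<in> C j \<Longrightarrow> d i j \<le> dist x y"
    by blast
  define D where "D = insert 1 ((\<lambda>(i, j). d i j) ` ({..<k} \<times> {..<k}))"
  have D: "finite D" "D \<noteq> {}" by (auto simp: D_def)
  have "Min D > 0" using D d(1) by (auto simp: D_def)
  moreover have le: "Min D \<le> d i j" if "i < k" "j < k" for i j
    using that by (intro Min_le D) (auto simp: D_def)
  ultimately show ?thesis
    by (intro exI[of _ "Min D"] conjI allI impI ballI) (auto intro: order_trans[OF le d(2)])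
qed

text \<open>Inner regularity of each of the \<open>k\<close> atoms with error
  \<open>\<eta> / (k + 1)\<close>, so that the total error stays strictly below \<eta>. Disjoint
  compact sets have positive distance.\<close>

lemma labelling_closed_approx:
  fixes \<nu> :: "'a::metric_space measure"
  assumes comp: "compact (UNIV :: 'a set)" and \<nu>: "borel_prob \<nu>"
    and p: "p \<in> finite_labellings \<nu>" "range p \<subseteq> {..<k}" and \<eta>: "\<eta> > 0"
  obtains C d where "d > 0" "\<And>i. closed (C i)" "\<And>i x. x \<in> C i \<Longrightarrow> p x = i"
    "measure \<nu> (UNIV - (\<Union>i. C i)) < \<eta>"
    "\<And>i j x y. i \<noteq> j \<Longrightarrow> x \<in> C i \<Longrightarrow> y \<in> C j \<Longrightarrow> d \<le> dist x y"
proof -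
  interpret prob_space \<nu> using \<nu> by (simp add: borel_probD)
  have "p \<in> measurable \<nu> (count_space UNIV)" using p(1) by (simp add: finite_labellings_def)
  then have m: "p -` {i} \<in> sets borel" for i
    using measurable_sets[of p \<nu> "count_space UNIV" "{i}"] by (simp add: borel_probD[OF \<nu>])
  define e where "e = \<eta> / real (Suc k)"
  have e: "e > 0" using \<eta> by (simp add: e_def)
  have "\<exists>C. closed C \<and> C \<subseteq> p -` {i} \<and> measure \<nu> (p -` {i} - C) < e" for i
  proof -
    obtain C U where CU: "closed C" "open U" "C \<subseteq> p -` {i}" "p -` {i} \<subseteq> U" "measure \<nu> (U - C) < e"
      using borel_closed_open_approx[OF \<nu> m[of i] e] by blast
    have "measure \<nu> (p -` {i} - C) \<le> measure \<nu> (U - C)"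
      using CU by (intro finite_measure_mono) (auto simp: borel_probD[OF \<nu>])
    with CU(5) have "measure \<nu> (p -` {i} - C) < e" by linarith
    with CU(1,3) show ?thesis by blast
  qed
  then have "\<forall>i. \<exists>C. closed C \<and> C \<subseteq> p -` {i} \<and> measure \<nu> (p -` {i} - C) < e" by blast
  from choice[OF this] obtain C where
    C: "\<And>i. closed (C i)" "\<And>i. C i \<subseteq> p -` {i}" "\<And>i. measure \<nu> (p -` {i} - C i) < e" by blast
  have Ck: "C i = {}" if "i \<ge> k" for i
  proof -
    have "x \<notin> C i" for x
    proof
      assume "x \<in> C i"
      then have "p x = i" using C(2) by auto
      moreover have "p x < k" using p(2) by auto
      ultimately show False using that by simp
    qed
    then show ?thesis by blast
  qed
  have "\<exists>d>0. \<forall>i<k. \<forall>j<k. i \<noteq> j \<longrightarrow> (\<forall>x\<in>C i. \<forall>y\<in>C j. d \<le> dist x y)"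
  proof (rule disjoint_compacts_separated)
    show "compact (C i)" for i using C(1)[of i] comp closed_Int_compact[of "C i" UNIV] by simp
    show "C i \<inter> C j = {}" if "i \<noteq> j" for i j using C(2)[of i] C(2)[of j] that by auto
  qed
  then obtain d where d: "d > 0" "\<And>i j x y. i < k \<Longrightarrow> j < k \<Longrightarrow> i \<noteq> j \<Longrightarrow> x \<in> C i \<Longrightarrow> y \<in> C j \<Longrightarrow> d \<le> dist x y"
    by blast
  have "UNIV - (\<Union>i. C i) \<subseteq> (\<Union>i<k. p -` {i} - C i)" using p(2) by auto
  then have "measure \<nu> (UNIV - (\<Union>i. C i)) \<le> measure \<nu> (\<Union>i<k. p -` {i} - C i)"
    using m C(1) by (intro finite_measure_mono) (auto simp: borel_probD[OF \<nu>])
  also have "\<dots> \<le> (\<Sum>i<k. measure \<nu> (p -` {i} - C i))"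
    using m C(1) by (intro finite_measure_subadditive_finite) (auto simp: borel_probD[OF \<nu>])
  also have "\<dots> \<le> (\<Sum>i<k. e)" using C(3) by (intro sum_mono) (auto intro: less_imp_le)
  also have "\<dots> < \<eta>" using \<eta> by (simp add: e_def field_simps)
  finally have small: "measure \<nu> (UNIV - (\<Union>i. C i)) < \<eta>" .
  show ?thesis
  proof (rule that[OF d(1) C(1) _ small])
    show "p x = i" if "x \<in> C i" for i x using C(2)[of i] that by auto
    show "d \<le> dist x y" if "i \<noteq> j" "x \<in> C i" "y \<in> C j" for i j x y
    proof (rule d(2)[OF _ _ that])
      show "i < k" using Ck[of i] that by (cases "i < k") auto
      show "j < k" using Ck[of j] that by (cases "j < k") auto
    qed
  qed
qed

text \<open>Conditioning on the finer \<open>q\<close> amounts to conditioning on \<open>q\<close>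
  and \<open>g (q x)\<close> together, so this is an instance of submodularity.\<close>

lemma conditional_entropy_le_factor:
  assumes \<nu>: "prob_space \<nu>" and p: "simple_function \<nu> p" and q: "simple_function \<nu> q"
  shows "partition_entropy \<nu> (\<lambda>x. (p x, q x)) - partition_entropy \<nu> q \<le>
    partition_entropy \<nu> (\<lambda>x. (p x, g (q x))) - partition_entropy \<nu> (\<lambda>x. g (q x))"
proof -
  have g: "simple_function \<nu> (\<lambda>x. g (q x))"
    using simple_function_compose[OF q, of g] by (simp add: comp_def)
  have "partition_entropy \<nu> (\<lambda>x. (q x, g (q x))) \<le> partition_entropy \<nu> q"
    by (rule partition_entropy_mono[OF \<nu> q]) simp
  moreover have "partition_entropy \<nu> (\<lambda>x. (p x, q x)) \<le> partition_entropy \<nu> (\<lambda>x. (p x, q x, g (q x)))"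
    by (rule partition_entropy_mono[OF \<nu>]) (intro simple_function_Pair p q g, simp)
  ultimately show ?thesis
    using partition_entropy_submodular[OF \<nu> p q g] by linarith
qed

text \<open>Approximate the atoms of \<open>p\<close> by closed sets at distance at least
  \<open>d\<close>. An atom of \<open>q\<close> of mesh below \<open>d\<close> meets at most one of
  them, so a coarsening of \<open>q\<close> agrees with \<open>p\<close> off a set of small
  measure.\<close>

lemma small_mesh_conditional_entropy:
  fixes \<nu> :: "'a::metric_space measure"
  assumes comp: "compact (UNIV :: 'a set)" and \<nu>: "borel_prob \<nu>"
    and p: "p \<in> finite_labellings \<nu>" and \<epsilon>: "\<epsilon> > 0"
  obtains \<delta> where "\<delta> > 0"
    "\<And>q :: 'a \<Rightarrow> nat. simple_function \<nu> q \<Longrightarrow> (\<And>x y. q x = q y \<Longrightarrow> dist x y < \<delta>) \<Longrightarrow>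
      partition_entropy \<nu> (\<lambda>x. (p x, q x)) \<le> partition_entropy \<nu> q + \<epsilon>"
proof -
  note P = borel_probD(1)[OF \<nu>]
  interpret prob_space \<nu> by (rule P)
  note sp = finite_labelling_simple[OF p]
  obtain k where k: "range p \<subseteq> {..<k}" using finite_labelling_bounded[OF p] .
  obtain \<eta> where \<eta>: "\<eta> > 0"
    "\<And>\<nu> (p :: 'a \<Rightarrow> nat) p'. prob_space \<nu> \<Longrightarrow> simple_function \<nu> p \<Longrightarrow> simple_function \<nu> p' \<Longrightarrow>
      p ` space \<nu> \<subseteq> {..<k} \<Longrightarrow> p' ` space \<nu> \<subseteq> {..<k} \<Longrightarrow>
      measure \<nu> {x\<in>space \<nu>. p x \<noteq> p' x} < \<eta> \<Longrightarrow>
      partition_entropy \<nu> (\<lambda>x. (p x, p' x)) \<le> partition_entropy \<nu> p' + \<epsilon>"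
    by (rule partition_entropy_close[OF \<epsilon>, of k]) blast
  obtain C d where d: "d > 0" and C: "\<And>i. closed (C i)" "\<And>i x. x \<in> C i \<Longrightarrow> p x = i"
    "measure \<nu> (UNIV - (\<Union>i. C i)) < \<eta>"
    "\<And>i j x y. i \<noteq> j \<Longrightarrow> x \<in> C i \<Longrightarrow> y \<in> C j \<Longrightarrow> d \<le> dist x y"
    using labelling_closed_approx[OF comp \<nu> p k \<eta>(1)] by metis
  show ?thesis
  proof (rule that[OF d])
    fix q :: "'a \<Rightarrow> nat" assume q: "simple_function \<nu> q" and mesh: "\<And>x y. q x = q y \<Longrightarrow> dist x y < d"
    \<comment> \<open>Labels an atom of \<open>q\<close> by the closed set that it meets;
      \<open>p undefined\<close> is merely a default below \<open>k\<close> for atoms that meet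
      none.\<close>
    define g where "g l = (if \<exists>x i. q x = l \<and> x \<in> C i then (SOME i. \<exists>x. q x = l \<and> x \<in> C i) else p undefined)" for l
    have gC: "g (q x) = i" if x: "x \<in> C i" for x i
    proof -
      have "\<exists>j y. q y = q x \<and> y \<in> C j" using x by blast
      then have "\<exists>y. q y = q x \<and> y \<in> C (SOME j. \<exists>y. q y = q x \<and> y \<in> C j)" by (rule someI_ex)
      moreover have "g (q x) = (SOME j. \<exists>y. q y = q x \<and> y \<in> C j)" unfolding g_def using x by auto
      ultimately obtain y where y: "q y = q x" "y \<in> C (g (q x))" by auto
      show ?thesis
      proof (rule ccontr)
        assume "g (q x) \<noteq> i"
        from C(4)[OF this y(2) x] mesh[OF y(1)] show False by simp
      qed
    qed
    have gk: "g l < k" for l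
    proof (cases "\<exists>x i. q x = l \<and> x \<in> C i")
      case True
      then obtain x i where "q x = l" "x \<in> C i" by blast
      then have "g l = p x" using gC C(2) by metis
      then show ?thesis using k by auto
    next
      case False
      have "p undefined < k" using k by blast
      with False show ?thesis by (auto simp: g_def)
    qed
    have gq: "simple_function \<nu> (\<lambda>x. g (q x))"
      using simple_function_compose[OF q, of g] by (simp add: comp_def)
    have "measure \<nu> {x\<in>space \<nu>. p x \<noteq> g (q x)} \<le> measure \<nu> (UNIV - (\<Union>i. C i))"
      using C(1) gC C(2) by (intro finite_measure_mono) (auto simp: borel_probD[OF \<nu>])
    then have "partition_entropy \<nu> (\<lambda>x. (p x, g (q x))) \<le> partition_entropy \<nu> (\<lambda>x. g (q x)) + \<epsilon>"
      using C(3) k gk by (intro \<eta>(2) P sp gq) auto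
    then show "partition_entropy \<nu> (\<lambda>x. (p x, q x)) \<le> partition_entropy \<nu> q + \<epsilon>"
      using conditional_entropy_le_factor[OF P sp q, of g] by linarith
  qed
qed

section \<open>Partitions of small mesh with null boundary\<close>

lemma closed_metric_sphere: "closed (sphere (x :: 'a::metric_space) r)"
  unfolding sphere_def by (intro closed_Collect_eq continuous_intros)

text \<open>The law of the distance from \<open>x\<close> has only countably many point masses,
  while there are uncountably many radii below \<delta>.\<close>

lemma null_sphere:
  fixes \<nu> :: "'a::metric_space measure"
  assumes \<nu>: "borel_prob \<nu>" and \<delta>: "\<delta> > 0"
  shows "\<exists>r. 0 < r \<and> r < \<delta> \<and> measure \<nu> (sphere x r) = 0"
proof -
  interpret prob_space \<nu> using \<nu> by (simp add: borel_probD)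
  have "continuous_on UNIV (\<lambda>y. dist x y)" by (intro continuous_intros)
  then have m: "(\<lambda>y. dist x y) \<in> borel_measurable \<nu>"
    using borel_measurable_continuous_onI measurable_cong_sets[OF borel_probD(2)[OF \<nu>] refl] by blast
  interpret L: prob_space "distr \<nu> borel (\<lambda>y. dist x y)" by (rule prob_space_distr[OF m])
  have "countable {r. measure (distr \<nu> borel (\<lambda>y. dist x y)) {r} \<noteq> 0}" by (rule L.countable_support)
  moreover have "uncountable {0<..<\<delta>}" using \<delta> by (simp add: uncountable_open_interval)
  ultimately have "\<not> {0<..<\<delta>} \<subseteq> {r. measure (distr \<nu> borel (\<lambda>y. dist x y)) {r} \<noteq> 0}"
    using countable_subset by blast
  then obtain r where r: "0 < r" "r < \<delta>" "measure (distr \<nu> borel (\<lambda>y. dist x y)) {r} = 0" by auto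
  have "(\<lambda>y. dist x y) -` {r} \<inter> space \<nu> = sphere x r" by (auto simp: borel_probD[OF \<nu>])
  then show ?thesis using r m by (auto simp: measure_distr)
qed

text \<open>Label each point by the first ball of a finite cover that contains it, with all bounding
  spheres null. Local constancy on an open set \<open>V\<close> of full measure is the form of the
  null boundary condition that passes easily to itineraries.\<close>

lemma null_boundary_partition:
  fixes \<nu> :: "'a::metric_space measure"
  assumes comp: "compact (UNIV :: 'a set)" and \<nu>: "borel_prob \<nu>" and \<delta>: "\<delta> > 0"
  obtains q :: "'a \<Rightarrow> nat" and V where "q \<in> measurable borel (count_space UNIV)" "finite (range q)"
    "\<And>x y. q x = q y \<Longrightarrow> dist x y < \<delta>"
    "open V" "measure \<nu> V = 1" "\<And>x. x \<in> V \<Longrightarrow> \<exists>U. open U \<and> x \<in> U \<and> (\<forall>y\<in>U. q y = q x)"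
proof -
  interpret prob_space \<nu> using \<nu> by (simp add: borel_probD)
  have "\<forall>x. \<exists>r. 0 < r \<and> r < \<delta> / 2 \<and> measure \<nu> (sphere x r) = 0"
    using null_sphere[OF \<nu>, of "\<delta> / 2"] \<delta> by auto
  from choice[OF this] obtain r where r: "\<And>x. 0 < r x" "\<And>x. r x < \<delta> / 2" "\<And>x. measure \<nu> (sphere x (r x)) = 0"
    by blast
  have "UNIV \<subseteq> (\<Union>x\<in>UNIV. ball x (r x))" using r(1) by auto
  from compactE_image[OF comp _ this] obtain F where F: "finite F" "UNIV \<subseteq> (\<Union>x\<in>F. ball x (r x))" by auto
  obtain l where l: "set l = F" using finite_list[OF F(1)] by blast
  define n where "n = length l"
  define B where "B i = ball (l ! i) (r (l ! i))" for i
  define S where "S i = sphere (l ! i) (r (l ! i))" for i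
  have cov: "\<exists>i<n. x \<in> B i" for x
  proof -
    obtain c where "c \<in> F" "x \<in> ball c (r c)" using F(2) by blast
    then show ?thesis using l by (auto simp: n_def B_def in_set_conv_nth)
  qed
  define q where "q x = (LEAST i. x \<in> B i)" for x
  have q: "x \<in> B (q x)" "q x < n" "\<And>i. i < q x \<Longrightarrow> x \<notin> B i" for x
  proof -
    obtain i where i: "i < n" "x \<in> B i" using cov by blast
    show "x \<in> B (q x)" unfolding q_def by (rule LeastI, rule i)
    have "q x \<le> i" unfolding q_def by (rule Least_le, rule i)
    then show "q x < n" using i by simp
    show "x \<notin> B i" if "i < q x" for i using that unfolding q_def by (rule not_less_Least)
  qed
  have qI: "q x = i" if "x \<in> B i" "\<And>j. j < i \<Longrightarrow> x \<notin> B j" for x i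
    using that q(1)[of x] q(3)[of i x] by (metis linorder_neqE_nat)
  define V where "V = - (\<Union>i<n. S i)"
  have S: "S i \<in> sets borel" for i unfolding S_def using closed_metric_sphere by (rule borel_closed)
  show ?thesis
  proof
    have "q -` {i} = B i - (\<Union>j<i. B j)" for i using q(1,3) qI by blast
    moreover have "B i \<in> sets borel" for i by (simp add: B_def)
    ultimately have "q -` {i} \<in> sets borel" for i by auto
    then show "q \<in> measurable borel (count_space UNIV)"
      by (subst measurable_count_space_eq_countable) auto
    show "finite (range q)" using q(2) by (intro finite_subset[of "range q" "{..<n}"]) auto
    show "dist x y < \<delta>" if "q x = q y" for x y
    proof -
      have "dist (l ! q x) x < \<delta> / 2" "dist (l ! q x) y < \<delta> / 2"
        using q(1)[of x] q(1)[of y] that r(2)[of "l ! q x"] by (auto simp: B_def intro: less_trans)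
      then show ?thesis using dist_triangle_half_r[of "l ! q x" x \<delta> y] by simp
    qed
    show "open V" unfolding V_def S_def by (intro open_Compl closed_UN) (auto simp: closed_metric_sphere)
    have "measure \<nu> (\<Union>i<n. S i) \<le> (\<Sum>i<n. measure \<nu> (S i))"
      by (intro finite_measure_subadditive_finite) (auto simp: borel_probD[OF \<nu>] S)
    also have "\<dots> = 0" using r(3) by (simp add: S_def)
    finally have "measure \<nu> (\<Union>i<n. S i) = 0" by (simp add: antisym)
    moreover have "(\<Union>i<n. S i) \<in> events" using S by (auto simp: borel_probD[OF \<nu>])
    ultimately show "measure \<nu> V = 1"
      using prob_compl[of "\<Union>i<n. S i"] by (auto simp: V_def borel_probD[OF \<nu>] S Compl_eq_Diff_UNIV)
    fix x assume x: "x \<in> V"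
    \<comment> \<open>Near \<open>x\<close>, stay in its ball and outside the closed balls with
      smaller index; \<open>x\<close> avoids those because it lies on none of the spheres.\<close>
    define U where "U = B (q x) \<inter> (\<Inter>j<q x. - cball (l ! j) (r (l ! j)))"
    have "open U" unfolding U_def B_def by (intro open_Int open_INT) auto
    moreover have "x \<in> U"
    proof -
      have "x \<notin> cball (l ! j) (r (l ! j))" if "j < q x" for j
      proof -
        have "x \<notin> B j" "x \<notin> S j" using q(3)[OF that] that q(2)[of x] x by (auto simp: V_def)
        then show ?thesis by (auto simp: B_def S_def)
      qed
      then show ?thesis using q(1)[of x] by (auto simp: U_def)
    qed
    moreover have "q y = q x" if "y \<in> U" for y
      using that by (intro qI) (force simp: U_def B_def)+
    ultimately show "\<exists>U. open U \<and> x \<in> U \<and> (\<forall>y\<in>U. q y = q x)" by blast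
  qed
qed

section \<open>Continuous flows\<close>

lemma
  assumes "continuous_flow f"
  shows continuous_flow_0: "f 0 x = x"
    and continuous_flow_add: "f (s + t) x = f s (f t x)"
    and continuous_flow_continuous: "continuous_on UNIV (f t)"
    and continuous_flow_continuous_time: "continuous_on A (\<lambda>s. f s x)"
    and continuous_flow_joint: "continuous_on UNIV (\<lambda>(t, x). f t x)"
proof -
  show "f 0 x = x" "f (s + t) x = f s (f t x)" "continuous_on UNIV (\<lambda>(t, x). f t x)"
    using assms by (auto simp: continuous_flow_def)
  then have c: "continuous_on UNIV (\<lambda>z. f (fst z) (snd z))" by (simp add: case_prod_unfold)
  show "continuous_on UNIV (f t)"
    using continuous_on_compose2[OF c, of UNIV "\<lambda>x. (t, x)"] by (simp add: continuous_intros)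
  show "continuous_on A (\<lambda>s. f s x)"
    using continuous_on_compose2[OF c, of A "\<lambda>s. (s, x)"] by (simp add: continuous_intros)
qed

lemma continuous_flow_funpow:
  assumes "continuous_flow f"
  shows "(f t ^^ n) x = f (real n * t) x"
  by (induction n) (simp_all add: continuous_flow_0[OF assms] distrib_right
      continuous_flow_add[OF assms, of t, symmetric])

lemma continuous_flow_inverse:
  assumes "continuous_flow f"
  shows "f (- t) (f t x) = x" "f t (f (- t) x) = x"
  using continuous_flow_add[OF assms, of "- t" t x] continuous_flow_add[OF assms, of t "- t" x]
  by (simp_all add: continuous_flow_0[OF assms])

lemma continuous_flow_equicontinuous:
  fixes f :: "real \<Rightarrow> 'a::metric_space \<Rightarrow> 'a"
  assumes comp: "compact (UNIV :: 'a set)" and f: "continuous_flow f" and e: "e > 0"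
  obtains d where "d > 0" "\<And>s x y. a \<le> s \<Longrightarrow> s \<le> b \<Longrightarrow> dist x y < d \<Longrightarrow> dist (f s x) (f s y) < e"
proof -
  have "uniformly_continuous_on ({a..b} \<times> UNIV) (\<lambda>(t, x). f t x)"
    using comp continuous_flow_joint[OF f]
    by (intro compact_uniformly_continuous compact_Times) (auto intro: continuous_on_subset)
  then obtain d where d: "d > 0" "\<And>z z'. z \<in> {a..b} \<times> UNIV \<Longrightarrow> z' \<in> {a..b} \<times> UNIV \<Longrightarrow> dist z' z < d \<Longrightarrow>
      dist ((\<lambda>(t, x). f t x) z') ((\<lambda>(t, x). f t x) z) < e"
    using e unfolding uniformly_continuous_on_def by meson
  show ?thesis
  proof (rule that[OF d(1)])
    fix s and x y :: 'a assume "a \<le> s" "s \<le> b" "dist x y < d"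
    then show "dist (f s x) (f s y) < e" using d(2)[of "(s, y)" "(s, x)"] by (simp add: dist_Pair_Pair)
  qed
qed

lemma continuous_flow_small_time:
  fixes f :: "real \<Rightarrow> 'a::metric_space \<Rightarrow> 'a" and g :: "'a \<Rightarrow> real"
  assumes comp: "compact (UNIV :: 'a set)" and f: "continuous_flow f" and g: "continuous_on UNIV g" and e: "e > 0"
  obtains d where "d > 0" "\<And>s x. \<bar>s\<bar> < d \<Longrightarrow> \<bar>g (f s x) - g x\<bar> < e"
proof -
  have "continuous_on UNIV (\<lambda>z. g ((\<lambda>(t, x). f t x) z))"
    by (rule continuous_on_compose2[OF g continuous_flow_joint[OF f]]) auto
  then have "uniformly_continuous_on ({-1..1} \<times> UNIV) (\<lambda>z. g ((\<lambda>(t, x). f t x) z))"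
    using comp by (intro compact_uniformly_continuous compact_Times) (auto intro: continuous_on_subset)
  then obtain d where d: "d > 0" "\<And>z z'. z \<in> {-1..1} \<times> UNIV \<Longrightarrow> z' \<in> {-1..1} \<times> UNIV \<Longrightarrow> dist z' z < d \<Longrightarrow>
      dist (g ((\<lambda>(t, x). f t x) z')) (g ((\<lambda>(t, x). f t x) z)) < e"
    using e unfolding uniformly_continuous_on_def by meson
  show ?thesis
  proof (rule that[of "min d 1"])
    show "min d 1 > 0" using d by simp
    fix s x assume "\<bar>s\<bar> < min d 1"
    then have "\<bar>s\<bar> < d" "- 1 \<le> s" "s \<le> 1" by (auto simp: abs_less_iff)
    then show "\<bar>g (f s x) - g x\<bar> < e"
      using d(2)[of "(0, x)" "(s, x)"] by (simp add: dist_Pair_Pair dist_real_def continuous_flow_0[OF f])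
  qed
qed

lemma orbit_integrable:
  fixes \<phi> :: "'a::topological_space \<Rightarrow> real"
  assumes "continuous_flow f" "continuous_on UNIV \<phi>"
  shows "(\<lambda>s. \<phi> (f s x)) integrable_on {a..b}"
  by (intro integrable_continuous_interval continuous_on_compose2[OF assms(2)]
      continuous_flow_continuous_time[OF assms(1)]) auto

text \<open>Each subinterval of length \<open>1 / m\<close> costs at most \<open>e / m\<close>,
  uniformly in the point. The bound is thus linear in \<open>n\<close>, with \<open>m0\<close>
  independent of \<open>n\<close> and \<open>x\<close>, and survives division by \<open>n\<close>
  and integration over \<open>x\<close>.\<close>

lemma orbit_riemann_sum:
  fixes f :: "real \<Rightarrow> 'a::metric_space \<Rightarrow> 'a" and g :: "'a \<Rightarrow> real"
  assumes comp: "compact (UNIV :: 'a set)" and f: "continuous_flow f" and g: "continuous_on UNIV g" and e: "e > 0"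
  obtains m0 where "\<And>m n x. m0 \<le> m \<Longrightarrow> 0 < m \<Longrightarrow>
    \<bar>integral {0..real n} (\<lambda>s. g (f s x)) - (\<Sum>j<n * m. g (f (real j / real m) x)) / real m\<bar> \<le> real n * e"
proof -
  obtain d where d: "d > 0" "\<And>s x. \<bar>s\<bar> < d \<Longrightarrow> \<bar>g (f s x) - g x\<bar> < e"
    using continuous_flow_small_time[OF comp f g e] by blast
  obtain m0 :: nat where m0: "real m0 > 1 / d" using reals_Archimedean2 by blast
  show ?thesis
  proof (rule that)
    fix m n :: nat and x assume m: "m0 \<le> m" "0 < m"
    have "1 / d < real m" using m0 m by linarith
    then have md: "1 / real m < d" using d m by (simp add: field_simps)
    have "\<bar>integral {0..real k / real m} (\<lambda>s. g (f s x)) - (\<Sum>j<k. g (f (real j / real m) x)) / real m\<bar>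
       \<le> real k / real m * e" for k
    proof (induction k)
      case (Suc k)
      let ?a = "real k / real m" and ?b = "real (Suc k) / real m"
      let ?h = "\<lambda>s. g (f s x)"
      have ab: "?a \<le> ?b" "0 \<le> ?a" using m by (auto simp: divide_right_mono)
      have len: "?b - ?a = 1 / real m" by (simp add: add_divide_distrib)
      have split: "integral {0..?b} ?h = integral {0..?a} ?h + integral {?a..?b} ?h"
        using Henstock_Kurzweil_Integration.integral_combine[OF ab(2,1) orbit_integrable[OF f g]] by simp
      have "norm (integral {?a..?b} (\<lambda>s. ?h s - ?h ?a)) \<le> e * (?b - ?a)"
      proof (rule integral_bound)
        show "continuous_on {?a..?b} (\<lambda>s. ?h s - ?h ?a)"
          by (intro continuous_intros continuous_on_compose2[OF g] continuous_flow_continuous_time[OF f]) auto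
        fix s assume s: "s \<in> {?a..?b}"
        then have "\<bar>s - ?a\<bar> < d" using len md by auto
        then have "\<bar>g (f (s - ?a) (f ?a x)) - g (f ?a x)\<bar> < e" by (rule d(2))
        then show "norm (?h s - ?h ?a) \<le> e" using continuous_flow_add[OF f, of "s - ?a" ?a x] by simp
      qed (rule ab)
      also have "integral {?a..?b} (\<lambda>s. ?h s - ?h ?a) = integral {?a..?b} ?h - ?h ?a / real m"
        using ab len by (subst integral_diff[OF orbit_integrable[OF f g]]) auto
      finally have "\<bar>integral {?a..?b} ?h - ?h ?a / real m\<bar> \<le> e / real m" using len by simp
      then show ?case using Suc unfolding split by (simp add: add_divide_distrib distrib_right)
    qed simp
    from this[of "n * m"] m(2)
    show "\<bar>integral {0..real n} (\<lambda>s. g (f s x)) - (\<Sum>j<n * m. g (f (real j / real m) x)) / real m\<bar> \<le> real n * e"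
      by simp
  qed
qed

section \<open>Invariant measures of a flow and lower bounds for their entropy\<close>

lemma invariant_measuresD:
  assumes "\<nu> \<in> invariant_measures f"
  shows "borel_prob \<nu>" "distr \<nu> borel (f t) = \<nu>"
  using assms by (auto simp: invariant_measures_def borel_prob_def)

lemma continuous_borel_prob_measurable:
  fixes g :: "'a::topological_space \<Rightarrow> 'b::topological_space"
  assumes "continuous_on UNIV g" "borel_prob \<nu>"
  shows "g \<in> measurable \<nu> borel"
  using borel_measurable_continuous_onI[OF assms(1)] measurable_cong_sets[OF borel_probD(2)[OF assms(2)] refl]
  by blast

lemma invariant_measure_preserving:
  assumes \<nu>: "\<nu> \<in> invariant_measures f" and f: "continuous_flow f"
  shows "measure_preserving \<nu> (f t)"
proof -
  note b = invariant_measuresD(1)[OF \<nu>]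
  interpret prob_space \<nu> using b by (rule borel_probD)
  have m: "f t \<in> measurable \<nu> borel"
    by (rule continuous_borel_prob_measurable[OF continuous_flow_continuous[OF f] b])
  show ?thesis
  proof
    show "f t \<in> measurable \<nu> \<nu>"
      using m measurable_cong_sets[OF refl borel_probD(2)[OF b]] by blast
    show "distr \<nu> \<nu> (f t) = \<nu>"
    proof -
      have "distr \<nu> \<nu> (f t) = distr \<nu> borel (f t)" by (rule distr_cong) (auto simp: borel_probD[OF b])
      then show ?thesis using invariant_measuresD(2)[OF \<nu>, of t] by simp
    qed
  qed
qed

lemma invariant_integral:
  fixes g :: "'a::topological_space \<Rightarrow> real"
  assumes \<nu>: "\<nu> \<in> invariant_measures f" and f: "continuous_flow f" and g: "continuous_on UNIV g"
  shows "(\<integral>x. g (f t x) \<partial>\<nu>) = (\<integral>x. g x \<partial>\<nu>)"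
  using integral_distr[OF continuous_borel_prob_measurable[OF continuous_flow_continuous[OF f] invariant_measuresD(1)[OF \<nu>]]
      borel_measurable_continuous_onI[OF g], of t] invariant_measuresD(2)[OF \<nu>, of t] by simp

lemma finite_labellings_iff_simple:
  assumes "space \<nu> = UNIV"
  shows "p \<in> finite_labellings \<nu> \<longleftrightarrow> simple_function \<nu> p"
proof
  assume p: "simple_function \<nu> p"
  then show "p \<in> finite_labellings \<nu>"
    using simple_functionD(1)[OF p] measurable_simple_function[OF p] assms by (simp add: finite_labellings_def)
qed (rule finite_labelling_simple)

lemma flow_entropy_upper:
  assumes "p \<in> finite_labellings \<nu>"
  shows "ereal (entropy_wrt_partition \<nu> (f 1) p) \<le> flow_entropy f \<nu>"
  unfolding flow_entropy_def ks_entropy_def by (rule SUP_upper[OF assms])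

section \<open>Entropy of joinings\<close>

lemma map_prod_funpow:
  fixes g :: "'a \<Rightarrow> 'a" and h :: "'b \<Rightarrow> 'b"
  shows "(map_prod g h ^^ n) z = ((g ^^ n) (fst z), (h ^^ n) (snd z))"
  by (induction n) auto

lemma product_flow_continuous:
  fixes f :: "real \<Rightarrow> 'a::metric_space \<Rightarrow> 'a"
  assumes f: "continuous_flow f"
  shows "continuous_flow (product_flow f)"
proof -
  have c: "continuous_on UNIV (\<lambda>z. f (fst z) (snd z))"
    using continuous_flow_joint[OF f] by (simp add: case_prod_unfold)
  have "continuous_on UNIV (\<lambda>z :: real \<times> 'a \<times> 'a. (f (fst z) (fst (snd z)), f (fst z) (snd (snd z))))"
    by (intro continuous_on_Pair continuous_on_compose2[OF c, of UNIV "\<lambda>z. (fst z, fst (snd z))", simplified]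
        continuous_on_compose2[OF c, of UNIV "\<lambda>z. (fst z, snd (snd z))", simplified] continuous_intros)
  moreover have "(\<lambda>(t, z). product_flow f t z) =
      (\<lambda>z :: real \<times> 'a \<times> 'a. (f (fst z) (fst (snd z)), f (fst z) (snd (snd z))))"
    by (auto simp: product_flow_def map_prod_def)
  ultimately show ?thesis
    by (auto simp: continuous_flow_def product_flow_def continuous_flow_0[OF f] continuous_flow_add[OF f])
qed

lemma compact_UNIV_prod:
  assumes "compact (UNIV :: 'a::metric_space set)"
  shows "compact (UNIV :: ('a \<times> 'a) set)"
  using compact_Times[OF assms assms] by simp

lemma factor_invariant:
  fixes f :: "real \<Rightarrow> 'a::metric_space \<Rightarrow> 'a"
  assumes f: "continuous_flow f" and g: "continuous_on UNIV g" and F: "continuous_flow F"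
    and \<nu>: "\<nu> \<in> invariant_measures F" and eq: "\<And>t z. g (F t z) = f t (g z)"
  shows "distr \<nu> borel g \<in> invariant_measures f"
proof -
  note b = invariant_measuresD(1)[OF \<nu>]
  interpret prob_space \<nu> using b by (rule borel_probD)
  have gm: "g \<in> measurable \<nu> borel" by (rule continuous_borel_prob_measurable[OF g b])
  have gb: "g \<in> measurable borel borel" by (rule borel_measurable_continuous_onI[OF g])
  have fm: "f t \<in> measurable borel borel" for t
    by (rule borel_measurable_continuous_onI[OF continuous_flow_continuous[OF f]])
  have Fm: "F t \<in> measurable \<nu> borel" for t
    by (rule continuous_borel_prob_measurable[OF continuous_flow_continuous[OF F] b])
  have "distr (distr \<nu> borel g) borel (f t) = distr \<nu> borel g" for t
  proof -
    have "distr (distr \<nu> borel g) borel (f t) = distr \<nu> borel (f t \<circ> g)" by (rule distr_distr[OF fm gm])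
    also have "f t \<circ> g = g \<circ> F t" using eq by (auto simp: comp_def)
    also have "distr \<nu> borel (g \<circ> F t) = distr (distr \<nu> borel (F t)) borel g" by (rule distr_distr[OF gb Fm, symmetric])
    finally show ?thesis by (simp add: invariant_measuresD(2)[OF \<nu>])
  qed
  then show ?thesis using prob_space_distr[OF gm] by (simp add: invariant_measures_def)
qed

text \<open>Product partitions of small mesh nearly determine any given partition of the product
  space, and an itinerary of a product partition is a pair of itineraries, whose joint entropy is
  subadditive.\<close>

lemma joining_entropy_le:
  fixes f :: "real \<Rightarrow> 'a::metric_space \<Rightarrow> 'a"
  assumes comp: "compact (UNIV :: 'a set)" and f: "continuous_flow f"
    and \<nu>: "\<nu> \<in> invariant_measures (product_flow f)"
  shows "flow_entropy (product_flow f) \<nu> \<le> flow_entropy f (distr \<nu> borel fst) + flow_entropy f (distr \<nu> borel snd)"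
proof -
  let ?F = "product_flow f"
  note F = product_flow_continuous[OF f]
  note b = invariant_measuresD(1)[OF \<nu>]
  define \<nu>1 where "\<nu>1 = distr \<nu> borel fst"
  define \<nu>2 where "\<nu>2 = distr \<nu> borel snd"
  have c: "continuous_on UNIV (fst :: 'a \<times> 'a \<Rightarrow> 'a)" "continuous_on UNIV (snd :: 'a \<times> 'a \<Rightarrow> 'a)"
    by (intro continuous_intros)+
  have inv: "\<nu>1 \<in> invariant_measures f" "\<nu>2 \<in> invariant_measures f"
    unfolding \<nu>1_def \<nu>2_def
    by (rule factor_invariant[OF f _ F \<nu>]; auto simp: c product_flow_def)+
  note b1 = invariant_measuresD(1)[OF inv(1)] and b2 = invariant_measuresD(1)[OF inv(2)]
  interpret M: measure_preserving \<nu> "?F 1" by (rule invariant_measure_preserving[OF \<nu> F])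
  interpret M1: measure_preserving \<nu>1 "f 1" by (rule invariant_measure_preserving[OF inv(1) f])
  interpret M2: measure_preserving \<nu>2 "f 1" by (rule invariant_measure_preserving[OF inv(2) f])
  note m1 = continuous_borel_prob_measurable[OF c(1) b] and m2 = continuous_borel_prob_measurable[OF c(2) b]
  have "ereal (entropy_wrt_partition \<nu> (?F 1) p) \<le> flow_entropy f \<nu>1 + flow_entropy f \<nu>2"
    if p: "p \<in> finite_labellings \<nu>" for p
  proof (rule ereal_le_epsilon2)
    fix e :: real assume e: "e > 0"
    obtain \<delta> where \<delta>: "\<delta> > 0" "\<And>q :: 'a \<times> 'a \<Rightarrow> nat. simple_function \<nu> q \<Longrightarrow>
        (\<And>x y. q x = q y \<Longrightarrow> dist x y < \<delta>) \<Longrightarrow>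
        partition_entropy \<nu> (\<lambda>x. (p x, q x)) \<le> partition_entropy \<nu> q + e"
      by (rule small_mesh_conditional_entropy[OF compact_UNIV_prod[OF comp] b p e]) blast
    have "\<delta> / 2 > 0" using \<delta> by simp
    obtain r :: "'a \<Rightarrow> nat" where r: "r \<in> measurable borel (count_space UNIV)" "finite (range r)"
        "\<And>x y. r x = r y \<Longrightarrow> dist x y < \<delta> / 2"
      by (rule null_boundary_partition[OF comp b1 \<open>\<delta> / 2 > 0\<close>]) blast
    have rb: "simple_function borel r"
      using r(1,2) by (intro finite_labelling_simple) (simp add: finite_labellings_def)
    have rf: "r \<in> finite_labellings \<nu>1" "r \<in> finite_labellings \<nu>2"
      using r by (auto simp: finite_labellings_def \<nu>1_def \<nu>2_def)
    note r1 = finite_labelling_simple[OF rf(1)] and r2 = finite_labelling_simple[OF rf(2)]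
    define q where "q z = prod_encode (r (fst z), r (snd z))" for z
    have rfst: "simple_function \<nu> (\<lambda>z. r (fst z))" "simple_function \<nu> (\<lambda>z. r (snd z))"
      using simple_function_comp[OF m1 rb] simple_function_comp[OF m2 rb] by (auto simp: comp_def)
    have q: "simple_function \<nu> q"
      using simple_function_compose[OF simple_function_Pair[OF rfst], of prod_encode]
      by (simp add: q_def[abs_def] comp_def)
    have mesh: "dist x y < \<delta>" if "q x = q y" for x y
    proof -
      have "dist (fst x) (fst y) < \<delta> / 2" "dist (snd x) (snd y) < \<delta> / 2"
        using that r(3) by (auto simp: q_def)
      moreover have "dist x y \<le> dist (fst x) (fst y) + dist (snd x) (snd y)"
        unfolding dist_prod_def by (rule sqrt_sum_squares_le_sum) auto
      ultimately show ?thesis by simp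
    qed
    have hp: "entropy_wrt_partition \<nu> (?F 1) p \<le> entropy_wrt_partition \<nu> (?F 1) q + e"
      using M.entropy_wrt_partition_compare[OF finite_labelling_simple[OF p] q] \<delta>(2)[OF q mesh] by simp
    have "entropy_wrt_partition \<nu> (?F 1) q \<le> entropy_wrt_partition \<nu>1 (f 1) r + entropy_wrt_partition \<nu>2 (f 1) r"
    proof (rule LIMSEQ_le[OF M.entropy_wrt_partition_lim[OF q]
          tendsto_add[OF M1.entropy_wrt_partition_lim[OF r1] M2.entropy_wrt_partition_lim[OF r2]]])
      have "partition_entropy \<nu> (itinerary (?F 1) q n) \<le>
         partition_entropy \<nu>1 (itinerary (f 1) r n) + partition_entropy \<nu>2 (itinerary (f 1) r n)" for n
      proof -
        have i1: "simple_function borel (itinerary (f 1) r n)"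
          using M1.simple_function_itinerary[OF r1, of n] by (simp add: \<nu>1_def simple_function_def)
        have s1: "simple_function \<nu> (\<lambda>z. itinerary (f 1) r n (fst z))" "simple_function \<nu> (\<lambda>z. itinerary (f 1) r n (snd z))"
          using simple_function_comp[OF m1 i1] simple_function_comp[OF m2 i1] by (auto simp: comp_def)
        have "partition_entropy \<nu> (itinerary (?F 1) q n) \<le>
          partition_entropy \<nu> (\<lambda>z. (itinerary (f 1) r n (fst z), itinerary (f 1) r n (snd z)))"
          by (rule partition_entropy_mono[OF M.prob_space_axioms simple_function_Pair[OF s1]])
             (auto simp: itinerary_def q_def product_flow_def map_prod_funpow)
        also have "\<dots> \<le> partition_entropy \<nu> (\<lambda>z. itinerary (f 1) r n (fst z)) + partition_entropy \<nu> (\<lambda>z. itinerary (f 1) r n (snd z))"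
          by (rule partition_entropy_Pair_le[OF M.prob_space_axioms s1])
        also have "\<dots> = partition_entropy \<nu>1 (itinerary (f 1) r n) + partition_entropy \<nu>2 (itinerary (f 1) r n)"
          unfolding \<nu>1_def \<nu>2_def
          by (simp add: partition_entropy_distr[OF M.prob_space_axioms m1 i1] partition_entropy_distr[OF M.prob_space_axioms m2 i1])
        finally show ?thesis .
      qed
      then show "\<exists>N. \<forall>n\<ge>N. partition_entropy \<nu> (itinerary (?F 1) q n) / real n \<le>
          partition_entropy \<nu>1 (itinerary (f 1) r n) / real n + partition_entropy \<nu>2 (itinerary (f 1) r n) / real n"
        by (auto simp: add_divide_distrib[symmetric] intro!: divide_right_mono)
    qed
    then have "entropy_wrt_partition \<nu> (?F 1) p \<le> entropy_wrt_partition \<nu>1 (f 1) r + entropy_wrt_partition \<nu>2 (f 1) r + e"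
      using hp by simp
    then have "ereal (entropy_wrt_partition \<nu> (?F 1) p) \<le>
        (ereal (entropy_wrt_partition \<nu>1 (f 1) r) + ereal (entropy_wrt_partition \<nu>2 (f 1) r)) + ereal e" by simp
    also have "\<dots> \<le> (flow_entropy f \<nu>1 + flow_entropy f \<nu>2) + ereal e"
      by (intro add_mono flow_entropy_upper rf order_refl)
    finally show "ereal (entropy_wrt_partition \<nu> (?F 1) p) \<le> (flow_entropy f \<nu>1 + flow_entropy f \<nu>2) + ereal e" .
  qed
  then show ?thesis
    unfolding flow_entropy_def[of ?F] ks_entropy_def \<nu>1_def[symmetric] \<nu>2_def[symmetric] by (intro SUP_least)
qed

section \<open>The measure pressure is at most the topological pressure\<close>

text \<open>Entropies are controlled along integer times, whereas the pressure is an upper limit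
  over real times.\<close>

lemma ereal_le_Limsup_subseq:
  fixes L :: "real \<Rightarrow> ereal" and a :: "nat \<Rightarrow> real"
  assumes X: "filterlim X at_top sequentially" and le: "eventually (\<lambda>n. ereal (a n) \<le> L (X n)) sequentially"
    and a: "a \<longlonglongrightarrow> l"
  shows "ereal l \<le> Limsup at_top L"
proof (rule ccontr)
  assume "\<not> ereal l \<le> Limsup at_top L"
  then have "Limsup at_top L < ereal l" by simp
  then obtain c where c: "Limsup at_top L < c" "c < ereal l" using dense by blast
  have "eventually (\<lambda>t. L t < c) at_top" by (rule Limsup_lessD[OF c(1)])
  then have "eventually (\<lambda>n. L (X n) < c) sequentially" using X by (rule eventually_compose_filterlim)
  with le have "eventually (\<lambda>n. ereal (a n) \<le> c) sequentially"
    by eventually_elim auto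
  moreover have "(\<lambda>n. ereal (a n)) \<longlonglongrightarrow> ereal l" using a by simp
  ultimately have "ereal l \<le> c" by (intro tendsto_upperbound) auto
  then show False using c by simp
qed

text \<open>Compactness of the time interval bounds the distances along the orbits, which gives the
  real supremum in \<open>bowen_dist\<close> its meaning.\<close>

lemma bowen_dist_le_iff:
  fixes f :: "real \<Rightarrow> 'a::metric_space \<Rightarrow> 'a"
  assumes f: "continuous_flow f" and t: "0 \<le> t"
  shows "bowen_dist f t x y \<le> \<delta> \<longleftrightarrow> (\<forall>s\<in>{0..t}. dist (f s x) (f s y) \<le> \<delta>)"
proof -
  have "continuous_on {0..t} (\<lambda>s. dist (f s x) (f s y))"
    by (intro continuous_intros continuous_flow_continuous_time[OF f])
  then have "bounded ((\<lambda>s. dist (f s x) (f s y)) ` {0..t})"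
    by (intro compact_imp_bounded compact_continuous_image compact_Icc)
  then have bdd: "bdd_above ((\<lambda>s. dist (f s x) (f s y)) ` {0..t})" by (rule bounded_imp_bdd_above)
  show ?thesis
    unfolding bowen_dist_def using t by (subst cSUP_le_iff[OF _ bdd]) auto
qed

text \<open>A separated set of maximal cardinality spans. Cardinalities are bounded because, by
  equicontinuity, two points near the same centre of a suitable finite cover are not
  separated.\<close>

lemma bowen_spanning_set:
  fixes f :: "real \<Rightarrow> 'a::metric_space \<Rightarrow> 'a"
  assumes comp: "compact (UNIV :: 'a set)" and f: "continuous_flow f" and t: "0 \<le> t" and \<delta>: "0 < \<delta>"
  obtains E where "E \<in> separated_sets f UNIV t \<delta>" "E \<noteq> {}" "\<And>x. \<exists>e\<in>E. bowen_dist f t e x \<le> \<delta>"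
proof -
  have "\<delta> / 2 > 0" using \<delta> by simp
  then obtain g where g: "g > 0" "\<And>s x y. 0 \<le> s \<Longrightarrow> s \<le> t \<Longrightarrow> dist x y < g \<Longrightarrow> dist (f s x) (f s y) < \<delta> / 2"
    by (rule continuous_flow_equicontinuous[OF comp f, of _ 0 t]) blast
  have "\<forall>e>0. \<exists>k. finite k \<and> (UNIV :: 'a set) \<subseteq> (\<Union>x\<in>k. ball x e)"
    using comp unfolding compact_eq_totally_bounded by blast
  from this[rule_format, OF g(1)] obtain F where F: "finite F" "UNIV \<subseteq> (\<Union>x\<in>F. ball (x :: 'a) g)"
    by blast
  have card: "card E \<le> card F" if E: "E \<in> separated_sets f UNIV t \<delta>" for E
  proof -
    have "\<forall>x. \<exists>c. c \<in> F \<and> dist c x < g"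
    proof
      fix x
      have "x \<in> (\<Union>c\<in>F. ball c g)" using F(2) by blast
      then show "\<exists>c. c \<in> F \<and> dist c x < g" by auto
    qed
    from choice[OF this] obtain c where c: "\<And>x. c x \<in> F" "\<And>x. dist (c x) x < g" by blast
    have "inj_on c E"
    proof (rule inj_onI, rule ccontr)
      fix x y assume xy: "x \<in> E" "y \<in> E" "c x = c y" "x \<noteq> y"
      have "bowen_dist f t x y \<le> \<delta>"
        unfolding bowen_dist_le_iff[OF f t]
      proof
        fix s assume "s \<in> {0..t}"
        then have "dist (f s (c x)) (f s x) < \<delta> / 2" "dist (f s (c x)) (f s y) < \<delta> / 2"
          using g(2)[OF _ _ c(2)[of x], of s] g(2)[OF _ _ c(2)[of y], of s] xy(3) by auto
        then show "dist (f s x) (f s y) \<le> \<delta>"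
          using dist_triangle_half_r[of "f s (c x)" "f s x" \<delta> "f s y"] by simp
      qed
      moreover have "\<delta> < bowen_dist f t x y" using E xy unfolding separated_sets_def by blast
      ultimately show False by simp
    qed
    then show ?thesis using c(1) F(1) by (intro card_inj_on_le[of c]) auto
  qed
  have single: "{undefined} \<in> separated_sets f UNIV t \<delta>" by (simp add: separated_sets_def)
  then obtain E where E: "E \<in> separated_sets f UNIV t \<delta>" "\<And>E'. E' \<in> separated_sets f UNIV t \<delta> \<Longrightarrow> card E' \<le> card E"
    using ex_has_greatest_nat[of "\<lambda>E. E \<in> separated_sets f UNIV t \<delta>" "{undefined}" card "Suc (card F)"] card
    by (auto simp: less_Suc_eq_le)
  have fin: "finite E" using E(1) by (simp add: separated_sets_def)
  show ?thesis
  proof (rule that[OF E(1)])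
    show "E \<noteq> {}" using E(2)[OF single] by auto
    fix x
    show "\<exists>e\<in>E. bowen_dist f t e x \<le> \<delta>"
    proof (rule ccontr)
      assume "\<not> ?thesis"
      then have far: "\<delta> < bowen_dist f t e x" if "e \<in> E" for e using that by auto
      have sym: "bowen_dist f t x e = bowen_dist f t e x" for e
        by (simp add: bowen_dist_def dist_commute)
      have "bowen_dist f t x x \<le> \<delta>" using \<delta> by (simp add: bowen_dist_le_iff[OF f t])
      then have "x \<notin> E" using far[of x] by linarith
      moreover have "insert x E \<in> separated_sets f UNIV t \<delta>"
      proof -
        have sep: "\<delta> < bowen_dist f t a b" if "a \<in> E" "b \<in> E" "a \<noteq> b" for a b
          using E(1) that by (simp add: separated_sets_def)
        have "\<delta> < bowen_dist f t a b" if "a \<in> insert x E" "b \<in> insert x E" "a \<noteq> b" for a b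
        proof (cases "a = x")
          case True
          then have "b \<in> E" using that by simp
          then show ?thesis using far[of b] sym[of b] True by simp
        next
          case False
          then have "a \<in> E" using that by simp
          then show ?thesis using far[of a] sep[of a b] that by (cases "b = x") auto
        qed
        then show ?thesis using fin by (simp add: separated_sets_def)
      qed
      ultimately show False using E(2)[of "insert x E"] fin by simp
    qed
  qed
qed

text \<open>The tangent inequality at the Gibbs weights \<open>exp (a v) / Z\<close>, summed over
  \<open>v\<close>; \<open>gibbs_pmf_exists\<close> realizes the case of equality.\<close>

lemma gibbs_inequality:
  fixes m a :: "'b \<Rightarrow> real"
  assumes V: "finite V" and m: "\<And>v. v \<in> V \<Longrightarrow> 0 \<le> m v" "(\<Sum>v\<in>V. m v) = 1"
  shows "- (\<Sum>v\<in>V. m v * ln (m v)) + (\<Sum>v\<in>V. m v * a v) \<le> ln (\<Sum>v\<in>V. exp (a v))"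
proof -
  define Z where "Z = (\<Sum>v\<in>V. exp (a v))"
  have "V \<noteq> {}" using m by auto
  then have Z: "Z > 0" unfolding Z_def using V by (intro sum_pos) auto
  have "(\<Sum>v\<in>V. m v * ln (exp (a v) / Z) + m v - exp (a v) / Z) \<le> (\<Sum>v\<in>V. m v * ln (m v))"
    using Z m by (intro sum_mono mult_ln_ge_tangent) auto
  moreover have "(\<Sum>v\<in>V. m v * ln (exp (a v) / Z) + m v - exp (a v) / Z) =
      (\<Sum>v\<in>V. m v * a v) - ln Z * (\<Sum>v\<in>V. m v) + (\<Sum>v\<in>V. m v) - (\<Sum>v\<in>V. exp (a v)) / Z"
    using Z by (simp add: ln_div sum.distrib sum_subtractf algebra_simps sum_distrib_left sum_divide_distrib)
  ultimately show ?thesis using Z m(2) by (simp add: Z_def[symmetric])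
qed

text \<open>Counts the itineraries assigned to one spanning point, whose orbit leaves at each time a
  choice between the label 0 and one other atom.\<close>

lemma card_lists_two_choices:
  assumes "\<And>v i. v \<in> A \<Longrightarrow> i < n \<Longrightarrow> v ! i \<in> {0, b i}" "\<And>v. v \<in> A \<Longrightarrow> length v = n"
  shows "card (A :: nat list set) \<le> 2 ^ n"
proof -
  have "card A \<le> card (PiE {..<n} (\<lambda>i. {0, b i}))"
  proof (rule card_inj_on_le[of "\<lambda>v. restrict ((!) v) {..<n}"])
    show "inj_on (\<lambda>v. restrict ((!) v) {..<n}) A"
    proof (rule inj_onI)
      fix v w assume vw: "v \<in> A" "w \<in> A" "restrict ((!) v) {..<n} = restrict ((!) w) {..<n}"
      show "v = w"
      proof (rule nth_equalityI)
        fix i assume "i < length v"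
        then have "i \<in> {..<n}" using assms(2)[OF vw(1)] by simp
        then show "v ! i = w ! i" using fun_cong[OF vw(3), of i] by simp
      qed (use assms(2) vw in simp)
    qed
    show "(\<lambda>v. restrict ((!) v) {..<n}) ` A \<subseteq> PiE {..<n} (\<lambda>i. {0, b i})"
    proof
      fix g assume "g \<in> (\<lambda>v. restrict ((!) v) {..<n}) ` A"
      then obtain v where "v \<in> A" "g = restrict ((!) v) {..<n}" by blast
      then show "g \<in> PiE {..<n} (\<lambda>i. {0, b i})"
        using assms(1)[of v] by (simp only: restrict_PiE_iff) blast
    qed
  qed (intro finite_PiE, auto)
  also have "\<dots> = (\<Prod>i<n. card {0, b i})" by (simp add: card_PiE)
  also have "\<dots> \<le> (\<Prod>i<n. 2)" by (intro prod_mono) (auto simp: card_insert_if)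
  finally show ?thesis by simp
qed

text \<open>Bounding \<open>R\<close> by a function of the label turns the integral into a finite
  sum over atoms, to which the Gibbs inequality applies.\<close>

lemma partition_entropy_plus_integral_le:
  assumes \<nu>: "prob_space \<nu>" and W: "simple_function \<nu> W" and R: "integrable \<nu> R"
    and le: "\<And>x. x \<in> space \<nu> \<Longrightarrow> R x \<le> a (W x) + c"
  shows "partition_entropy \<nu> W + (\<integral>x. R x \<partial>\<nu>) \<le> ln (\<Sum>v\<in>W ` space \<nu>. exp (a v)) + c"
proof -
  interpret prob_space \<nu> by fact
  define V where "V = W ` space \<nu>"
  have V: "finite V" unfolding V_def by (rule simple_functionD(1)[OF W])
  define m where "m v = prob (W -` {v} \<inter> space \<nu>)" for v
  note ev = simple_functionD(2)[OF W]
  have ind: "(\<Sum>v\<in>V. b v * indicator (W -` {v} \<inter> space \<nu>) x) = b (W x)" if "x \<in> space \<nu>" for x and b :: "_ \<Rightarrow> real"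
  proof -
    have "(\<Sum>v\<in>V. b v * indicator (W -` {v} \<inter> space \<nu>) x) = (\<Sum>v\<in>V. if v = W x then b v else 0)"
      using that by (intro sum.cong) auto
    then show ?thesis using that V by (simp add: V_def)
  qed
  have int: "integrable \<nu> (\<lambda>x. \<Sum>v\<in>V. b v * indicator (W -` {v} \<inter> space \<nu>) x)" for b :: "_ \<Rightarrow> real"
    by (intro Bochner_Integration.integrable_sum integrable_mult_right integrable_real_indicator ev)
       (simp add: emeasure_eq_measure)
  have val: "(\<integral>x. (\<Sum>v\<in>V. b v * indicator (W -` {v} \<inter> space \<nu>) x) \<partial>\<nu>) = (\<Sum>v\<in>V. b v * m v)" for b
    by (subst Bochner_Integration.integral_sum)
       (auto simp: m_def ev emeasure_eq_measure intro!: integrable_real_indicator)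
  have "(\<Sum>v\<in>V. 1 * m v) = (\<integral>x. 1 \<partial>\<nu>)"
    unfolding val[symmetric] by (intro Bochner_Integration.integral_cong refl) (rule ind)
  then have m1: "(\<Sum>v\<in>V. m v) = 1" by (simp add: prob_space)
  have "(\<integral>x. R x \<partial>\<nu>) \<le> (\<integral>x. (\<Sum>v\<in>V. a v * indicator (W -` {v} \<inter> space \<nu>) x) + c \<partial>\<nu>)"
    by (intro integral_mono R Bochner_Integration.integrable_add int integrable_const) (use le ind in auto)
  also have "\<dots> = (\<Sum>v\<in>V. a v * m v) + c"
    by (subst Bochner_Integration.integral_add[OF int]) (simp_all add: val prob_space)
  finally have "(\<integral>x. R x \<partial>\<nu>) \<le> (\<Sum>v\<in>V. m v * a v) + c" by (simp add: mult.commute)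
  moreover have "- (\<Sum>v\<in>V. m v * ln (m v)) + (\<Sum>v\<in>V. m v * a v) \<le> ln (\<Sum>v\<in>V. exp (a v))"
    by (rule gibbs_inequality[OF V _ m1]) (simp add: m_def)
  ultimately show ?thesis
    unfolding partition_entropy_eq[OF \<nu> W] V_def[symmetric] m_def[symmetric] by linarith
qed

text \<open>The atoms of \<open>q\<close> below are disjoint closed sets and their complement \<open>0\<close>, so a small ball meets at
  most two of them. This costs a factor \<open>2\<close>, and replacing \<open>q0\<close> by \<open>q\<close> costs entropy \<open>1\<close>, for each
  application of the time-\<open>N\<close> map, hence \<open>(1 + ln 2) / N\<close> per unit of time. The Riemann sums \<open>R\<close> replace
  the orbit integrals \<open>S\<close> because the product of the Borel \<open>\<sigma>\<close>-algebras need not be the Borel \<open>\<sigma>\<close>-algebra of the product for this type, which obstructs Fubini.\<close>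

lemma entropy_le_log_partition_function:
  fixes f :: "real \<Rightarrow> 'a::metric_space \<Rightarrow> 'a"
  assumes comp: "compact (UNIV :: 'a set)" and f: "continuous_flow f" and \<phi>: "continuous_on UNIV \<phi>"
    and \<nu>: "\<nu> \<in> invariant_measures f" and p: "p \<in> finite_labellings \<nu>" and N: "N > 0" and \<epsilon>: "\<epsilon> > 0"
  obtains \<delta> where "\<delta> > 0"
    "\<And>n. n > 0 \<Longrightarrow> ereal (partition_entropy \<nu> (itinerary (f 1) p (N * n)) / real (N * n) + (\<integral>x. \<phi> x \<partial>\<nu>)
        - ((1 + ln 2) / real N + 2 * \<epsilon>)) \<le> log_partition_function f UNIV \<phi> \<delta> (real (N * n)) / ereal (real (N * n))"
proof -
  note b = invariant_measuresD(1)[OF \<nu>]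
  note sp = finite_labelling_simple[OF p]
  let ?T = "f (real N)"
  interpret M1: measure_preserving \<nu> "f 1" by (rule invariant_measure_preserving[OF \<nu> f])
  interpret M: measure_preserving \<nu> ?T by (rule invariant_measure_preserving[OF \<nu> f])
  note P = M1.prob_space_axioms
  \<comment> \<open>One symbol of \<open>q0\<close> under the time-\<open>N\<close> map records
    \<open>N\<close> symbols of \<open>p\<close> under the time-one map, so fixed losses per symbol
    are divided by \<open>N\<close>.\<close>
  define q0 where "q0 x = list_encode (itinerary (f 1) p N x)" for x
  have q0: "simple_function \<nu> q0"
    using simple_function_compose[OF M1.simple_function_itinerary[OF sp, of N], of list_encode]
    by (simp add: q0_def[abs_def] comp_def)
  then have q0f: "q0 \<in> finite_labellings \<nu>" by (simp add: finite_labellings_iff_simple borel_probD[OF b])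
  obtain k where k: "range q0 \<subseteq> {..<k}" using finite_labelling_bounded[OF q0f] .
  obtain \<eta> where \<eta>: "\<eta> > 0"
    "\<And>\<nu> (p :: 'a \<Rightarrow> nat) p'. prob_space \<nu> \<Longrightarrow> simple_function \<nu> p \<Longrightarrow> simple_function \<nu> p' \<Longrightarrow>
      p ` space \<nu> \<subseteq> {..<k} \<Longrightarrow> p' ` space \<nu> \<subseteq> {..<k} \<Longrightarrow>
      measure \<nu> {x\<in>space \<nu>. p x \<noteq> p' x} < \<eta> \<Longrightarrow>
      partition_entropy \<nu> (\<lambda>x. (p x, p' x)) \<le> partition_entropy \<nu> p' + 1"
    by (rule partition_entropy_close[OF zero_less_one, of k]) blast
  obtain C d where d: "d > 0" and C: "\<And>i. closed (C i)" "\<And>i x. x \<in> C i \<Longrightarrow> q0 x = i"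
    "measure \<nu> (UNIV - (\<Union>i. C i)) < \<eta>"
    "\<And>i j x y. i \<noteq> j \<Longrightarrow> x \<in> C i \<Longrightarrow> y \<in> C j \<Longrightarrow> d \<le> dist x y"
    by (rule labelling_closed_approx[OF comp b q0f k \<eta>(1)]) blast
  define q where "q x = (if x \<in> (\<Union>i. C i) then Suc (q0 x) else 0)" for x
  have Cm: "(\<Union>i. C i) \<in> sets \<nu>" using C(1) by (auto simp: borel_probD[OF b])
  have "simple_function \<nu> (\<lambda>x. if x \<in> (\<Union>i. C i) then Suc (q0 x) else 0)"
  proof (rule simple_function_If_set[OF _ _ ])
    show "simple_function \<nu> (\<lambda>x. Suc (q0 x))"
      using simple_function_compose[OF q0, of Suc] by (simp add: comp_def)
    show "(\<Union>i. C i) \<inter> space \<nu> \<in> sets \<nu>" using Cm by (simp add: borel_probD[OF b])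
  qed simp
  then have q: "simple_function \<nu> q" by (simp add: q_def[abs_def])
  \<comment> \<open>Undoes the shift by \<open>Suc\<close> that keeps 0 free for the complement;
    \<open>q0 undefined\<close> is only a default below \<open>k\<close>.\<close>
  define g where "g l = (case l of 0 \<Rightarrow> q0 undefined | Suc j \<Rightarrow> j)" for l
  have gq: "simple_function \<nu> (\<lambda>x. g (q x))"
    using simple_function_compose[OF q, of g] by (simp add: comp_def)
  have "measure \<nu> {x\<in>space \<nu>. q0 x \<noteq> g (q x)} \<le> measure \<nu> (UNIV - (\<Union>i. C i))"
    by (intro M1.finite_measure_mono) (use Cm in \<open>auto simp: q_def g_def borel_probD[OF b]\<close>)
  moreover have "g (q x) < k" for x using k by (auto simp: g_def q_def)
  ultimately have "partition_entropy \<nu> (\<lambda>x. (q0 x, g (q x))) \<le> partition_entropy \<nu> (\<lambda>x. g (q x)) + 1"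
    using C(3) k by (intro \<eta>(2) P q0 gq) auto
  then have cond: "partition_entropy \<nu> (\<lambda>x. (q0 x, q x)) - partition_entropy \<nu> q \<le> 1"
    using conditional_entropy_le_factor[OF P q0 q, of g] by linarith
  have "uniformly_continuous_on UNIV \<phi>" using \<phi> comp by (rule compact_uniformly_continuous)
  then obtain \<delta>0 where \<delta>0: "\<delta>0 > 0" "\<And>x y. dist x y < \<delta>0 \<Longrightarrow> \<bar>\<phi> x - \<phi> y\<bar> < \<epsilon>"
    using \<epsilon> unfolding uniformly_continuous_on_def dist_real_def by (metis UNIV_I dist_commute)
  \<comment> \<open>A third makes \<open>2 * \<delta>\<close> smaller than the distance
    \<open>d\<close> of the closed atoms, so that a \<delta>-ball meets at most one, and keeps
    \<delta> below the scale \<delta>0 of \<phi>.\<close>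
  define \<delta> where "\<delta> = min d \<delta>0 / 3"
  have \<delta>: "\<delta> > 0" "2 * \<delta> < d" "\<delta> < \<delta>0" using d \<delta>0(1) by (auto simp: \<delta>_def)
  have "\<exists>b. \<forall>x. dist z x \<le> \<delta> \<longrightarrow> q x \<in> {0, b}" for z
  proof (cases "\<exists>y. dist z y \<le> \<delta> \<and> q y \<noteq> 0")
    case True
    then obtain y where y: "dist z y \<le> \<delta>" "q y \<noteq> 0" by blast
    have "q x = q y" if x: "dist z x \<le> \<delta>" "q x \<noteq> 0" for x
    proof (rule ccontr)
      assume ne: "q x \<noteq> q y"
      obtain i j where ij: "x \<in> C i" "y \<in> C j" using x(2) y(2) by (auto simp: q_def split: if_splits)
      then have "i \<noteq> j" using ne C(2)[OF ij(1)] C(2)[OF ij(2)] by (auto simp: q_def split: if_splits)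
      from C(4)[OF this ij] have "d \<le> dist x y" .
      moreover have "dist x y \<le> dist z x + dist z y" by (rule dist_triangle3)
      ultimately show False using x(1) y(1) \<delta>(2) by linarith
    qed
    then show ?thesis by (intro exI[of _ "q y"]) auto
  qed auto
  then have "\<forall>z. \<exists>b. \<forall>x. dist z x \<le> \<delta> \<longrightarrow> q x \<in> {0, b}" by blast
  from choice[OF this] obtain \<beta> where \<beta>: "\<And>z x. dist z x \<le> \<delta> \<Longrightarrow> q x \<in> {0, \<beta> z}" by blast
  show ?thesis
  proof (rule that[OF \<delta>(1)])
    fix n :: nat assume n: "n > 0"
    define t where "t = N * n"
    have t: "t > 0" using N n by (simp add: t_def)
    define S where "S x = integral {0..real t} (\<lambda>s. \<phi> (f s x))" for x
    obtain E where E: "E \<in> separated_sets f UNIV (real t) \<delta>" "E \<noteq> {}" "\<And>x. \<exists>e\<in>E. bowen_dist f (real t) e x \<le> \<delta>"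
      by (rule bowen_spanning_set[OF comp f of_nat_0_le_iff \<delta>(1), of t]) blast
    have fE: "finite E" using E(1) by (simp add: separated_sets_def)
    obtain m0 where m0: "\<And>m n x. m0 \<le> m \<Longrightarrow> 0 < m \<Longrightarrow>
      \<bar>integral {0..real n} (\<lambda>s. \<phi> (f s x)) - (\<Sum>j<n * m. \<phi> (f (real j / real m) x)) / real m\<bar> \<le> real n * \<epsilon>"
      by (rule orbit_riemann_sum[OF comp f \<phi> \<epsilon>]) blast
    define m where "m = Suc m0"
    have m: "m0 \<le> m" "0 < m" by (auto simp: m_def)
    define R where "R x = (\<Sum>j<t * m. \<phi> (f (real j / real m) x)) / real m" for x
    have cR: "continuous_on UNIV (\<lambda>x. \<phi> (f s x))" for s
      by (rule continuous_on_compose2[OF \<phi> continuous_flow_continuous[OF f]]) simp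
    note iR = continuous_borel_integrable[OF comp cR b]
    have intR: "integrable \<nu> R"
      unfolding R_def[abs_def] by (intro integrable_divide_zero Bochner_Integration.integrable_sum iR)
    have valR: "(\<integral>x. R x \<partial>\<nu>) = real t * (\<integral>x. \<phi> x \<partial>\<nu>)"
    proof -
      have "(\<integral>x. R x \<partial>\<nu>) = (\<Sum>j<t * m. (\<integral>x. \<phi> (f (real j / real m) x) \<partial>\<nu>)) / real m"
        unfolding R_def by (simp add: Bochner_Integration.integral_sum iR)
      also have "\<dots> = real t * real m * (\<integral>x. \<phi> x \<partial>\<nu>) / real m"
        by (simp add: invariant_integral[OF \<nu> f \<phi>])
      also have "\<dots> = real t * (\<integral>x. \<phi> x \<partial>\<nu>)" using m by simp
      finally show ?thesis .
    qed
    have RS: "R x \<le> S x + real t * \<epsilon>" for x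
      using m0[OF m, of t x] by (simp add: R_def S_def abs_le_iff)
    have S_close: "S x \<le> S e + real t * \<epsilon>" if "bowen_dist f (real t) e x \<le> \<delta>" for x e
    proof -
      have "norm (integral {0..real t} (\<lambda>s. \<phi> (f s x) - \<phi> (f s e))) \<le> \<epsilon> * (real t - 0)"
      proof (rule integral_bound)
        show "continuous_on {0..real t} (\<lambda>s. \<phi> (f s x) - \<phi> (f s e))"
          by (intro continuous_intros continuous_on_compose2[OF \<phi>] continuous_flow_continuous_time[OF f]) auto
        fix s assume "s \<in> {0..real t}"
        then have "dist (f s e) (f s x) \<le> \<delta>" using that by (simp add: bowen_dist_le_iff[OF f])
        then have "dist (f s x) (f s e) < \<delta>0" using \<delta>(3) by (simp add: dist_commute)
        then show "norm (\<phi> (f s x) - \<phi> (f s e)) \<le> \<epsilon>" using \<delta>0(2) by (force intro: less_imp_le)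
      qed simp
      then show ?thesis
        unfolding S_def by (subst (asm) integral_diff) (auto intro: orbit_integrable[OF f \<phi>] simp: mult.commute)
    qed
    let ?W = "itinerary ?T q n"
    note W = M.simple_function_itinerary[OF q, of n]
    have Wi: "?W x ! i = q (f (real i * real N) x)" if "i < n" for x i
      using that by (simp add: itinerary_def continuous_flow_funpow[OF f])
    \<comment> \<open>Spanning points shadowing some point with itinerary \<open>v\<close>. Taking
      for \<open>e v\<close> the one with the largest orbit integral bounds \<open>R x\<close> for
      every \<open>x\<close> with that itinerary.\<close>
    define G where "G v = {e \<in> E. \<exists>x. ?W x = v \<and> bowen_dist f (real t) e x \<le> \<delta>}" for v
    have "\<exists>e. e \<in> G v \<and> (\<forall>e'\<in>G v. S e' \<le> S e)" if v: "v \<in> range ?W" for v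
    proof -
      have "finite (G v)" using fE by (simp add: G_def)
      moreover obtain x where "v = ?W x" using v by blast
      moreover obtain e where "e \<in> E" "bowen_dist f (real t) e x \<le> \<delta>" using E(3) by blast
      ultimately have fG: "finite (G v)" "G v \<noteq> {}" unfolding G_def by blast+
      then have "Max (S ` G v) \<in> S ` G v" by (intro Max_in) auto
      then obtain e where "e \<in> G v" "S e = Max (S ` G v)" by auto
      then show ?thesis using fG by (intro exI[of _ e]) auto
    qed
    note ex = this
    define e where "e v = (SOME e. e \<in> G v \<and> (\<forall>e'\<in>G v. S e' \<le> S e))" for v
    have e: "e v \<in> G v" "\<And>e'. e' \<in> G v \<Longrightarrow> S e' \<le> S (e v)" if "v \<in> range ?W" for v
      using someI_ex[OF ex[OF that]] unfolding e_def by auto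
    have "R x \<le> S (e (?W x)) + 2 * real t * \<epsilon>" for x
    proof -
      obtain e' where e': "e' \<in> E" "bowen_dist f (real t) e' x \<le> \<delta>" using E(3) by blast
      then have "e' \<in> G (?W x)" unfolding G_def by blast
      then have "S e' \<le> S (e (?W x))" by (rule e(2)[OF rangeI])
      moreover have "S x \<le> S e' + real t * \<epsilon>" by (rule S_close[OF e'(2)])
      ultimately show ?thesis using RS[of x] by (simp add: mult.assoc)
    qed
    then have 1: "partition_entropy \<nu> ?W + real t * (\<integral>x. \<phi> x \<partial>\<nu>) \<le>
        ln (\<Sum>v\<in>range ?W. exp (S (e v))) + 2 * real t * \<epsilon>"
      using partition_entropy_plus_integral_le[OF P W intR, of "\<lambda>v. S (e v)"] by (simp add: valR borel_probD[OF b])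
    have fW: "finite (range ?W)" using simple_functionD(1)[OF W] by (simp add: borel_probD[OF b])
    have "(\<Sum>v\<in>range ?W. exp (S (e v))) = (\<Sum>e'\<in>e ` range ?W. \<Sum>v\<in>{v\<in>range ?W. e v = e'}. exp (S (e v)))"
      by (rule sum.image_gen[OF fW])
    also have "\<dots> = (\<Sum>e'\<in>e ` range ?W. real (card {v\<in>range ?W. e v = e'}) * exp (S e'))"
      by (intro sum.cong) auto
    also have "\<dots> \<le> (\<Sum>e'\<in>e ` range ?W. 2 ^ n * exp (S e'))"
    proof (intro sum_mono mult_right_mono)
      fix e'
      \<comment> \<open>The orbit of \<open>e'\<close> is \<delta>-close to that of some point with
        itinerary \<open>v\<close> at all times \<open>i * N\<close>, so each symbol of
        \<open>v\<close> is 0 or fixed by \<open>e'\<close>.\<close>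
      have "card {v\<in>range ?W. e v = e'} \<le> 2 ^ n"
      proof (rule card_lists_two_choices[where b="\<lambda>i. \<beta> (f (real i * real N) e')"])
        fix v i assume v: "v \<in> {v\<in>range ?W. e v = e'}" and i: "i < n"
        then have "e' \<in> G v" using e(1)[of v] by blast
        then obtain x where x: "?W x = v" "bowen_dist f (real t) e' x \<le> \<delta>" by (auto simp: G_def)
        have "real i * real N \<le> real t" using i by (simp add: t_def mult.commute flip: of_nat_mult)
        then have "dist (f (real i * real N) e') (f (real i * real N) x) \<le> \<delta>"
          using x(2) by (simp add: bowen_dist_le_iff[OF f])
        from \<beta>[OF this] show "v ! i \<in> {0, \<beta> (f (real i * real N) e')}" using Wi[OF i, of x] x(1) by simp
      qed (auto simp: itinerary_def)
      then show "real (card {v\<in>range ?W. e v = e'}) \<le> 2 ^ n" by (metis of_nat_le_iff of_nat_numeral of_nat_power)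
    qed simp
    also have "\<dots> \<le> (\<Sum>e'\<in>E. 2 ^ n * exp (S e'))"
      using e(1) by (intro sum_mono2 fE) (auto simp: G_def)
    also have "\<dots> = 2 ^ n * (\<Sum>e'\<in>E. exp (S e'))" by (simp add: sum_distrib_left)
    finally have 2: "(\<Sum>v\<in>range ?W. exp (S (e v))) \<le> 2 ^ n * (\<Sum>e'\<in>E. exp (S e'))" .
    have posE: "(\<Sum>e'\<in>E. exp (S e')) > 0" using E(2) fE by (intro sum_pos) auto
    have posW: "(\<Sum>v\<in>range ?W. exp (S (e v))) > 0" using fW by (intro sum_pos) auto
    have 3: "ln (\<Sum>v\<in>range ?W. exp (S (e v))) \<le> real n * ln 2 + ln (\<Sum>e'\<in>E. exp (S e'))"
    proof -
      have "ln (\<Sum>v\<in>range ?W. exp (S (e v))) \<le> ln (2 ^ n * (\<Sum>e'\<in>E. exp (S e')))"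
        using 2 posW by (intro ln_mono) auto
      also have "\<dots> = real n * ln 2 + ln (\<Sum>e'\<in>E. exp (S e'))"
        using posE by (simp add: ln_mult ln_realpow)
      finally show ?thesis .
    qed
    \<comment> \<open>Time \<open>j\<close> is \<open>j div N\<close> steps of the
      time-\<open>N\<close> map followed by \<open>j mod N\<close> unit steps, so the
      \<open>q0\<close>-itinerary determines all \<open>N * n\<close> symbols of
      \<open>p\<close>.\<close>
    have 4: "partition_entropy \<nu> (itinerary (f 1) p t) \<le> partition_entropy \<nu> (itinerary ?T q0 n)"
    proof (rule partition_entropy_mono[OF P M.simple_function_itinerary[OF q0]])
      fix x y assume eq: "itinerary ?T q0 n x = itinerary ?T q0 n y"
      have "p ((f 1 ^^ j) x) = p ((f 1 ^^ j) y)" if j: "j < t" for j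
      proof -
        have jn: "j div N < n" using j by (simp add: t_def less_mult_imp_div_less mult.commute)
        have jm: "j mod N < N" using N by simp
        have "itinerary (f 1) p N ((?T ^^ (j div N)) x) = itinerary (f 1) p N ((?T ^^ (j div N)) y)"
        proof -
          have "\<forall>i\<in>{0..<n}. q0 ((?T ^^ i) x) = q0 ((?T ^^ i) y)" using eq by (simp add: itinerary_def)
          then have "q0 ((?T ^^ (j div N)) x) = q0 ((?T ^^ (j div N)) y)" using jn by simp
          then show ?thesis by (simp only: q0_def list_encode_eq)
        qed
        then have "p ((f 1 ^^ (j mod N)) ((?T ^^ (j div N)) x)) = p ((f 1 ^^ (j mod N)) ((?T ^^ (j div N)) y))"
          using jm by (simp add: itinerary_def)
        moreover have "(f 1 ^^ (j mod N)) ((?T ^^ (j div N)) z) = (f 1 ^^ j) z" for z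
        proof -
          have "real (j mod N) + real (j div N) * real N = real j"
            by (simp flip: of_nat_mult of_nat_add)
          then show ?thesis by (simp add: continuous_flow_funpow[OF f] flip: continuous_flow_add[OF f])
        qed
        ultimately show ?thesis by simp
      qed
      then show "itinerary (f 1) p t x = itinerary (f 1) p t y" by (simp add: itinerary_def)
    qed
    have 5: "partition_entropy \<nu> (itinerary ?T q0 n) \<le> partition_entropy \<nu> ?W + real n"
    proof -
      have "real n * (partition_entropy \<nu> (\<lambda>x. (q0 x, q x)) - partition_entropy \<nu> q) \<le> real n * 1"
        using cond by (intro mult_left_mono) auto
      then show ?thesis using M.itinerary_entropy_compare[OF q0 q, of n] by linarith
    qed
    have "partition_entropy \<nu> (itinerary (f 1) p t) + real t * (\<integral>x. \<phi> x \<partial>\<nu>) - real n * (1 + ln 2) - 2 * real t * \<epsilon>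
        \<le> ln (\<Sum>e'\<in>E. exp (S e'))"
      using 1 3 4 5 by (simp add: algebra_simps)
    then have "(partition_entropy \<nu> (itinerary (f 1) p t) + real t * (\<integral>x. \<phi> x \<partial>\<nu>) - real n * (1 + ln 2) - 2 * real t * \<epsilon>) / real t
        \<le> ln (\<Sum>e'\<in>E. exp (S e')) / real t"
      by (rule divide_right_mono) simp
    moreover have "real n / real t = 1 / real N" using n N by (simp add: t_def)
    then have "(partition_entropy \<nu> (itinerary (f 1) p t) + real t * (\<integral>x. \<phi> x \<partial>\<nu>) - real n * (1 + ln 2) - 2 * real t * \<epsilon>) / real t
      = partition_entropy \<nu> (itinerary (f 1) p t) / real t + (\<integral>x. \<phi> x \<partial>\<nu>) - ((1 + ln 2) / real N + 2 * \<epsilon>)"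
      using t n N by (simp add: t_def field_simps)
    ultimately have "ereal (partition_entropy \<nu> (itinerary (f 1) p t) / real t + (\<integral>x. \<phi> x \<partial>\<nu>) - ((1 + ln 2) / real N + 2 * \<epsilon>))
      \<le> ereal (ln (\<Sum>e'\<in>E. exp (S e'))) / ereal (real t)" using t by simp
    also have "\<dots> \<le> log_partition_function f UNIV \<phi> \<delta> (real t) / ereal (real t)"
    proof (rule ereal_divide_right_mono)
      show "ereal (ln (\<Sum>e'\<in>E. exp (S e'))) \<le> log_partition_function f UNIV \<phi> \<delta> (real t)"
        unfolding log_partition_function_def S_def using E(1,2) by (intro SUP_upper) auto
    qed (use t in simp)
    finally show "ereal (partition_entropy \<nu> (itinerary (f 1) p (N * n)) / real (N * n) + (\<integral>x. \<phi> x \<partial>\<nu>)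
        - ((1 + ln 2) / real N + 2 * \<epsilon>)) \<le> log_partition_function f UNIV \<phi> \<delta> (real (N * n)) / ereal (real (N * n))"
      unfolding t_def .
  qed
qed

text \<open>The upper half of the variational principle. For each partition the loss
  \<open>(1 + ln 2) / N + 2 * (\<epsilon> / 4)\<close> is at most \<epsilon> once \<open>N\<close>
  is large, and the limit along multiples of \<open>N\<close> is the partition's entropy
  rate.\<close>

theorem measure_pressure_le_topological_pressure:
  fixes f :: "real \<Rightarrow> 'a::metric_space \<Rightarrow> 'a"
  assumes comp: "compact (UNIV :: 'a set)" and f: "continuous_flow f" and \<phi>: "continuous_on UNIV \<phi>"
    and \<nu>: "\<nu> \<in> invariant_measures f"
  shows "measure_pressure f \<phi> \<nu> \<le> topological_pressure f UNIV \<phi>"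
proof -
  let ?P = "topological_pressure f UNIV \<phi>" and ?I = "\<integral>x. \<phi> x \<partial>\<nu>"
  interpret M: measure_preserving \<nu> "f 1" by (rule invariant_measure_preserving[OF \<nu> f])
  have "ereal (entropy_wrt_partition \<nu> (f 1) p + ?I) \<le> ?P" if p: "p \<in> finite_labellings \<nu>" for p
  proof (rule ereal_le_epsilon2)
    fix \<epsilon> :: real assume \<epsilon>: "\<epsilon> > 0"
    let ?h = "entropy_wrt_partition \<nu> (f 1) p"
    obtain N :: nat where N: "real N > 2 * (1 + ln 2) / \<epsilon>" using reals_Archimedean2 by blast
    have "2 * (1 + ln 2) / \<epsilon> > 0" using \<epsilon> by (intro divide_pos_pos) (auto intro: add_pos_pos)
    then have N0: "N > 0" using N by (cases N) auto
    have Ne: "(1 + ln 2) / real N \<le> \<epsilon> / 2" using N N0 \<epsilon> by (simp add: field_simps)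
    have "\<epsilon> / 4 > 0" using \<epsilon> by simp
    from entropy_le_log_partition_function[OF comp f \<phi> \<nu> p N0 this]
    obtain \<delta> where \<delta>: "\<delta> > 0"
      "\<And>n. n > 0 \<Longrightarrow> ereal (partition_entropy \<nu> (itinerary (f 1) p (N * n)) / real (N * n) + ?I
        - ((1 + ln 2) / real N + 2 * (\<epsilon> / 4))) \<le> log_partition_function f UNIV \<phi> \<delta> (real (N * n)) / ereal (real (N * n))"
      by blast
    have sub: "filterlim (\<lambda>n. N * n) at_top sequentially"
      using N0 by (intro filterlim_subseq strict_monoI) auto
    have "ereal (?h + ?I - ((1 + ln 2) / real N + 2 * (\<epsilon> / 4))) \<le> pressure_at_scale f UNIV \<phi> \<delta>"
      unfolding pressure_at_scale_def
    proof (rule ereal_le_Limsup_subseq[where X="\<lambda>n. real (N * n)"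
          and a="\<lambda>n. partition_entropy \<nu> (itinerary (f 1) p (N * n)) / real (N * n) + ?I
        - ((1 + ln 2) / real N + 2 * (\<epsilon> / 4))"])
      show "filterlim (\<lambda>n. real (N * n)) at_top sequentially"
        by (rule filterlim_compose[OF filterlim_real_sequentially sub])
      show "(\<lambda>n. partition_entropy \<nu> (itinerary (f 1) p (N * n)) / real (N * n) + ?I
          - ((1 + ln 2) / real N + 2 * (\<epsilon> / 4))) \<longlonglongrightarrow> ?h + ?I - ((1 + ln 2) / real N + 2 * (\<epsilon> / 4))"
        by (intro tendsto_intros filterlim_compose[OF M.entropy_wrt_partition_lim[OF finite_labelling_simple[OF p]] sub])
    qed (use \<delta>(2) in \<open>auto simp: eventually_sequentially intro!: exI[of _ 1]\<close>)
    also have "\<dots> \<le> ?P" unfolding topological_pressure_def using \<delta>(1) by (intro SUP_upper) auto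
    finally have "ereal (?h + ?I - ((1 + ln 2) / real N + 2 * (\<epsilon> / 4))) + ereal \<epsilon> \<le> ?P + ereal \<epsilon>"
      by (rule add_right_mono)
    moreover have "?h + ?I \<le> ?h + ?I - ((1 + ln 2) / real N + 2 * (\<epsilon> / 4)) + \<epsilon>" using Ne by simp
    ultimately show "ereal (?h + ?I) \<le> ?P + ereal \<epsilon>"
      using order_trans[of "ereal (?h + ?I)"] by (simp only: plus_ereal.simps ereal_less_eq(3)) (metis ereal_less_eq(3))
  qed
  then have "ereal (entropy_wrt_partition \<nu> (f 1) p) \<le> ?P - ereal ?I" if "p \<in> finite_labellings \<nu>" for p
    using that by (simp add: ereal_le_minus)
  then have "flow_entropy f \<nu> \<le> ?P - ereal ?I"
    unfolding flow_entropy_def ks_entropy_def by (rule SUP_least)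
  then show ?thesis unfolding measure_pressure_def by (simp add: ereal_le_minus)
qed

section \<open>Misiurewicz's construction of measures of large pressure\<close>

lemma simple_function_measure_pmf: "finite (range g) \<Longrightarrow> simple_function (measure_pmf P) g"
  by (simp add: simple_function_def)

lemma finite_range_itinerary:
  assumes "finite (range p)" shows "finite (range (itinerary T p n))"
proof (rule finite_subset)
  show "range (itinerary T p n) \<subseteq> {xs. set xs \<subseteq> range p \<and> length xs = n}"
    by (auto simp: itinerary_def)
qed (rule finite_lists_length_eq[OF assms])

lemma finite_range_comp: "finite (range g) \<Longrightarrow> finite (range (\<lambda>x. g (h x)))"
  by (rule finite_subset[of _ "range g"]) auto

text \<open>For each offset \<open>r < q\<close>, cut \<open>{r..<n}\<close> into blocks of length \<open>q\<close> and use subadditivity, then sum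
  over \<open>r\<close>.\<close>

lemma itinerary_entropy_blocks:
  fixes P :: "'a pmf"
  assumes p: "range p \<subseteq> {..<k}" and q: "q > 0"
  shows "real q * partition_entropy P (itinerary T p n) \<le>
    (\<Sum>i<n. partition_entropy P (\<lambda>x. itinerary T p q ((T ^^ i) x))) + (real q)\<^sup>2 * ln (real k)"
proof -
  let ?H = "partition_entropy (measure_pmf P)"
  let ?I = "itinerary T p"
  note ps = measure_pmf.prob_space_axioms[of P]
  have fp: "finite (range p)" using p finite_subset by blast
  have pk: "p y < k" for y using p by blast
  have k: "k > 0" using pk[of undefined] by simp
  have si: "simple_function (measure_pmf P) (\<lambda>x. ?I n (g x))" for n g
    by (rule simple_function_measure_pmf, rule finite_range_comp, rule finite_range_itinerary[OF fp])
  note si' = si[of _ "\<lambda>x. x"]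
  have add: "?H (?I (m + n)) \<le> ?H (?I m) + ?H (\<lambda>x. ?I n ((T ^^ m) x))" for m n
  proof -
    have "?H (?I (m + n)) \<le> ?H (\<lambda>x. (?I m x, ?I n ((T ^^ m) x)))"
      by (rule partition_entropy_mono[OF ps simple_function_Pair[OF si' si]]) (simp add: itinerary_add)
    also have "\<dots> \<le> ?H (?I m) + ?H (\<lambda>x. ?I n ((T ^^ m) x))"
      by (rule partition_entropy_Pair_le[OF ps si' si])
    finally show ?thesis .
  qed
  have mono: "?H (\<lambda>x. ?I m ((T ^^ i) x)) \<le> ?H (\<lambda>x. ?I n ((T ^^ i) x))" if "m \<le> n" for m n i
    by (rule partition_entropy_mono[OF ps si]) (use that in \<open>simp add: itinerary_def\<close>)
  have short: "?H (?I n) \<le> real n * ln (real k)" for n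
  proof -
    have sub: "range (?I n) \<subseteq> {xs. set xs \<subseteq> {..<k} \<and> length xs = n}" by (auto simp: itinerary_def pk)
    have "card (range (?I n)) \<le> k ^ n"
      using card_mono[OF finite_lists_length_eq sub] by (simp add: card_lists_length_eq)
    moreover have "card (range (?I n)) > 0"
      using finite_range_itinerary[OF fp] by (simp add: card_gt_0_iff)
    ultimately have "ln (real (card (range (?I n)))) \<le> ln (real (k ^ n))" by (intro ln_mono) auto
    also have "\<dots> = real n * ln (real k)" using k by (simp add: ln_realpow)
    finally show ?thesis using partition_entropy_le_card[OF ps si', of n] by simp
  qed
  define h where "h i = ?H (\<lambda>x. ?I q ((T ^^ i) x))" for i
  \<comment> \<open>The first \<open>r\<close> symbols cost at most \<open>ln k\<close> each. The
    last block may be shorter than \<open>q\<close> and is bounded by a full one.\<close>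
  have block: "?H (?I n) \<le> real r * ln (real k) + (\<Sum>i\<in>{i\<in>{..<n}. i mod q = r}. h i)" if r: "r < q" for r n
  proof (induction n rule: less_induct)
    case (less n)
    show ?case
    proof (cases "n \<le> r")
      case True
      then have e: "{i\<in>{..<n}. i mod q = r} = {}" using r by auto
      have "real n * ln (real k) \<le> real r * ln (real k)" using True k by (intro mult_right_mono) auto
      then show ?thesis using short[of n] unfolding e by simp
    next
      case False
      \<comment> \<open>The start of the last block: the largest index below \<open>n\<close>
        congruent to \<open>r\<close> modulo \<open>q\<close>.\<close>
      define i where "i = r + q * ((n - 1 - r) div q)"
      have qd: "q * ((n - 1 - r) div q) \<le> n - 1 - r" "n - 1 - r < q * ((n - 1 - r) div q) + q"
        using q by (simp_all add: mult_div_mod_eq[symmetric] dividend_less_times_div add.commute)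
      have nr: "n - 1 - r + r + 1 = n" using False by simp
      have i: "i < n" "n \<le> i + q" using qd nr unfolding i_def by linarith+
      have "i mod q = r" using r by (simp add: i_def)
      note i = i this
      have "{j\<in>{..<n}. j mod q = r} = insert i {j\<in>{..<i}. j mod q = r}"
      proof (intro set_eqI iffI)
        fix j assume "j \<in> {j\<in>{..<n}. j mod q = r}"
        then have j: "j < n" "j mod q = r" by auto
        have "j \<le> i"
        proof (rule ccontr)
          assume "\<not> j \<le> i"
          then have "q dvd (j - i)" using j i(3) by (metis mod_eq_dvd_iff_nat nat_le_linear)
          moreover have "0 < j - i" "j - i < q" using \<open>\<not> j \<le> i\<close> j i by auto
          ultimately show False by (auto dest: dvd_imp_le)
        qed
        then show "j \<in> insert i {j\<in>{..<i}. j mod q = r}" using j by auto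
      qed (use i in auto)
      then have sum: "(\<Sum>j\<in>{j\<in>{..<n}. j mod q = r}. h j) = h i + (\<Sum>j\<in>{j\<in>{..<i}. j mod q = r}. h j)" by simp
      have "?H (?I n) \<le> ?H (?I i) + ?H (\<lambda>x. ?I (n - i) ((T ^^ i) x))" using add[of i "n - i"] i by simp
      also have "?H (\<lambda>x. ?I (n - i) ((T ^^ i) x)) \<le> h i" unfolding h_def using i by (intro mono) simp
      finally show ?thesis using less.IH[OF i(1)] unfolding sum by simp
    qed
  qed
  have "real q * ?H (?I n) = (\<Sum>r<q. ?H (?I n))" by simp
  also have "\<dots> \<le> (\<Sum>r<q. real r * ln (real k) + (\<Sum>i\<in>{i\<in>{..<n}. i mod q = r}. h i))"
    by (intro sum_mono block) simp
  also have "\<dots> = (\<Sum>r<q. real r * ln (real k)) + (\<Sum>i<n. h i)"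
    by (simp only: sum.distrib) (subst sum.group[of "{..<n}" "{..<q}" "\<lambda>i. i mod q" h]; use q in auto)
  also have "(\<Sum>r<q. real r * ln (real k)) \<le> (\<Sum>r<q. real q * ln (real k))"
    using k by (intro sum_mono mult_right_mono) auto
  finally show ?thesis by (simp add: h_def power2_eq_square)
qed

text \<open>Equality in the Gibbs inequality, attained by the weights \<open>exp (S x) / Z\<close>.
  A labelling injective on \<open>E\<close> sees the full entropy of the weights, as
  \<open>P\<close> lives on \<open>E\<close>.\<close>

lemma gibbs_pmf_exists:
  fixes S :: "'a \<Rightarrow> real"
  assumes E: "finite E" "E \<noteq> {}"
  obtains P :: "'a pmf" where "set_pmf P \<subseteq> E"
    "\<And>W. finite (range W) \<Longrightarrow> inj_on W E \<Longrightarrow>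
      partition_entropy P W = ln (\<Sum>x\<in>E. exp (S x)) - (\<integral>x. S x \<partial>P)"
proof -
  define Z where "Z = (\<Sum>x\<in>E. exp (S x))"
  have Z: "Z > 0" unfolding Z_def using E by (intro sum_pos) auto
  define w where "w x = (if x \<in> E then exp (S x) / Z else 0)" for x
  have wn: "0 \<le> w x" for x using Z by (simp add: w_def)
  have w1: "(\<integral>\<^sup>+x. ennreal (w x) \<partial>count_space UNIV) = 1"
  proof -
    have "(\<integral>\<^sup>+x. ennreal (w x) \<partial>count_space UNIV) = (\<Sum>x\<in>E. ennreal (w x))"
      by (rule nn_integral_count_space'[OF E(1)]) (auto simp: w_def)
    also have "\<dots> = ennreal (\<Sum>x\<in>E. w x)" using wn by simp
    also have "(\<Sum>x\<in>E. w x) = 1" using Z by (simp add: w_def Z_def sum_divide_distrib[symmetric])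
    finally show ?thesis by simp
  qed
  define P where "P = embed_pmf w"
  have P: "pmf P x = w x" for x unfolding P_def by (rule pmf_embed_pmf[OF wn w1])
  show ?thesis
  proof
    show sub: "set_pmf P \<subseteq> E" by (auto simp: set_pmf_eq P w_def)
    fix W :: "'a \<Rightarrow> 'b" assume W: "finite (range W)" "inj_on W E"
    have m: "measure_pmf.prob P (W -` {W x}) = w x" if "x \<in> E" for x
    proof -
      have "measure_pmf.prob P (W -` {W x}) = measure_pmf.prob P {x}"
        by (rule measure_prob_cong_0) (use W(2) that sub in \<open>auto simp: inj_on_def set_pmf_eq\<close>)
      then show ?thesis by (simp add: measure_pmf_single P)
    qed
    have m0: "measure_pmf.prob P (W -` {v}) = 0" if "v \<notin> W ` E" for v
      using that sub by (subst measure_pmf_zero_iff) auto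
    have "partition_entropy P W = - (\<Sum>v\<in>range W. measure_pmf.prob P (W -` {v}) * ln (measure_pmf.prob P (W -` {v})))"
      using partition_entropy_eq[OF measure_pmf.prob_space_axioms simple_function_measure_pmf[OF W(1)]] by simp
    also have "(\<Sum>v\<in>range W. measure_pmf.prob P (W -` {v}) * ln (measure_pmf.prob P (W -` {v}))) =
        (\<Sum>v\<in>W ` E. measure_pmf.prob P (W -` {v}) * ln (measure_pmf.prob P (W -` {v})))"
      using W(1) m0 by (intro sum.mono_neutral_right) auto
    also have "\<dots> = (\<Sum>x\<in>E. w x * ln (w x))"
      by (subst sum.reindex[OF W(2)]) (simp add: m)
    also have "\<dots> = (\<Sum>x\<in>E. w x * S x) - (\<Sum>x\<in>E. w x) * ln Z"
      using Z by (simp add: w_def ln_div sum_subtractf right_diff_distrib sum_distrib_right)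
    also have "(\<Sum>x\<in>E. w x) = 1" using Z by (simp add: w_def Z_def sum_divide_distrib[symmetric])
    also have "(\<Sum>x\<in>E. w x * S x) = (\<integral>x. S x \<partial>P)"
      using integral_measure_pmf_real[OF E(1), of P S] sub by (simp add: P mult.commute subset_iff)
    finally show "partition_entropy P W = ln (\<Sum>x\<in>E. exp (S x)) - (\<integral>x. S x \<partial>P)" by (simp add: Z_def)
  qed
qed

text \<open>The convex combination is the law obtained by drawing the index first, which yields its
  measures and integrals from those of \<open>bind\<close>.\<close>

lemma finite_mixture_exists:
  fixes N :: "'i \<Rightarrow> 'a::topological_space measure"
  assumes I: "finite I" "\<And>i. i \<in> I \<Longrightarrow> 0 \<le> w i" "(\<Sum>i\<in>I. w i) = 1" and N: "\<And>i. i \<in> I \<Longrightarrow> borel_prob (N i)"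
  obtains M where "borel_prob M" "\<And>A. A \<in> sets borel \<Longrightarrow> measure M A = (\<Sum>i\<in>I. w i * measure (N i) A)"
    "\<And>g :: 'a \<Rightarrow> real. compact (UNIV :: 'a set) \<Longrightarrow> continuous_on UNIV g \<Longrightarrow>
      (\<integral>x. g x \<partial>M) = (\<Sum>i\<in>I. w i * (\<integral>x. g x \<partial>N i))"
proof -
  define v where "v i = (if i \<in> I then w i else 0)" for i
  have vn: "0 \<le> v i" for i using I by (simp add: v_def)
  have v1: "(\<integral>\<^sup>+x. ennreal (v x) \<partial>count_space UNIV) = 1"
  proof -
    have "(\<integral>\<^sup>+x. ennreal (v x) \<partial>count_space UNIV) = (\<Sum>x\<in>I. ennreal (v x))"
      by (rule nn_integral_count_space'[OF I(1)]) (auto simp: v_def)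
    also have "\<dots> = ennreal (\<Sum>x\<in>I. v x)" using vn by simp
    also have "(\<Sum>x\<in>I. v x) = 1" using I by (simp add: v_def)
    finally show ?thesis by simp
  qed
  define V where "V = embed_pmf v"
  have V: "pmf V x = v x" for x unfolding V_def by (rule pmf_embed_pmf[OF vn v1])
  have VI: "set_pmf V \<subseteq> I" by (auto simp: set_pmf_eq V v_def)
  obtain i0 where i0: "i0 \<in> I" using I(3) by (cases "I = {}") auto
  \<comment> \<open>Outside \<open>I\<close> the kernel takes the harmless value
    \<open>N i0\<close>, so that it consists of probability measures everywhere.\<close>
  define K where "K i = (if i \<in> I then N i else N i0)" for i
  have Kb: "borel_prob (K i)" for i using N i0 by (simp add: K_def)
  have Kp: "K \<in> measurable (measure_pmf V) (prob_algebra borel)"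
    using Kb by (simp add: measurable_def space_prob_algebra borel_prob_def)
  then have Ks: "K \<in> measurable (measure_pmf V) (subprob_algebra borel)" by (rule measurable_prob_algebraD)
  define M where "M = measure_pmf V \<bind> K"
  have setsM: "sets M = sets borel"
    unfolding M_def by (rule sets_bind[where N=borel]) (use Kb in \<open>auto simp: borel_prob_def\<close>)
  have "prob_space M"
    unfolding M_def by (rule prob_space_bind'[OF _ Kp]) (simp add: space_prob_algebra measure_pmf.prob_space_axioms)
  then have bM: "borel_prob M" using setsM by (simp add: borel_prob_def)
  interpret M: prob_space M by fact
  have ms: "measure M A = (\<Sum>i\<in>I. w i * measure (N i) A)" if A: "A \<in> sets borel" for A
  proof -
    have "measure M A = (\<integral>i. measure (K i) A \<partial>measure_pmf V)"
      unfolding M_def by (rule measure_pmf.measure_bind[OF Ks A])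
    also have "\<dots> = (\<Sum>i\<in>I. measure (K i) A * pmf V i)"
      by (rule integral_measure_pmf_real[OF I(1)]) (use VI in auto)
    also have "\<dots> = (\<Sum>i\<in>I. w i * measure (N i) A)"
      by (intro sum.cong) (auto simp: K_def V v_def)
    finally show ?thesis .
  qed
  have "(\<integral>x. g x \<partial>M) = (\<Sum>i\<in>I. w i * (\<integral>x. g x \<partial>N i))"
    if comp: "compact (UNIV :: 'a set)" and g: "continuous_on UNIV g" for g :: "'a \<Rightarrow> real"
  proof -
    obtain B where B: "\<And>x. \<bar>g x\<bar> \<le> B" using compact_range_bounded[OF comp g] by blast
    have "(\<integral>x. g x \<partial>M) = (\<integral>i. (\<integral>x. g x \<partial>K i) \<partial>measure_pmf V)"
      unfolding M_def
    proof (rule integral_bind[where B'=1, OF _ _ Ks])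
      show "g \<in> borel_measurable borel" by (rule borel_measurable_continuous_onI[OF g])
      show "AE i in measure_pmf V. emeasure (K i) (space (K i)) \<le> ennreal 1"
        using prob_space.emeasure_space_1[OF borel_probD(1)[OF Kb]] by simp
    qed (use B in auto)
    also have "\<dots> = (\<Sum>i\<in>I. (\<integral>x. g x \<partial>K i) * pmf V i)"
      by (rule integral_measure_pmf_real[OF I(1)]) (use VI in auto)
    also have "\<dots> = (\<Sum>i\<in>I. w i * (\<integral>x. g x \<partial>N i))"
      by (intro sum.cong) (auto simp: K_def V v_def)
    finally show ?thesis .
  qed
  with bM ms show ?thesis by (rule that)
qed

section \<open>Empirical measures along separated orbit segments\<close>

lemma simple_function_itinerary_borel:
  assumes T: "T \<in> measurable borel borel" and p: "simple_function borel p"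
  shows "simple_function borel (itinerary T p n)"
proof (induction n)
  case 0
  then show ?case by (simp add: itinerary_def)
next
  case (Suc n)
  have "(T ^^ n) \<in> measurable borel borel"
    by (induction n) (auto intro: measurable_compose[OF _ T] simp: comp_def)
  then have "simple_function borel (\<lambda>x. p ((T ^^ n) x))"
    using simple_function_comp[OF _ p, of "T ^^ n"] by (simp add: comp_def)
  moreover have "itinerary T p (Suc n) = (\<lambda>(l, a). l @ [a]) \<circ> (\<lambda>x. (itinerary T p n x, p ((T ^^ n) x)))"
    by (auto simp: itinerary_def)
  ultimately show ?case
    by (simp only:) (intro simple_function_compose simple_function_Pair Suc)
qed

text \<open>The labels control the orbits at the times \<open>\<tau> + i\<close>. Every time in the
  interval lies within 1 of such a time, and \<open>equi\<close> carries closeness over this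
  gap.\<close>

lemma itinerary_determines_orbit:
  fixes F :: "real \<Rightarrow> 'b::metric_space \<Rightarrow> 'b"
  assumes F: "continuous_flow F" and t: "0 \<le> t" "t \<le> real n" and n: "n > 0" and \<tau>: "0 \<le> \<tau>" "\<tau> \<le> 1"
    and eq: "itinerary (F 1) (\<lambda>x. p (F \<tau> x)) n x = itinerary (F 1) (\<lambda>x. p (F \<tau> x)) n y"
    and mesh: "\<And>x y. p x = p y \<Longrightarrow> dist x y < d"
    and equi: "\<And>s x y. - 1 \<le> s \<Longrightarrow> s \<le> 1 \<Longrightarrow> dist x y < d \<Longrightarrow> dist (F s x) (F s y) \<le> \<delta>"
  shows "bowen_dist F t x y \<le> \<delta>"
  unfolding bowen_dist_le_iff[OF F t(1)]
proof
  fix s assume s: "s \<in> {0..t}"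
  \<comment> \<open>The minimum matters for \<open>s = n\<close>, where the floor would exceed the
    last index \<open>n - 1\<close>.\<close>
  define i where "i = min (nat \<lfloor>s\<rfloor>) (n - 1)"
  have i: "i < n" using n by (auto simp: i_def)
  have "real i \<le> s"
  proof -
    have "real i \<le> real (nat \<lfloor>s\<rfloor>)" by (simp add: i_def)
    also have "\<dots> \<le> s" using s by (intro of_nat_floor) simp
    finally show ?thesis .
  qed
  moreover have "s \<le> real i + 1"
  proof (cases "nat \<lfloor>s\<rfloor> \<le> n - 1")
    case True
    then show ?thesis using s by (simp add: i_def)
  next
    case False
    then show ?thesis using s t n by (simp add: i_def of_nat_diff)
  qed
  ultimately have r: "- 1 \<le> s - (\<tau> + real i)" "s - (\<tau> + real i) \<le> 1" using \<tau> by auto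
  have "\<forall>i\<in>{0..<n}. p (F \<tau> ((F 1 ^^ i) x)) = p (F \<tau> ((F 1 ^^ i) y))"
    using eq by (simp add: itinerary_def)
  then have "p (F (\<tau> + real i) x) = p (F (\<tau> + real i) y)"
    using i by (simp add: continuous_flow_funpow[OF F] continuous_flow_add[OF F])
  from equi[OF r mesh[OF this]] show "dist (F s x) (F s y) \<le> \<delta>"
    by (simp flip: continuous_flow_add[OF F])
qed

text \<open>The index \<open>i * m + j\<close> stands for the time \<open>i + j / m\<close>.
  Grouping by the offset \<open>j\<close> leaves whole time-one itineraries in the inner
  sum.\<close>

lemma sum_blocks: "(\<Sum>l<n * m. h l) = (\<Sum>j<m. \<Sum>i<n. h (i * m + j))" for h :: "nat \<Rightarrow> 'c::comm_monoid_add"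
proof -
  have "(\<Sum>l<n * m. h l) = (\<Sum>i<n. \<Sum>l\<in>{i * m..<i * m + m}. h l)"
    by (rule sum.nat_group[symmetric])
  also have "\<dots> = (\<Sum>i<n. \<Sum>j<m. h (i * m + j))"
  proof (rule sum.cong[OF refl])
    fix i
    show "(\<Sum>l\<in>{i * m..<i * m + m}. h l) = (\<Sum>j<m. h (i * m + j))"
      using sum.shift_bounds_nat_ivl[of h 0 "i * m" m] by (simp add: add.commute lessThan_atLeast0)
  qed
  also have "\<dots> = (\<Sum>j<m. \<Sum>i<n. h (i * m + j))" by (rule sum.swap)
  finally show ?thesis .
qed

text \<open>Averaging over the discrete times \<open>l / m\<close> keeps all measures finitely supported. In return,
  invariance under the whole flow only appears in the limit \<open>m \<rightarrow> \<infinity>\<close>.\<close>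

lemma misiurewicz_stage:
  fixes F :: "real \<Rightarrow> 'b::metric_space \<Rightarrow> 'b"
  assumes comp: "compact (UNIV :: 'b set)" and F: "continuous_flow F"
    and B: "closed B" "\<And>t x. x \<in> B \<Longrightarrow> F t x \<in> B"
    and E: "E \<in> separated_sets F B t \<delta>" "E \<noteq> {}" and t: "0 \<le> t" "t \<le> real n" and n: "n > 0" and m: "m > 0"
    and equi: "\<And>s x y. - 1 \<le> s \<Longrightarrow> s \<le> 1 \<Longrightarrow> dist x y < d \<Longrightarrow> dist (F s x) (F s y) \<le> \<delta>"
  obtains P :: "'b pmf" and M where "borel_prob M" "measure M B = 1" "finite (set_pmf P)"
    "\<And>g :: 'b \<Rightarrow> real. continuous_on UNIV g \<Longrightarrow>
      (\<integral>x. g x \<partial>M) = (\<integral>x. (\<Sum>l<n * m. g (F (real l / real m) x)) / real m \<partial>P) / real n"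
    "\<And>p k q. p \<in> measurable borel (count_space UNIV) \<Longrightarrow> range p \<subseteq> {..<k} \<Longrightarrow> q > 0 \<Longrightarrow>
      (\<And>x y. p x = p y \<Longrightarrow> dist x y < d) \<Longrightarrow>
      real q * (ln (\<Sum>x\<in>E. exp (S x)) - (\<integral>x. S x \<partial>P)) \<le>
        real n * partition_entropy M (itinerary (F 1) p q) + (real q)\<^sup>2 * ln (real k)"
proof -
  have fE: "finite E" and EB: "E \<subseteq> B"
    and sep: "\<And>x y. x \<in> E \<Longrightarrow> y \<in> E \<Longrightarrow> x \<noteq> y \<Longrightarrow> \<delta> < bowen_dist F t x y"
    using E(1) by (auto simp: separated_sets_def)
  obtain P :: "'b pmf" where P: "set_pmf P \<subseteq> E"
    "\<And>W :: 'b \<Rightarrow> nat list. finite (range W) \<Longrightarrow> inj_on W E \<Longrightarrow>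
      partition_entropy P W = ln (\<Sum>x\<in>E. exp (S x)) - (\<integral>x. S x \<partial>P)"
    using gibbs_pmf_exists[OF fE E(2), of S] by metis
  have fP: "finite (set_pmf P)" using P(1) fE by (rule finite_subset)
  define N where "N l = distr (measure_pmf P) borel (F (real l / real m))" for l
  have Fm: "F s \<in> measurable (measure_pmf P) borel" for s by simp
  have Fb: "F s \<in> measurable borel borel" for s
    by (rule borel_measurable_continuous_onI[OF continuous_flow_continuous[OF F]])
  have Nb: "borel_prob (N l)" for l
    unfolding borel_prob_def N_def by (simp add: measure_pmf.prob_space_distr[OF Fm])
  define w where "w = (1 / real (n * m))"
  have w1: "(\<Sum>l<n * m. w) = 1" using n m by (simp add: w_def)
  have w0: "0 \<le> w" by (simp add: w_def)
  obtain M where M: "borel_prob M"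
    "\<And>A. A \<in> sets borel \<Longrightarrow> measure M A = (\<Sum>l<n * m. w * measure (N l) A)"
    "\<And>g :: 'b \<Rightarrow> real. compact (UNIV :: 'b set) \<Longrightarrow> continuous_on UNIV g \<Longrightarrow>
      (\<integral>x. g x \<partial>M) = (\<Sum>l<n * m. w * (\<integral>x. g x \<partial>N l))"
    by (rule finite_mixture_exists[of "{..<n * m}" "\<lambda>_. w" N]) (use w1 w0 Nb in auto)
  show ?thesis
  proof (rule that[OF M(1) _ fP])
    have "measure (N l) B = 1" for l
    proof -
      have "measure (N l) B = measure_pmf.prob P (F (real l / real m) -` B)"
        unfolding N_def using B(1) by (subst measure_distr[OF Fm]) auto
      also have "\<dots> = 1"
        using P(1) EB B(2) by (subst measure_pmf.prob_eq_1) (auto simp: AE_measure_pmf_iff)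
      finally show ?thesis .
    qed
    then show "measure M B = 1" using M(2)[of B] B(1) w1 by simp
  next
    fix g :: "'b \<Rightarrow> real" assume g: "continuous_on UNIV g"
    have int: "integrable (measure_pmf P) h" for h :: "'b \<Rightarrow> real"
      by (rule integrable_measure_pmf_finite[OF fP])
    have "(\<integral>x. g x \<partial>N l) = (\<integral>x. g (F (real l / real m) x) \<partial>P)" for l
      unfolding N_def by (rule integral_distr[OF Fm borel_measurable_continuous_onI[OF g]])
    then have "(\<integral>x. g x \<partial>M) = w * (\<Sum>l<n * m. \<integral>x. g (F (real l / real m) x) \<partial>P)"
      using M(3)[OF comp g] by (simp add: sum_distrib_left)
    also have "(\<Sum>l<n * m. \<integral>x. g (F (real l / real m) x) \<partial>P) = (\<integral>x. (\<Sum>l<n * m. g (F (real l / real m) x)) \<partial>P)"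
      by (rule Bochner_Integration.integral_sum[symmetric]) (rule int)
    also have "w * \<dots> = (\<integral>x. (\<Sum>l<n * m. g (F (real l / real m) x)) / real m \<partial>P) / real n"
      by (simp add: w_def)
    finally show "(\<integral>x. g x \<partial>M) = (\<integral>x. (\<Sum>l<n * m. g (F (real l / real m) x)) / real m \<partial>P) / real n" .
  next
    fix p :: "'b \<Rightarrow> nat" and k q :: nat
    assume p: "p \<in> measurable borel (count_space UNIV)" and k: "range p \<subseteq> {..<k}" and q: "q > 0"
      and mesh: "\<And>x y. p x = p y \<Longrightarrow> dist x y < d"
    let ?T = "F 1" and ?D = "ln (\<Sum>x\<in>E. exp (S x)) - (\<integral>x. S x \<partial>P)"
    let ?c = "(real q)\<^sup>2 * ln (real k)"
    have fp: "finite (range p)" using k finite_subset by blast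
    have sp: "simple_function borel p"
      using p fp by (intro finite_labelling_simple) (simp add: finite_labellings_def)
    have sI: "simple_function borel (itinerary ?T p q)" by (rule simple_function_itinerary_borel[OF Fb sp])
    have sM: "simple_function M (itinerary ?T p q)"
      using sI borel_probD[OF M(1)] by (simp add: simple_function_def)
    \<comment> \<open>The offset \<open>j / m\<close> commutes with the time-one map and is absorbed
      into the labelling, leaving \<open>i\<close> unit steps as in
      \<open>itinerary_entropy_blocks\<close>.\<close>
    have HN: "partition_entropy (N (i * m + j)) (itinerary ?T p q) =
        partition_entropy P (\<lambda>x. itinerary ?T (\<lambda>x. p (F (real j / real m) x)) q ((?T ^^ i) x))" if "j < m" for i j
    proof -
      have "partition_entropy (N (i * m + j)) (itinerary ?T p q) =
          partition_entropy P (\<lambda>x. itinerary ?T p q (F (real (i * m + j) / real m) x))"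
        unfolding N_def by (rule partition_entropy_distr[OF measure_pmf.prob_space_axioms Fm sI])
      also have "(\<lambda>x. itinerary ?T p q (F (real (i * m + j) / real m) x)) =
          (\<lambda>x. itinerary ?T (\<lambda>x. p (F (real j / real m) x)) q ((?T ^^ i) x))"
      proof
        fix x
        have "(?T ^^ a) (F (real (i * m + j) / real m) x) = F (real j / real m) ((?T ^^ a) ((?T ^^ i) x))" for a
        proof -
          have "real a + real (i * m + j) / real m = real j / real m + (real a + real i)"
            using m by (simp add: field_simps)
          then show ?thesis
            by (simp add: continuous_flow_funpow[OF F] add.left_commute flip: continuous_flow_add[OF F])
        qed
        then show "itinerary ?T p q (F (real (i * m + j) / real m) x) =
          itinerary ?T (\<lambda>x. p (F (real j / real m) x)) q ((?T ^^ i) x)" by (simp add: itinerary_def)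
      qed
      finally show ?thesis .
    qed
    \<comment> \<open>Points of \<open>E\<close> are separated, so for each offset their
      \<open>n\<close>-step itineraries differ and the Gibbs weights have entropy
      \<open>?D\<close>.\<close>
    have blk: "real q * ?D - ?c \<le> (\<Sum>i<n. partition_entropy (N (i * m + j)) (itinerary ?T p q))" if j: "j < m" for j
    proof -
      let ?p = "\<lambda>x. p (F (real j / real m) x)"
      have k': "range ?p \<subseteq> {..<k}" using k by auto
      have "inj_on (itinerary ?T ?p n) E"
      proof (rule inj_onI, rule ccontr)
        fix x y assume xy: "x \<in> E" "y \<in> E" "itinerary ?T ?p n x = itinerary ?T ?p n y" "x \<noteq> y"
        have "bowen_dist F t x y \<le> \<delta>"
          by (rule itinerary_determines_orbit[OF F t n _ _ xy(3) mesh equi]) (use j in auto)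
        then show False using sep[OF xy(1,2,4)] by simp
      qed
      moreover have "finite (range (itinerary ?T ?p n))"
        by (rule finite_range_itinerary) (rule finite_subset[OF k'], simp)
      ultimately have "partition_entropy P (itinerary ?T ?p n) = ?D" by (intro P(2))
      then show ?thesis
        using itinerary_entropy_blocks[OF k' q, of P ?T n] HN[OF j] by simp
    qed
    \<comment> \<open>Summing over the offsets collects all sample times; concavity then passes from
      the average of the entropies to the entropy of the average \<open>M\<close>.\<close>
    have "real m * (real q * ?D - ?c) = (\<Sum>j<m. real q * ?D - ?c)" by simp
    also have "\<dots> \<le> (\<Sum>j<m. \<Sum>i<n. partition_entropy (N (i * m + j)) (itinerary ?T p q))"
      by (intro sum_mono blk) simp
    also have "\<dots> = (\<Sum>l<n * m. partition_entropy (N l) (itinerary ?T p q))" by (rule sum_blocks[symmetric])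
    also have "\<dots> = real (n * m) * (\<Sum>l<n * m. w * partition_entropy (N l) (itinerary ?T p q))"
      using n m by (simp add: w_def sum_distrib_left)
    also have "\<dots> \<le> real (n * m) * partition_entropy M (itinerary ?T p q)"
    proof (intro mult_left_mono partition_entropy_concave[OF borel_probD(1)[OF M(1)] sM])
      show "sets (N i) = sets M" for i using borel_probD(2)[OF Nb] borel_probD(2)[OF M(1)] by simp
      show "measure M A = (\<Sum>i<n * m. w * measure (N i) A)" if "A \<in> sets M" for A
        using M(2) that borel_probD(2)[OF M(1)] by simp
    qed (use w0 w1 borel_probD(1)[OF Nb] in auto)
    finally have "real m * (real q * ?D - ?c) \<le> real m * (real n * partition_entropy M (itinerary ?T p q))"
      by (simp add: mult.assoc mult.left_commute)
    then have "real q * ?D - ?c \<le> real n * partition_entropy M (itinerary ?T p q)" using m by simp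
    then show "real q * ?D \<le> real n * partition_entropy M (itinerary (F 1) p q) + ?c" by simp
  qed
qed

section \<open>Invariance and entropy of weak limits of orbit averages\<close>

lemma orbit_integral_shift:
  fixes F :: "real \<Rightarrow> 'b::topological_space \<Rightarrow> 'b" and g :: "'b \<Rightarrow> real"
  assumes F: "continuous_flow F" and g: "continuous_on UNIV g" and K: "\<And>x. \<bar>g x\<bar> \<le> K"
    and \<tau>: "0 \<le> \<tau>" and a: "0 \<le> a"
  shows "\<bar>integral {0..a} (\<lambda>s. g (F \<tau> (F s x))) - integral {0..a} (\<lambda>s. g (F s x))\<bar> \<le> 2 * \<tau> * K"
proof -
  let ?h = "\<lambda>s. g (F s x)"
  have c: "continuous_on A ?h" for A
    by (rule continuous_on_compose2[OF g continuous_flow_continuous_time[OF F]]) auto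
  have int: "?h integrable_on {u..v}" for u v by (rule orbit_integrable[OF F g])
  have b: "\<bar>integral {u..u + \<tau>} ?h\<bar> \<le> \<tau> * K" for u
    using integral_bound[of u "u + \<tau>" ?h K] \<tau> c K by (simp add: mult.commute)
  have "(\<lambda>s. g (F \<tau> (F s x))) = ?h \<circ> (+) \<tau>"
    by (auto simp: continuous_flow_add[OF F])
  then have "integral {0..a} (\<lambda>s. g (F \<tau> (F s x))) = integral {0 + \<tau>..a + \<tau>} ?h"
    by (simp only: integral_shift_Icc_real)
  also have "\<dots> = integral {0..a} ?h + integral {a..a + \<tau>} ?h - integral {0..0 + \<tau>} ?h"
    using Henstock_Kurzweil_Integration.integral_combine[of 0 \<tau> "a + \<tau>" ?h]
      Henstock_Kurzweil_Integration.integral_combine[of 0 a "a + \<tau>" ?h] int \<tau> a by simp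
  finally show ?thesis using b[of a] b[of 0] by (simp add: abs_le_iff)
qed

lemma pmf_integral_abs_le:
  fixes D :: "'b \<Rightarrow> real"
  assumes "finite (set_pmf P)" "\<And>x. \<bar>D x\<bar> \<le> C"
  shows "\<bar>\<integral>x. D x \<partial>measure_pmf P\<bar> \<le> C"
proof -
  have int: "integrable (measure_pmf P) h" for h :: "'b \<Rightarrow> real"
    by (rule integrable_measure_pmf_finite[OF assms(1)])
  have "\<bar>\<integral>x. D x \<partial>measure_pmf P\<bar> \<le> (\<integral>x. \<bar>D x\<bar> \<partial>measure_pmf P)" by (rule integral_abs_bound)
  also have "\<dots> \<le> (\<integral>x. C \<partial>measure_pmf P)" by (intro integral_mono int assms(2))
  finally show ?thesis by simp
qed

text \<open>Replacing \<open>g\<close> by \<open>g\<close> after \<open>F \<tau>\<close> moves the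
  time window: two end pieces of length \<tau> cost \<open>2 * \<tau> * K / n\<close>, and the
  Riemann sums cost \<epsilon>. Negative times follow by inverting the flow.\<close>

lemma weak_limit_invariant:
  fixes F :: "real \<Rightarrow> 'b::metric_space \<Rightarrow> 'b"
  assumes comp: "compact (UNIV :: 'b set)" and F: "continuous_flow F"
    and \<nu>: "borel_prob \<nu>" and w: "weakly_converges M \<nu>"
    and n: "filterlim n at_top sequentially" "\<And>k. n k > (0::nat)"
    and m: "filterlim m at_top sequentially" "\<And>k. m k > (0::nat)"
    and P: "\<And>k. finite (set_pmf (P k))"
    and avg: "\<And>k (g :: 'b \<Rightarrow> real). continuous_on UNIV g \<Longrightarrow>
      (\<integral>x. g x \<partial>M k) = (\<integral>x. (\<Sum>l<n k * m k. g (F (real l / real (m k)) x)) / real (m k) \<partial>P k) / real (n k)"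
  shows "\<nu> \<in> invariant_measures F"
proof -
  have Fm: "F t \<in> measurable \<nu> borel" for t
    by (rule continuous_borel_prob_measurable[OF continuous_flow_continuous[OF F] \<nu>])
  have Fb: "F t \<in> measurable borel borel" for t
    by (rule borel_measurable_continuous_onI[OF continuous_flow_continuous[OF F]])
  interpret prob_space \<nu> by (rule borel_probD(1)[OF \<nu>])
  have pos: "distr \<nu> borel (F \<tau>) = \<nu>" if \<tau>: "0 \<le> \<tau>" for \<tau>
  proof (rule borel_prob_eqI[OF _ \<nu>])
    show "borel_prob (distr \<nu> borel (F \<tau>))" using prob_space_distr[OF Fm] by (simp add: borel_prob_def)
    fix g :: "'b \<Rightarrow> real" assume g: "continuous_on UNIV g"
    have h: "continuous_on UNIV (\<lambda>x. g (F \<tau> x))"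
      by (rule continuous_on_compose2[OF g continuous_flow_continuous[OF F]]) auto
    obtain K where K: "\<And>x. \<bar>g x\<bar> \<le> K" using compact_range_bounded[OF comp g] by blast
    have le: "\<bar>(\<integral>x. g (F \<tau> x) \<partial>\<nu>) - (\<integral>x. g x \<partial>\<nu>)\<bar> \<le> \<epsilon>" if \<epsilon>: "\<epsilon> > 0" for \<epsilon>
    proof -
      have e2: "\<epsilon> / 2 > 0" using \<epsilon> by simp
      obtain m1 where m1: "\<And>m n x. m1 \<le> m \<Longrightarrow> 0 < m \<Longrightarrow>
        \<bar>integral {0..real n} (\<lambda>s. g (F s x)) - (\<Sum>j<n * m. g (F (real j / real m) x)) / real m\<bar> \<le> real n * (\<epsilon> / 2)"
        by (rule orbit_riemann_sum[OF comp F g e2]) blast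
      \<comment> \<open>Since \<tau> need not be a multiple of \<open>1 / m k\<close>, shifted and
        unshifted sample points cannot be matched; the comparison passes through the two
        integrals.\<close>
      obtain m2 where m2: "\<And>m n x. m2 \<le> m \<Longrightarrow> 0 < m \<Longrightarrow>
        \<bar>integral {0..real n} (\<lambda>s. g (F \<tau> (F s x))) - (\<Sum>j<n * m. g (F \<tau> (F (real j / real m) x))) / real m\<bar> \<le> real n * (\<epsilon> / 2)"
        by (rule orbit_riemann_sum[OF comp F h e2]) blast
      have "eventually (\<lambda>k. m1 \<le> m k \<and> m2 \<le> m k) sequentially"
        using m(1) by (auto simp: filterlim_at_top intro: eventually_conj)
      then have ev: "eventually (\<lambda>k. \<bar>(\<integral>x. g (F \<tau> x) \<partial>M k) - (\<integral>x. g x \<partial>M k)\<bar> \<le> \<epsilon> + 2 * \<tau> * K / real (n k)) sequentially"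
      proof eventually_elim
        case (elim k)
        define G where "G x = (\<Sum>l<n k * m k. g (F (real l / real (m k)) x)) / real (m k)" for x
        define H where "H x = (\<Sum>l<n k * m k. g (F \<tau> (F (real l / real (m k)) x))) / real (m k)" for x
        have int: "integrable (measure_pmf (P k)) h" for h :: "'b \<Rightarrow> real"
          by (rule integrable_measure_pmf_finite[OF P])
        have D: "\<bar>H x - G x\<bar> \<le> real (n k) * \<epsilon> + 2 * \<tau> * K" for x
        proof -
          have "\<bar>integral {0..real (n k)} (\<lambda>s. g (F s x)) - G x\<bar> \<le> real (n k) * (\<epsilon> / 2)"
            unfolding G_def using elim m(2) by (intro m1) auto
          moreover have "\<bar>integral {0..real (n k)} (\<lambda>s. g (F \<tau> (F s x))) - H x\<bar> \<le> real (n k) * (\<epsilon> / 2)"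
            unfolding H_def using elim m(2) by (intro m2) auto
          moreover have "\<bar>integral {0..real (n k)} (\<lambda>s. g (F \<tau> (F s x))) - integral {0..real (n k)} (\<lambda>s. g (F s x))\<bar> \<le> 2 * \<tau> * K"
            by (rule orbit_integral_shift[OF F g K \<tau>]) simp
          moreover have "real (n k) * (\<epsilon> / 2) + real (n k) * (\<epsilon> / 2) = real (n k) * \<epsilon>" by (simp add: field_simps)
          ultimately show ?thesis by linarith
        qed
        have "(\<integral>x. g (F \<tau> x) \<partial>M k) - (\<integral>x. g x \<partial>M k) = (\<integral>x. H x - G x \<partial>P k) / real (n k)"
          using avg[OF g, of k] avg[OF h, of k]
          by (simp add: G_def[symmetric] H_def[symmetric] Bochner_Integration.integral_diff[OF int int] diff_divide_distrib)
        then have "\<bar>(\<integral>x. g (F \<tau> x) \<partial>M k) - (\<integral>x. g x \<partial>M k)\<bar> = \<bar>\<integral>x. H x - G x \<partial>P k\<bar> / real (n k)" by simp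
        also have "\<dots> \<le> (real (n k) * \<epsilon> + 2 * \<tau> * K) / real (n k)"
          by (intro divide_right_mono pmf_integral_abs_le[OF P D]) simp
        also have "\<dots> = \<epsilon> + 2 * \<tau> * K / real (n k)" using n(2)[of k] by (simp add: add_divide_distrib)
        finally show ?case .
      qed
      have "(\<lambda>k. \<bar>(\<integral>x. g (F \<tau> x) \<partial>M k) - (\<integral>x. g x \<partial>M k)\<bar>) \<longlonglongrightarrow> \<bar>(\<integral>x. g (F \<tau> x) \<partial>\<nu>) - (\<integral>x. g x \<partial>\<nu>)\<bar>"
        using w g h by (intro tendsto_intros) (auto simp: weakly_converges_def)
      moreover have "(\<lambda>k. \<epsilon> + 2 * \<tau> * K / real (n k)) \<longlonglongrightarrow> \<epsilon> + 0"
        by (intro tendsto_add tendsto_const real_tendsto_divide_at_top[OF tendsto_const]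
            filterlim_compose[OF filterlim_real_sequentially n(1)])
      ultimately show ?thesis using ev by (intro tendsto_le[of sequentially _ "\<epsilon>"]) auto
    qed
    have "\<bar>(\<integral>x. g (F \<tau> x) \<partial>\<nu>) - (\<integral>x. g x \<partial>\<nu>)\<bar> \<le> 0"
    proof (rule field_le_epsilon)
      fix e :: real assume "0 < e"
      from le[OF this] show "\<bar>(\<integral>x. g (F \<tau> x) \<partial>\<nu>) - (\<integral>x. g x \<partial>\<nu>)\<bar> \<le> 0 + e" by (simp only: add_0)
    qed
    then show "(\<integral>x. g x \<partial>distr \<nu> borel (F \<tau>)) = (\<integral>x. g x \<partial>\<nu>)"
      using integral_distr[OF Fm borel_measurable_continuous_onI[OF g], of \<tau>] by simp
  qed
  have "distr \<nu> borel (F \<tau>) = \<nu>" for \<tau>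
  proof (cases "0 \<le> \<tau>")
    case False
    then have p: "distr \<nu> borel (F (- \<tau>)) = \<nu>" by (intro pos) simp
    have "distr \<nu> borel (F \<tau>) = distr (distr \<nu> borel (F (- \<tau>))) borel (F \<tau>)" by (simp only: p)
    also have "\<dots> = distr \<nu> borel (F \<tau> \<circ> F (- \<tau>))" by (rule distr_distr[OF Fb Fm])
    also have "F \<tau> \<circ> F (- \<tau>) = (\<lambda>x. x)" by (simp add: comp_def continuous_flow_inverse[OF F])
    also have "distr \<nu> borel (\<lambda>x. x) = \<nu>"
      by (rule distr_id2) (simp add: borel_probD[OF \<nu>])
    finally show ?thesis .
  qed (rule pos)
  then show ?thesis using borel_probD[OF \<nu>] by (simp add: invariant_measures_def)
qed

text \<open>The only delicate limit is 0, where \<open>ln\<close> is discontinuous and the square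
  root bound takes over.\<close>

lemma tendsto_mult_ln:
  fixes m :: "nat \<Rightarrow> real"
  assumes m: "m \<longlonglongrightarrow> a" and b: "\<And>k. 0 \<le> m k" "\<And>k. m k \<le> 1"
  shows "(\<lambda>k. m k * ln (m k)) \<longlonglongrightarrow> a * ln a"
proof (cases "a = 0")
  case True
  have "(\<lambda>k. 2 * sqrt (m k)) \<longlonglongrightarrow> 2 * sqrt a" by (intro tendsto_intros m)
  then have lim: "(\<lambda>k. 2 * sqrt (m k)) \<longlonglongrightarrow> 0" using True by simp
  have "\<forall>k. norm (m k * ln (m k)) \<le> 2 * sqrt (m k)"
  proof
    fix k
    have "m k * ln (m k) \<le> 0"
      using b[of k] by (cases "m k = 0") (auto intro: mult_nonneg_nonpos)
    then show "norm (m k * ln (m k)) \<le> 2 * sqrt (m k)"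
      using minus_mult_ln_le_sqrt[OF b(1)[of k]] by simp
  qed
  then have "(\<lambda>k. m k * ln (m k)) \<longlonglongrightarrow> 0"
    by (rule Lim_null_comparison[OF always_eventually lim])
  then show ?thesis using True by simp
qed (intro tendsto_intros m)

text \<open>Points of \<open>G\<close> with a given label form an open set, and so do those with
  another label; these two sets witness the null boundary of the atom.\<close>

lemma partition_entropy_weak_limit:
  fixes \<nu> :: "'b::metric_space measure"
  assumes comp: "compact (UNIV :: 'b set)" and M: "\<And>k. borel_prob (M k)" and \<nu>: "borel_prob \<nu>"
    and w: "weakly_converges M \<nu>" and W: "simple_function borel W"
    and G: "open G" "measure \<nu> G = 1" "\<And>x. x \<in> G \<Longrightarrow> \<exists>U. open U \<and> x \<in> U \<and> (\<forall>y\<in>U. W y = W x)"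
  shows "(\<lambda>k. partition_entropy (M k) W) \<longlonglongrightarrow> partition_entropy \<nu> W"
proof -
  have sf: "simple_function \<rho> W" if "borel_prob \<rho>" for \<rho>
    using W borel_probD[OF that] by (simp add: simple_function_def)
  have H: "partition_entropy \<rho> W = - (\<Sum>v\<in>range W. measure \<rho> (W -` {v}) * ln (measure \<rho> (W -` {v})))"
    if "borel_prob \<rho>" for \<rho>
    using partition_entropy_eq[OF borel_probD(1)[OF that] sf[OF that]] by (simp add: borel_probD[OF that])
  have m: "(\<lambda>k. measure (M k) (W -` {v})) \<longlonglongrightarrow> measure \<nu> (W -` {v})" for v
  proof (rule weakly_converges_null_boundary[OF comp M \<nu> w])
    show "W -` {v} \<in> sets borel" using simple_functionD(2)[OF W, of "{v}"] by simp
    have o: "open {x\<in>G. Q (W x)}" for Q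
    proof (subst open_subopen, intro ballI)
      fix x assume x: "x \<in> {x\<in>G. Q (W x)}"
      then have xG: "x \<in> G" and Q: "Q (W x)" by auto
      from G(3)[OF xG] obtain U where U: "open U" "x \<in> U" "\<forall>y\<in>U. W y = W x" by (elim exE conjE)
      have "open (U \<inter> G)" using U(1) G(1) by (rule open_Int)
      moreover have "U \<inter> G \<subseteq> {x\<in>G. Q (W x)}" using U(3) Q by auto
      ultimately show "\<exists>T. open T \<and> x \<in> T \<and> T \<subseteq> {x\<in>G. Q (W x)}"
        using xG U(2) by (intro exI[of _ "U \<inter> G"]) simp
    qed
    show "open {x\<in>G. W x = v}" "open {x\<in>G. W x \<noteq> v}" by (rule o)+
    have "{x\<in>G. W x = v} \<union> {x\<in>G. W x \<noteq> v} = G" by auto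
    then show "measure \<nu> ({x\<in>G. W x = v} \<union> {x\<in>G. W x \<noteq> v}) = 1" using G(2) by simp
  qed auto
  show ?thesis
    unfolding H[OF M] H[OF \<nu>]
    by (intro tendsto_minus tendsto_sum tendsto_mult_ln m)
       (auto intro: prob_space.prob_le_1 borel_probD(1)[OF M])
qed

text \<open>\<open>G\<close> consists of the points whose first \<open>q\<close> iterates lie in
  \<open>V\<close>; invariance gives each preimage of \<open>V\<close> full measure.\<close>

lemma itinerary_locally_constant:
  assumes F: "continuous_flow F" and \<nu>: "\<nu> \<in> invariant_measures F"
    and V: "open V" "measure \<nu> V = 1" "\<And>x. x \<in> V \<Longrightarrow> \<exists>U. open U \<and> x \<in> U \<and> (\<forall>y\<in>U. p y = p x)"
  obtains G where "open G" "measure \<nu> G = 1"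
    "\<And>x. x \<in> G \<Longrightarrow> \<exists>U. open U \<and> x \<in> U \<and> (\<forall>y\<in>U. itinerary (F 1) p q y = itinerary (F 1) p q x)"
proof -
  note b = invariant_measuresD(1)[OF \<nu>]
  interpret prob_space \<nu> by (rule borel_probD(1)[OF b])
  have o: "open (F t -` U)" if "open U" for t U
    using open_vimage[OF that continuous_flow_continuous[OF F]] .
  have Fm: "F t \<in> measurable \<nu> borel" for t
    by (rule continuous_borel_prob_measurable[OF continuous_flow_continuous[OF F] b])
  define G where "G = (\<Inter>i<q. F (real i) -` V)"
  have fp: "(F 1 ^^ i) = F (real i)" for i by (rule ext) (simp add: continuous_flow_funpow[OF F])
  show ?thesis
  proof
    show "open G" unfolding G_def using V(1) o by (intro open_INT) auto
    have 1: "prob (F t -` V) = 1" for t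
      using measure_distr[OF Fm, of V t] V invariant_measuresD(2)[OF \<nu>, of t] by (simp add: borel_probD[OF b])
    have "AE x in \<nu>. \<forall>i\<in>{..<q}. x \<in> F (real i) -` V"
      using 1 o[OF V(1)] by (intro AE_finite_allI) (auto simp: prob_eq_1 borel_probD[OF b])
    then have "AE x in \<nu>. x \<in> G" by (simp add: G_def)
    then show "measure \<nu> G = 1"
      using \<open>open G\<close> by (subst prob_eq_1) (auto simp: borel_probD[OF b])
    fix x assume x: "x \<in> G"
    have "\<forall>i\<in>{..<q}. \<exists>U. open U \<and> F (real i) x \<in> U \<and> (\<forall>y\<in>U. p y = p (F (real i) x))"
      using V(3) x by (auto simp: G_def)
    from bchoice[OF this] obtain U where U: "\<And>i. i < q \<Longrightarrow> open (U i)" "\<And>i. i < q \<Longrightarrow> F (real i) x \<in> U i"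
      "\<And>i y. i < q \<Longrightarrow> y \<in> U i \<Longrightarrow> p y = p (F (real i) x)" by auto
    have "open (\<Inter>i<q. F (real i) -` U i)" using U(1) o by (intro open_INT) auto
    moreover have "x \<in> (\<Inter>i<q. F (real i) -` U i)" using U(2) by auto
    moreover have "itinerary (F 1) p q y = itinerary (F 1) p q x" if "y \<in> (\<Inter>i<q. F (real i) -` U i)" for y
      using that U(3) by (simp add: itinerary_def fp)
    ultimately show "\<exists>U. open U \<and> x \<in> U \<and> (\<forall>y\<in>U. itinerary (F 1) p q y = itinerary (F 1) p q x)"
      by blast
  qed
qed

text \<open>A value above \<open>c\<close> of the upper limit recurs at arbitrarily large times. The
  bound \<open>real k + 1\<close> makes these times unbounded and positive, so that dividing by them
  is legitimate.\<close>

lemma large_separated_sets: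
  assumes "ereal c < pressure_at_scale F B \<Phi> \<delta>"
  obtains t E where "\<And>k :: nat. real k + 1 \<le> t k" "\<And>k. E k \<in> separated_sets F B (t k) \<delta>" "\<And>k. E k \<noteq> {}"
    "\<And>k. c * t k < ln (\<Sum>x\<in>E k. exp (integral {0..t k} (\<lambda>s. \<Phi> (F s x))))"
proof -
  have "\<exists>t E. real k + 1 \<le> t \<and> E \<in> separated_sets F B t \<delta> - {{}} \<and>
      c * t < ln (\<Sum>x\<in>E. exp (integral {0..t} (\<lambda>s. \<Phi> (F s x))))" for k :: nat
  proof -
    let ?L = "log_partition_function F B \<Phi> \<delta>"
    have "\<not> eventually (\<lambda>t. ?L t / ereal t \<le> ereal c) at_top"
      using Limsup_bounded[of "\<lambda>t. ?L t / ereal t" "ereal c" at_top] assms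
      unfolding pressure_at_scale_def by auto
    then have "\<not> (\<forall>t\<ge>real k + 1. ?L t / ereal t \<le> ereal c)"
      unfolding eventually_at_top_linorder by blast
    then obtain t where t: "real k + 1 \<le> t" "ereal c < ?L t / ereal t" by (auto simp: not_le)
    then have "ereal t * ereal c < ?L t" by (subst (asm) ereal_less_divide_pos) auto
    then obtain E where "E \<in> separated_sets F B t \<delta> - {{}}"
        "ereal t * ereal c < ereal (ln (\<Sum>x\<in>E. exp (integral {0..t} (\<lambda>s. \<Phi> (F s x)))))"
      unfolding log_partition_function_def less_SUP_iff by blast
    then show ?thesis using t(1) by (intro exI[of _ t] exI[of _ E]) (simp add: mult.commute)
  qed
  then have "\<forall>k::nat. \<exists>z. real k + 1 \<le> fst z \<and> snd z \<in> separated_sets F B (fst z) \<delta> - {{}} \<and>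
      c * fst z < ln (\<Sum>x\<in>snd z. exp (integral {0..fst z} (\<lambda>s. \<Phi> (F s x))))" by auto
  from choice[OF this] obtain z where "\<forall>k::nat. real k + 1 \<le> fst (z k) \<and>
      snd (z k) \<in> separated_sets F B (fst (z k)) \<delta> - {{}} \<and>
      c * fst (z k) < ln (\<Sum>x\<in>snd (z k). exp (integral {0..fst (z k)} (\<lambda>s. \<Phi> (F s x))))" by blast
  then show ?thesis by (intro that[of "\<lambda>k. fst (z k)" "\<lambda>k. snd (z k)"]) auto
qed

text \<open>Gibbs weights on separated sets have entropy plus mean orbit integral equal to the log
  partition sum. For fixed \<open>q\<close> the block inequality passes to the weak limit \<nu>,
  since the \<open>q\<close>-itinerary has null boundary for \<nu>; only then does \<open>q\<close>
  tend to infinity.\<close>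

lemma misiurewicz:
  fixes F :: "real \<Rightarrow> 'b::metric_space \<Rightarrow> 'b"
  assumes comp: "compact (UNIV :: 'b set)" and F: "continuous_flow F" and \<Phi>: "continuous_on UNIV \<Phi>"
    and B: "closed B" "\<And>t x. x \<in> B \<Longrightarrow> F t x \<in> B"
    and \<delta>: "\<delta> > 0" and c: "ereal c < pressure_at_scale F B \<Phi> \<delta>"
  obtains \<nu> where "\<nu> \<in> invariant_measures F" "measure \<nu> B = 1" "ereal c \<le> measure_pressure F \<Phi> \<nu>"
proof -
  obtain t E where t: "\<And>k :: nat. real k + 1 \<le> t k" and E: "\<And>k. E k \<in> separated_sets F B (t k) \<delta>" "\<And>k. E k \<noteq> {}"
    and big: "\<And>k. c * t k < ln (\<Sum>x\<in>E k. exp (integral {0..t k} (\<lambda>s. \<Phi> (F s x))))"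
    by (rule large_separated_sets[OF c]) blast
  obtain d where d: "d > 0" "\<And>s x y. - 1 \<le> s \<Longrightarrow> s \<le> 1 \<Longrightarrow> dist x y < d \<Longrightarrow> dist (F s x) (F s y) < \<delta>"
    by (rule continuous_flow_equicontinuous[OF comp F \<delta>, of "- 1" 1]) blast
  have equi: "dist (F s x) (F s y) \<le> \<delta>" if "- 1 \<le> s" "s \<le> 1" "dist x y < d" for s x y
    using d(2)[OF that] by simp
  \<comment> \<open>The averages need integer lengths. Rounding \<open>t k\<close> up changes
    \<open>c * t k\<close> by at most \<open>\<bar>c\<bar>\<close> and the orbit integral by at most
    \<open>K\<close>.\<close>
  define n where "n k = nat \<lceil>t k\<rceil>" for k
  define S where "S k x = integral {0..t k} (\<lambda>s. \<Phi> (F s x))" for k x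
  define D where "D k P = ln (\<Sum>x\<in>E k. exp (S k x)) - (\<integral>x. S k x \<partial>measure_pmf P)" for k P
  have t0: "0 \<le> t k" for k using t[of k] by simp
  have n: "t k \<le> real (n k)" "n k > 0" "real (n k) \<le> t k + 1" "k < n k" for k
    using t[of k] t0[of k] unfolding n_def by linarith+
  \<comment> \<open>Gathers what a stage provides so that one choice yields all stages. The entropy
    bound stays quantified over the labelling \<open>p\<close>, which is picked only after the limit
    is known.\<close>
  define Q where "Q k P M \<longleftrightarrow> borel_prob M \<and> measure M B = 1 \<and> finite (set_pmf P) \<and>
      (\<forall>g :: 'b \<Rightarrow> real. continuous_on UNIV g \<longrightarrow>
        (\<integral>x. g x \<partial>M) = (\<integral>x. (\<Sum>l<n k * Suc k. g (F (real l / real (Suc k)) x)) / real (Suc k) \<partial>measure_pmf P) / real (n k)) \<and>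
      (\<forall>p j q. p \<in> measurable borel (count_space UNIV) \<longrightarrow> range p \<subseteq> {..<j} \<longrightarrow> q > 0 \<longrightarrow>
        (\<forall>x y. p x = p y \<longrightarrow> dist x y < d) \<longrightarrow>
        real q * D k P \<le> real (n k) * partition_entropy M (itinerary (F 1) p q) + (real q)\<^sup>2 * ln (real j))"
    for k P M
  have "\<exists>P M. Q k P M" for k
  proof -
    show ?thesis
    proof (rule misiurewicz_stage[where S="S k", OF comp F B E(1)[of k] E(2)[of k] t0 n(1) n(2) zero_less_Suc[of k] equi])
      fix P :: "'b pmf" and M assume "borel_prob M" "measure M B = 1" "finite (set_pmf P)"
      "\<And>g :: 'b \<Rightarrow> real. continuous_on UNIV g \<Longrightarrow>
        (\<integral>x. g x \<partial>M) = (\<integral>x. (\<Sum>l<n k * Suc k. g (F (real l / real (Suc k)) x)) / real (Suc k) \<partial>P) / real (n k)"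
      "\<And>p j q. p \<in> measurable borel (count_space UNIV) \<Longrightarrow> range p \<subseteq> {..<j} \<Longrightarrow> q > 0 \<Longrightarrow>
        (\<And>x y. p x = p y \<Longrightarrow> dist x y < d) \<Longrightarrow>
        real q * (ln (\<Sum>x\<in>E k. exp (S k x)) - (\<integral>x. S k x \<partial>P)) \<le>
          real (n k) * partition_entropy M (itinerary (F 1) p q) + (real q)\<^sup>2 * ln (real j)"
      then have "Q k P M" unfolding Q_def D_def by blast
      then show ?thesis by blast
    qed
  qed
  then have "\<forall>k. \<exists>z. Q k (fst z) (snd z)" by auto
  from choice[OF this] obtain z where "\<And>k. Q k (fst (z k)) (snd (z k))" by blast
  then obtain P M where PM: "\<And>k. Q k (P k) (M k)" by (rule that[of "\<lambda>k. fst (z k)" "\<lambda>k. snd (z k)"])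
  have z: "\<And>k. borel_prob (M k)" "\<And>k. measure (M k) B = 1" "\<And>k. finite (set_pmf (P k))"
    "\<And>k (g :: 'b \<Rightarrow> real). continuous_on UNIV g \<Longrightarrow>
        (\<integral>x. g x \<partial>M k) = (\<integral>x. (\<Sum>l<n k * Suc k. g (F (real l / real (Suc k)) x)) / real (Suc k) \<partial>P k) / real (n k)"
    "\<And>k p j q. p \<in> measurable borel (count_space UNIV) \<Longrightarrow> range p \<subseteq> {..<j} \<Longrightarrow> q > 0 \<Longrightarrow>
        (\<forall>x y. p x = p y \<longrightarrow> dist x y < d) \<Longrightarrow>
        real q * D k (P k) \<le> real (n k) * partition_entropy (M k) (itinerary (F 1) p q) + (real q)\<^sup>2 * ln (real j)"
    using PM unfolding Q_def by blast+
  obtain r \<nu> where r: "strict_mono (r :: nat \<Rightarrow> nat)" and \<nu>: "borel_prob \<nu>" and w: "weakly_converges (\<lambda>k. M (r k)) \<nu>"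
    by (rule weak_compactness[OF comp z(1)])
  have rk: "k \<le> r k" for k using r by (rule seq_suble)
  have ninf: "filterlim (\<lambda>k. n (r k)) at_top sequentially"
    by (rule filterlim_at_top_mono[OF filterlim_ident]) (use rk n(4) in \<open>auto intro!: always_eventually less_imp_le intro: le_less_trans\<close>)
  have minf: "filterlim (\<lambda>k. Suc (r k)) at_top sequentially"
    by (rule filterlim_at_top_mono[OF filterlim_ident]) (use rk in \<open>auto intro!: always_eventually le_SucI\<close>)
  have inv: "\<nu> \<in> invariant_measures F"
    by (rule weak_limit_invariant[OF comp F \<nu> w ninf n(2) minf zero_less_Suc z(3) z(4)])
  have "measure \<nu> B = 1"
    by (rule weakly_converges_closed_carrier[OF comp z(1) \<nu> w B(1) z(2)])
  moreover have "ereal c \<le> measure_pressure F \<Phi> \<nu>"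
  proof -
    interpret Mp: measure_preserving \<nu> "F 1" by (rule invariant_measure_preserving[OF inv F])
    \<comment> \<open>The null boundary refers to the limit measure \<nu>, while mesh below
      \<open>d\<close> makes the bound available at every stage.\<close>
    obtain p V where p: "p \<in> measurable borel (count_space UNIV)" "finite (range (p :: 'b \<Rightarrow> nat))"
      "\<And>x y. p x = p y \<Longrightarrow> dist x y < d" and V: "open V" "measure \<nu> V = 1"
      "\<And>x. x \<in> V \<Longrightarrow> \<exists>U. open U \<and> x \<in> U \<and> (\<forall>y\<in>U. p y = p x)"
      by (rule null_boundary_partition[OF comp \<nu> d(1)]) blast
    have pf: "p \<in> finite_labellings borel" using p by (simp add: finite_labellings_def)
    note sp = finite_labelling_simple[OF pf]
    have spv: "simple_function \<nu> p" using sp borel_probD[OF \<nu>] by (simp add: simple_function_def)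
    obtain j where j: "range p \<subseteq> {..<j}" using finite_labelling_bounded[OF pf] .
    define I where "I = (\<integral>x. \<Phi> x \<partial>\<nu>)"
    obtain K where K: "K > 0" "\<And>x. \<bar>\<Phi> x\<bar> \<le> K" using compact_range_bounded[OF comp \<Phi>] by blast
    have main: "real q * (c - I - \<epsilon>) \<le> partition_entropy \<nu> (itinerary (F 1) p q)" if q: "q > 0" and \<epsilon>: "\<epsilon> > 0" for q \<epsilon>
    proof -
      obtain m0 where m0: "\<And>m n x. m0 \<le> m \<Longrightarrow> 0 < m \<Longrightarrow>
        \<bar>integral {0..real n} (\<lambda>s. \<Phi> (F s x)) - (\<Sum>l<n * m. \<Phi> (F (real l / real m) x)) / real m\<bar> \<le> real n * \<epsilon>"
        by (rule orbit_riemann_sum[OF comp F \<Phi> \<epsilon>]) blast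
      let ?J = "\<lambda>k. \<integral>x. \<Phi> x \<partial>M k" and ?H = "\<lambda>k. partition_entropy (M k) (itinerary (F 1) p q)"
      \<comment> \<open>The block inequality divided by \<open>n k\<close>: the errors from rounding
        and from the block ends vanish along the subsequence, leaving
        \<open>real q * (c - I - \<epsilon>)\<close>.\<close>
      let ?b = "\<lambda>k. real q * (c - (\<bar>c\<bar> + K) / real (n k) - ?J k - \<epsilon>) - (real q)\<^sup>2 * ln (real j) / real (n k)"
      have step: "?b k \<le> ?H k" if k: "m0 \<le> Suc k" for k
      proof -
        define R where "R x = (\<Sum>l<n k * Suc k. \<Phi> (F (real l / real (Suc k)) x)) / real (Suc k)" for x
        have int: "integrable (measure_pmf (P k)) h" for h :: "'b \<Rightarrow> real"
          by (rule integrable_measure_pmf_finite[OF z(3)])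
        have "S k x \<le> R x + real (n k) * \<epsilon> + K" for x
        proof -
          have "\<bar>integral {0..real (n k)} (\<lambda>s. \<Phi> (F s x)) - R x\<bar> \<le> real (n k) * \<epsilon>"
            unfolding R_def by (rule m0[OF k zero_less_Suc])
          moreover have "integral {0..real (n k)} (\<lambda>s. \<Phi> (F s x)) = S k x + integral {t k..real (n k)} (\<lambda>s. \<Phi> (F s x))"
            unfolding S_def
            by (rule Henstock_Kurzweil_Integration.integral_combine[symmetric, OF t0 n(1) orbit_integrable[OF F \<Phi>]])
          moreover have "\<bar>integral {t k..real (n k)} (\<lambda>s. \<Phi> (F s x))\<bar> \<le> K"
          proof -
            have "norm (integral {t k..real (n k)} (\<lambda>s. \<Phi> (F s x))) \<le> K * (real (n k) - t k)"
              by (rule integral_bound[OF n(1)])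
                (use K(2) in \<open>auto intro!: continuous_on_compose2[OF \<Phi>] continuous_flow_continuous_time[OF F]\<close>)
            also have "\<dots> \<le> K * 1" using K(1) n(3)[of k] by (intro mult_left_mono) auto
            finally show ?thesis by simp
          qed
          ultimately show ?thesis by linarith
        qed
        then have "(\<integral>x. S k x \<partial>P k) \<le> (\<integral>x. R x + real (n k) * \<epsilon> + K \<partial>P k)" by (intro integral_mono int)
        also have "\<dots> = (\<integral>x. R x \<partial>P k) + real (n k) * \<epsilon> + K"
          using int by (simp add: Bochner_Integration.integral_add)
        also have "(\<integral>x. R x \<partial>P k) = real (n k) * ?J k" using z(4)[OF \<Phi>, of k] n(2)[of k] by (simp add: R_def)
        finally have "c * t k - real (n k) * ?J k - real (n k) * \<epsilon> - K \<le> D k (P k)"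
          using big[of k] by (simp add: D_def S_def)
        moreover have "c * real (n k) - \<bar>c\<bar> \<le> c * t k"
        proof -
          have "c * (real (n k) - t k) \<le> \<bar>c\<bar> * 1"
            using n(1)[of k] n(3)[of k] by (intro mult_mono) auto
          then show ?thesis by (simp add: algebra_simps)
        qed
        ultimately have "c * real (n k) - \<bar>c\<bar> - real (n k) * ?J k - real (n k) * \<epsilon> - K \<le> D k (P k)" by linarith
        then have "real q * (c * real (n k) - \<bar>c\<bar> - real (n k) * ?J k - real (n k) * \<epsilon> - K) \<le> real q * D k (P k)"
          by (rule mult_left_mono) simp
        also have "\<dots> \<le> real (n k) * ?H k + (real q)\<^sup>2 * ln (real j)"
          by (rule z(5)[OF p(1) j q]) (use p(3) in blast)
        finally have "(real q * (c * real (n k) - \<bar>c\<bar> - real (n k) * ?J k - real (n k) * \<epsilon> - K) - (real q)\<^sup>2 * ln (real j)) / real (n k)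
            \<le> (real (n k) * ?H k) / real (n k)" by (intro divide_right_mono) auto
        also have "(real (n k) * ?H k) / real (n k) = ?H k" using n(2)[of k] by simp
        also have "(real q * (c * real (n k) - \<bar>c\<bar> - real (n k) * ?J k - real (n k) * \<epsilon> - K) - (real q)\<^sup>2 * ln (real j)) / real (n k) = ?b k"
          using n(2)[of k] by (simp add: field_simps)
        finally show ?thesis .
      qed
      have rn: "filterlim (\<lambda>k. real (n (r k))) at_top sequentially"
        by (rule filterlim_compose[OF filterlim_real_sequentially ninf])
      have lim1: "(\<lambda>k. ?b (r k)) \<longlonglongrightarrow> real q * (c - 0 - I - \<epsilon>) - 0"
        unfolding I_def using w \<Phi>
        by (intro tendsto_intros real_tendsto_divide_at_top[OF tendsto_const rn]) (auto simp: weakly_converges_def)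
      obtain G where G: "open G" "measure \<nu> G = 1"
        "\<And>x. x \<in> G \<Longrightarrow> \<exists>U. open U \<and> x \<in> U \<and> (\<forall>y\<in>U. itinerary (F 1) p q y = itinerary (F 1) p q x)"
        by (rule itinerary_locally_constant[OF F inv V, of q]) auto
      have Fb: "F 1 \<in> measurable borel borel"
        by (rule borel_measurable_continuous_onI[OF continuous_flow_continuous[OF F]])
      have lim2: "(\<lambda>k. ?H (r k)) \<longlonglongrightarrow> partition_entropy \<nu> (itinerary (F 1) p q)"
        by (rule partition_entropy_weak_limit[OF comp z(1) \<nu> w simple_function_itinerary_borel[OF Fb sp] G])
      have "eventually (\<lambda>k. ?b (r k) \<le> ?H (r k)) sequentially"
      proof (rule eventually_sequentiallyI[of m0])
        fix k assume "m0 \<le> k"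
        then show "?b (r k) \<le> ?H (r k)" using rk[of k] by (intro step) linarith
      qed
      from tendsto_le[OF sequentially_bot lim2 lim1 this] show ?thesis by simp
    qed
    have approx: "c - I - \<epsilon> \<le> entropy_wrt_partition \<nu> (F 1) p" if \<epsilon>: "\<epsilon> > 0" for \<epsilon>
    proof (rule LIMSEQ_le_const[OF Mp.entropy_wrt_partition_lim[OF spv]], intro exI allI impI)
      fix q :: nat assume "1 \<le> q"
      then show "c - I - \<epsilon> \<le> partition_entropy \<nu> (itinerary (F 1) p q) / real q"
        using main[of q \<epsilon>] \<epsilon> by (simp add: field_simps)
    qed
    have "c - I \<le> entropy_wrt_partition \<nu> (F 1) p + \<epsilon>" if "\<epsilon> > 0" for \<epsilon>
      using approx[OF that] by linarith
    then have "c - I \<le> entropy_wrt_partition \<nu> (F 1) p" by (rule field_le_epsilon)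
    then have "ereal (c - I) \<le> flow_entropy F \<nu>"
      using flow_entropy_upper[of p \<nu> F] spv
      by (meson ereal_less_eq(3) finite_labellings_iff_simple[OF borel_probD(3)[OF \<nu>]] order_trans)
    then have "ereal (c - I) + ereal I \<le> measure_pressure F \<Phi> \<nu>"
      unfolding measure_pressure_def I_def by (rule add_right_mono)
    then show ?thesis by simp
  qed
  ultimately show ?thesis using inv by (intro that)
qed

section \<open>Equilibrium states on the product\<close>

text \<open>Induction over the generation of the topology; this lets the semicontinuity hypothesis,
  stated with open sets, be applied to weakly convergent sequences.\<close>

lemma weak_star_eventually:
  fixes \<nu> :: "'b::topological_space measure"
  assumes U: "openin (weak_star_topology F) U" "\<nu> \<in> U"
    and N: "\<And>k. N k \<in> invariant_measures F" and w: "weakly_converges N \<nu>"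
  shows "eventually (\<lambda>k. N k \<in> U) sequentially"
proof -
  have "generate_topology_on {{\<nu> \<in> invariant_measures F. (\<integral>x. g x \<partial>\<nu>) \<in> U} | (g :: 'b \<Rightarrow> real) U.
        continuous_on UNIV g \<and> open U} U"
    using U(1) unfolding weak_star_topology_def openin_topology_generated_by_iff .
  then show ?thesis using U(2)
  proof induction
    case (Int a b)
    then show ?case by (simp add: eventually_conj)
  next
    case (UN K)
    then obtain a where a: "a \<in> K" "\<nu> \<in> a" by blast
    from UN.IH[OF a] show ?case by eventually_elim (use a in blast)
  next
    case (Basis s)
    then obtain g :: "'b \<Rightarrow> real" and V where s: "s = {\<nu> \<in> invariant_measures F. (\<integral>x. g x \<partial>\<nu>) \<in> V}"
      and g: "continuous_on UNIV g" and V: "open V" by blast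
    have "(\<lambda>k. \<integral>x. g x \<partial>N k) \<longlonglongrightarrow> (\<integral>x. g x \<partial>\<nu>)" using w g by (simp add: weakly_converges_def)
    then have "eventually (\<lambda>k. (\<integral>x. g x \<partial>N k) \<in> V) sequentially"
      using V Basis s by (auto dest: topological_tendstoD)
    then show ?case by eventually_elim (simp add: s N)
  qed simp
qed

text \<open>Invariance tested on continuous functions, a form that passes to weak limits and to
  finite mixtures.\<close>

lemma invariant_measuresI:
  fixes F :: "real \<Rightarrow> 'b::metric_space \<Rightarrow> 'b"
  assumes F: "continuous_flow F" and \<nu>: "borel_prob \<nu>"
    and eq: "\<And>t (g :: 'b \<Rightarrow> real). continuous_on UNIV g \<Longrightarrow> (\<integral>x. g (F t x) \<partial>\<nu>) = (\<integral>x. g x \<partial>\<nu>)"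
  shows "\<nu> \<in> invariant_measures F"
proof -
  interpret prob_space \<nu> by (rule borel_probD(1)[OF \<nu>])
  have Fm: "F t \<in> measurable \<nu> borel" for t
    by (rule continuous_borel_prob_measurable[OF continuous_flow_continuous[OF F] \<nu>])
  have "distr \<nu> borel (F t) = \<nu>" for t
  proof (rule borel_prob_eqI[OF _ \<nu>])
    show "borel_prob (distr \<nu> borel (F t))" using prob_space_distr[OF Fm] by (simp add: borel_prob_def)
    fix g :: "'b \<Rightarrow> real" assume g: "continuous_on UNIV g"
    show "(\<integral>x. g x \<partial>distr \<nu> borel (F t)) = (\<integral>x. g x \<partial>\<nu>)"
      using integral_distr[OF Fm borel_measurable_continuous_onI[OF g], of t] eq[OF g, of t] by simp
  qed
  then show ?thesis using borel_probD[OF \<nu>] by (simp add: invariant_measures_def)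
qed

text \<open>Lets finite and infinite pressure be treated by one argument in
  \<open>pressure_attained\<close>.\<close>

lemma ereal_increasing_approx:
  assumes "P > - \<infinity>"
  obtains c :: "nat \<Rightarrow> real" where "\<And>k. ereal (c k) < P" "\<And>z. ereal z < P \<Longrightarrow> eventually (\<lambda>k. z < c k) sequentially"
proof (cases P)
  case (real p)
  show ?thesis
  proof (rule that[of "\<lambda>k. p - 1 / real (Suc k)"])
    show "ereal (p - 1 / real (Suc k)) < P" for k using real by simp
    fix z assume "ereal z < P"
    then have z: "z < p - 0" using real by simp
    have "(\<lambda>k. p - 1 / real (Suc k)) \<longlonglongrightarrow> p - 0"
      by (intro tendsto_diff tendsto_const) (rule LIMSEQ_Suc[OF lim_inverse_n', unfolded o_def])
    then show "eventually (\<lambda>k. z < p - 1 / real (Suc k)) sequentially" using z by (rule order_tendstoD)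
  qed
next
  case PInf
  show ?thesis
  proof (rule that[of real])
    fix z show "eventually (\<lambda>k. z < real k) sequentially"
      using filterlim_real_sequentially by (simp add: filterlim_at_top_dense)
  qed (simp add: PInf)
qed (use assms in simp)

text \<open>The measures built for values \<open>c k\<close> approaching the pressure belong to
  different scales, so no single partition controls their entropies; here semicontinuity of the
  entropy map takes over.\<close>

lemma pressure_attained:
  fixes F :: "real \<Rightarrow> 'b::metric_space \<Rightarrow> 'b"
  assumes comp: "compact (UNIV :: 'b set)" and F: "continuous_flow F" and \<Phi>: "continuous_on UNIV \<Phi>"
    and B: "closed B" "\<And>t x. x \<in> B \<Longrightarrow> F t x \<in> B"
    and usc: "upper_semicontinuous_map (weak_star_topology F) (flow_entropy F)"
    and P: "topological_pressure F B \<Phi> > - \<infinity>"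
  obtains \<nu> where "\<nu> \<in> invariant_measures F" "measure \<nu> B = 1"
    "topological_pressure F B \<Phi> \<le> measure_pressure F \<Phi> \<nu>"
proof -
  let ?P = "topological_pressure F B \<Phi>"
  obtain c where c: "\<And>k. ereal (c k) < ?P" "\<And>z. ereal z < ?P \<Longrightarrow> eventually (\<lambda>k. z < c k) sequentially"
    by (rule ereal_increasing_approx[OF P]) blast
  have "\<exists>\<nu>. \<nu> \<in> invariant_measures F \<and> measure \<nu> B = 1 \<and> ereal (c k) \<le> measure_pressure F \<Phi> \<nu>" for k
  proof -
    obtain \<delta> where "\<delta> > 0" "ereal (c k) < pressure_at_scale F B \<Phi> \<delta>"
      using c(1)[of k] unfolding topological_pressure_def less_SUP_iff by auto
    then show ?thesis using misiurewicz[OF comp F \<Phi> B, of \<delta> "c k"] by blast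
  qed
  then have "\<forall>k. \<exists>\<nu>. \<nu> \<in> invariant_measures F \<and> measure \<nu> B = 1 \<and> ereal (c k) \<le> measure_pressure F \<Phi> \<nu>" by blast
  from choice[OF this] obtain N where N: "\<And>k. N k \<in> invariant_measures F" "\<And>k. measure (N k) B = 1"
    "\<And>k. ereal (c k) \<le> measure_pressure F \<Phi> (N k)" by blast
  note Nb = invariant_measuresD(1)[OF N(1)]
  obtain r \<nu> where r: "strict_mono (r :: nat \<Rightarrow> nat)" and \<nu>: "borel_prob \<nu>" and w: "weakly_converges (\<lambda>k. N (r k)) \<nu>"
    by (rule weak_compactness[OF comp Nb])
  have inv: "\<nu> \<in> invariant_measures F"
  proof (rule invariant_measuresI[OF F \<nu>])
    fix t and g :: "'b \<Rightarrow> real" assume g: "continuous_on UNIV g"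
    have h: "continuous_on UNIV (\<lambda>x. g (F t x))"
      by (rule continuous_on_compose2[OF g continuous_flow_continuous[OF F]]) auto
    have "(\<lambda>k. \<integral>x. g (F t x) \<partial>N (r k)) \<longlonglongrightarrow> (\<integral>x. g (F t x) \<partial>\<nu>)"
      using w h by (simp add: weakly_converges_def)
    moreover have "(\<lambda>k. \<integral>x. g (F t x) \<partial>N (r k)) \<longlonglongrightarrow> (\<integral>x. g x \<partial>\<nu>)"
      using w g by (simp add: weakly_converges_def invariant_integral[OF N(1) F g])
    ultimately show "(\<integral>x. g (F t x) \<partial>\<nu>) = (\<integral>x. g x \<partial>\<nu>)" by (rule LIMSEQ_unique)
  qed
  have "measure \<nu> B = 1"
    by (rule weakly_converges_closed_carrier[OF comp Nb \<nu> w B(1) N(2)])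
  moreover have "?P \<le> measure_pressure F \<Phi> \<nu>"
  proof (rule ccontr)
    assume "\<not> ?P \<le> measure_pressure F \<Phi> \<nu>"
    then have lt: "flow_entropy F \<nu> + ereal (\<integral>x. \<Phi> x \<partial>\<nu>) < ?P" by (simp add: measure_pressure_def)
    define I where "I = (\<integral>x. \<Phi> x \<partial>\<nu>)"
    have "flow_entropy F \<nu> < ?P - ereal I" using lt by (simp add: I_def ereal_less_minus)
    \<comment> \<open>With \<open>a\<close> above the entropy of \<nu> and \<open>z\<close> between
      \<open>a + I\<close> and the pressure, eventually the entropy is below \<open>a\<close>, the
      integral below \<open>z - a\<close>, and yet the pressure at least
      \<open>c (r k) > z\<close>.\<close>
    then obtain a where a: "flow_entropy F \<nu> < ereal a" "ereal a < ?P - ereal I" using ereal_dense2 by blast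
    have "ereal (a + I) < ?P" using a(2) by (simp add: ereal_less_minus)
    then obtain z where z: "ereal (a + I) < ereal z" "ereal z < ?P" using ereal_dense2 by blast
    have "openin (weak_star_topology F) {\<nu> \<in> invariant_measures F. flow_entropy F \<nu> < ereal a}"
      using usc by (simp add: upper_semicontinuous_map_def topspace_weak_star_topology)
    then have "eventually (\<lambda>k. N (r k) \<in> {\<nu> \<in> invariant_measures F. flow_entropy F \<nu> < ereal a}) sequentially"
      by (rule weak_star_eventually[OF _ _ N(1) w]) (use inv a(1) in simp)
    moreover have "eventually (\<lambda>k. (\<integral>x. \<Phi> x \<partial>N (r k)) < z - a) sequentially"
    proof (rule order_tendstoD(2))
      show "(\<lambda>k. \<integral>x. \<Phi> x \<partial>N (r k)) \<longlonglongrightarrow> I" using w \<Phi> by (simp add: weakly_converges_def I_def)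
    qed (use z in simp)
    moreover have "eventually (\<lambda>k. z < c (r k)) sequentially"
      using eventually_subseq[OF r c(2)[OF z(2)]] .
    ultimately have "eventually (\<lambda>k. False) sequentially"
    proof eventually_elim
      case (elim k)
      have "ereal (c (r k)) \<le> flow_entropy F (N (r k)) + ereal (\<integral>x. \<Phi> x \<partial>N (r k))"
        using N(3)[of "r k"] by (simp add: measure_pressure_def)
      also have "\<dots> \<le> ereal a + ereal (\<integral>x. \<Phi> x \<partial>N (r k))" using elim by (intro add_right_mono) auto
      finally show ?case using elim by simp
    qed
    then show False by simp
  qed
  ultimately show ?thesis using inv by (intro that)
qed

text \<open>By concavity the equal mixture of \<mu> and \<nu> keeps at least half of the infinite
  entropy of \<mu>, so it is an equilibrium state and equals \<mu>; this forces \<nu> to be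
  \<mu>.\<close>

lemma infinite_pressure_unique:
  fixes f :: "real \<Rightarrow> 'a::metric_space \<Rightarrow> 'a"
  assumes comp: "compact (UNIV :: 'a set)" and f: "continuous_flow f"
    and \<mu>: "equilibrium_state f \<phi> \<mu>" and unique: "\<And>\<nu>. equilibrium_state f \<phi> \<nu> \<Longrightarrow> \<nu> = \<mu>"
    and inf: "topological_pressure f UNIV \<phi> = \<infinity>" and \<nu>: "\<nu> \<in> invariant_measures f"
  shows "\<nu> = \<mu>"
proof -
  have \<mu>i: "\<mu> \<in> invariant_measures f" and "measure_pressure f \<phi> \<mu> = \<infinity>"
    using \<mu> inf by (auto simp: equilibrium_state_def)
  then have h\<mu>: "flow_entropy f \<mu> = \<infinity>" by (simp add: measure_pressure_def)
  note b\<mu> = invariant_measuresD(1)[OF \<mu>i] and b\<nu> = invariant_measuresD(1)[OF \<nu>]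
  define N where "N i = (if i then \<mu> else \<nu>)" for i
  have Ni: "N i \<in> invariant_measures f" for i using \<mu>i \<nu> by (simp add: N_def)
  note Nb = invariant_measuresD(1)[OF Ni]
  obtain M where M: "borel_prob M" "\<And>A. A \<in> sets borel \<Longrightarrow> measure M A = (\<Sum>i\<in>UNIV. 1 / 2 * measure (N i) A)"
    "\<And>g :: 'a \<Rightarrow> real. compact (UNIV :: 'a set) \<Longrightarrow> continuous_on UNIV g \<Longrightarrow>
      (\<integral>x. g x \<partial>M) = (\<Sum>i\<in>UNIV. 1 / 2 * (\<integral>x. g x \<partial>N i))"
    by (rule finite_mixture_exists[of UNIV "\<lambda>_. 1 / 2" N]) (auto simp: Nb UNIV_bool)
  have Mi: "M \<in> invariant_measures f"
  proof (rule invariant_measuresI[OF f M(1)])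
    fix t and g :: "'a \<Rightarrow> real" assume g: "continuous_on UNIV g"
    have h: "continuous_on UNIV (\<lambda>x. g (f t x))"
      by (rule continuous_on_compose2[OF g continuous_flow_continuous[OF f]]) auto
    show "(\<integral>x. g (f t x) \<partial>M) = (\<integral>x. g x \<partial>M)"
      using M(3)[OF comp g] M(3)[OF comp h] by (simp add: invariant_integral[OF Ni f g])
  qed
  interpret MM: measure_preserving M "f 1" by (rule invariant_measure_preserving[OF Mi f])
  interpret M1: measure_preserving \<mu> "f 1" by (rule invariant_measure_preserving[OF \<mu>i f])
  interpret M2: measure_preserving \<nu> "f 1" by (rule invariant_measure_preserving[OF \<nu> f])
  have conc: "entropy_wrt_partition \<mu> (f 1) p / 2 \<le> entropy_wrt_partition M (f 1) p" if p: "simple_function borel p" for p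
  proof -
    have sf: "simple_function \<rho> p" if "borel_prob \<rho>" for \<rho>
      using p borel_probD[OF that] by (simp add: simple_function_def)
    have "partition_entropy \<mu> (itinerary (f 1) p n) / real n / 2 \<le> partition_entropy M (itinerary (f 1) p n) / real n" for n
    proof -
      have "(\<Sum>i\<in>UNIV. 1 / 2 * partition_entropy (N i) (itinerary (f 1) p n)) \<le> partition_entropy M (itinerary (f 1) p n)"
      proof (rule partition_entropy_concave[OF borel_probD(1)[OF M(1)] MM.simple_function_itinerary[OF sf[OF M(1)]]])
        show "sets (N i) = sets M" for i using borel_probD(2)[OF Nb] borel_probD(2)[OF M(1)] by simp
        show "measure M A = (\<Sum>i\<in>UNIV. 1 / 2 * measure (N i) A)" if "A \<in> sets M" for A
          using M(2) that borel_probD(2)[OF M(1)] by simp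
      qed (auto simp: UNIV_bool borel_probD(1)[OF Nb])
      moreover have "0 \<le> partition_entropy \<nu> (itinerary (f 1) p n)"
        by (intro partition_entropy_nonneg borel_probD(1)[OF b\<nu>] M2.simple_function_itinerary sf b\<nu>)
      ultimately have "partition_entropy \<mu> (itinerary (f 1) p n) / 2 \<le> partition_entropy M (itinerary (f 1) p n)"
        by (simp add: UNIV_bool N_def)
      then have "(partition_entropy \<mu> (itinerary (f 1) p n) / 2) / real n \<le> partition_entropy M (itinerary (f 1) p n) / real n"
        by (rule divide_right_mono) simp
      then show ?thesis by simp
    qed
    then show ?thesis
      by (intro LIMSEQ_le[OF tendsto_divide[OF M1.entropy_wrt_partition_lim[OF sf[OF b\<mu>]] tendsto_const]
            MM.entropy_wrt_partition_lim[OF sf[OF M(1)]]]) auto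
  qed
  have "flow_entropy f M = \<infinity>"
  proof (rule ereal_top)
    fix c :: real
    \<comment> \<open>Twice the target, because the mixture retains half of the entropy of each
      partition.\<close>
    have "ereal (2 * c) < flow_entropy f \<mu>" using h\<mu> by simp
    then obtain p where p: "p \<in> finite_labellings \<mu>" "2 * c < entropy_wrt_partition \<mu> (f 1) p"
      unfolding flow_entropy_def ks_entropy_def less_SUP_iff by auto
    have sp: "simple_function borel p"
      using finite_labelling_simple[OF p(1)] borel_probD[OF b\<mu>] by (simp add: simple_function_def)
    then have "p \<in> finite_labellings M"
      using borel_probD[OF M(1)] by (simp add: finite_labellings_iff_simple simple_function_def)
    then have "ereal (entropy_wrt_partition M (f 1) p) \<le> flow_entropy f M" by (rule flow_entropy_upper)
    moreover have "ereal c \<le> ereal (entropy_wrt_partition M (f 1) p)" using conc[OF sp] p(2) by simp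
    ultimately show "ereal c \<le> flow_entropy f M" by (rule order_trans[rotated])
  qed
  then have "equilibrium_state f \<phi> M" using Mi inf by (simp add: equilibrium_state_def measure_pressure_def)
  then have "M = \<mu>" by (rule unique)
  show ?thesis
  proof (rule measure_eqI)
    show "sets \<nu> = sets \<mu>" using borel_probD(2)[OF b\<nu>] borel_probD(2)[OF b\<mu>] by simp
    fix A assume "A \<in> sets \<nu>"
    then have "A \<in> sets borel" using borel_probD(2)[OF b\<nu>] by simp
    from M(2)[OF this] have "measure \<nu> A = measure \<mu> A" by (simp add: \<open>M = \<mu>\<close> UNIV_bool N_def)
    then show "emeasure \<nu> A = emeasure \<mu> A" by (simp add: M1.emeasure_eq_measure M2.emeasure_eq_measure)
  qed
qed

theorem theorem4p8:
  fixes f :: "real \<Rightarrow> 'a::metric_space \<Rightarrow> 'a"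
    and \<phi> lam :: "'a \<Rightarrow> real"
    and \<mu> :: "'a measure"
    and \<Phi> lam2 :: "'a \<times> 'a \<Rightarrow> real"
    and B :: "('a \<times> 'a) set"
  assumes compact: "compact (UNIV :: 'a set)"
    and flow: "continuous_flow f"
    and phi: "continuous_on UNIV \<phi>"
    and lam_nonneg: "\<And>x. lam x \<ge> 0"
    and lam_bounded: "bounded (range lam)"
    and lam_lsc: "lower_semicontinuous lam"
    and equilibrium: "equilibrium_state f \<phi> \<mu>"
    and unique: "\<And>\<nu>. equilibrium_state f \<phi> \<nu> \<Longrightarrow> \<nu> = \<mu>"
    and mu_zero: "measure \<mu> (lam -` {0}) < 1 / 2"
    and entropy_usc: "upper_semicontinuous_map
           (weak_star_topology (product_flow f)) (flow_entropy (product_flow f))"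
    and Phi_def: "\<Phi> = (\<lambda>(x, y). \<phi> x + \<phi> y)"
    and lam2_def: "lam2 = (\<lambda>(x, y). lam x * lam y)"
    and B_def: "B = (\<Inter>t. product_flow f t ` (lam2 -` {0}))"
  shows "topological_pressure (product_flow f) B \<Phi> < 2 * topological_pressure f UNIV \<phi>"
proof (rule ccontr)
  let ?F = "product_flow f" and ?P = "topological_pressure f UNIV \<phi>"
  assume "\<not> topological_pressure ?F B \<Phi> < 2 * ?P"
  then have ge: "2 * ?P \<le> topological_pressure ?F B \<Phi>" by simp
  note F = product_flow_continuous[OF flow] and comp2 = compact_UNIV_prod[OF compact]
  define Z where "Z = lam -` {0}"
  have "Z = - {x. 0 < lam x}" using lam_nonneg by (auto simp: Z_def order_less_le)
  then have Z: "closed Z" using lam_lsc by (auto simp: lower_semicontinuous_def)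
  have c: "continuous_on UNIV (fst :: 'a \<times> 'a \<Rightarrow> 'a)" "continuous_on UNIV (snd :: 'a \<times> 'a \<Rightarrow> 'a)"
    by (intro continuous_intros)+
  define A where "A = lam2 -` {0}"
  have A: "A = fst -` Z \<union> snd -` Z" by (auto simp: A_def lam2_def Z_def)
  have Zc: "closed (fst -` Z :: ('a \<times> 'a) set)" "closed (snd -` Z :: ('a \<times> 'a) set)"
    using closed_vimage[OF Z c(1)] closed_vimage[OF Z c(2)] by auto
  have cA: "closed A" unfolding A using Zc by (rule closed_Un)
  \<comment> \<open>Images under the invertible flow become preimages, which are closed by
    continuity; replacing \<open>t\<close> by \<open>- t\<close> then describes \<open>B\<close> by
    full orbits in \<open>A\<close>.\<close>
  have image: "?F t ` A = ?F (- t) -` A" for t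
  proof (intro set_eqI iffI)
    fix x assume "x \<in> ?F (- t) -` A"
    then show "x \<in> ?F t ` A" using continuous_flow_inverse(2)[OF F, of t x] by (intro image_eqI[of _ _ "?F (- t) x"]) auto
  qed (auto simp: continuous_flow_inverse[OF F])
  have B: "B = (\<Inter>t. ?F t -` A)"
  proof -
    have "B = (\<Inter>t. ?F (- t) -` A)" unfolding B_def A_def[symmetric] image ..
    also have "\<dots> = (\<Inter>t. ?F t -` A)"
    proof (intro set_eqI iffI)
      fix x assume x: "x \<in> (\<Inter>t. ?F (- t) -` A)"
      have "x \<in> ?F t -` A" for t using INT_D[OF x, of "- t"] by simp
      then show "x \<in> (\<Inter>t. ?F t -` A)" by blast
    qed auto
    finally show ?thesis .
  qed
  have cB: "closed B"
    unfolding B by (intro closed_INT ballI closed_vimage[OF cA continuous_flow_continuous[OF F]])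
  have iB: "?F t x \<in> B" if "x \<in> B" for t x
    using that unfolding B by (auto simp flip: continuous_flow_add[OF F])
  have BA: "B \<subseteq> A"
  proof
    fix x assume "x \<in> B"
    then have "?F 0 x \<in> A" unfolding B by blast
    then show "x \<in> A" by (simp only: continuous_flow_0[OF F])
  qed
  have c\<Phi>: "continuous_on UNIV \<Phi>"
    unfolding Phi_def case_prod_unfold
    by (intro continuous_intros continuous_on_compose2[OF phi]) auto
  have \<mu>i: "\<mu> \<in> invariant_measures f" and P\<mu>: "measure_pressure f \<phi> \<mu> = ?P"
    using equilibrium by (auto simp: equilibrium_state_def)
  \<comment> \<open>The constant labelling already gives a nonnegative member of the supremum, so
    \<open>?P\<close> cannot be -\<infinity>.\<close>
  have hpos: "0 \<le> flow_entropy f \<nu>" if \<nu>: "\<nu> \<in> invariant_measures f" for \<nu>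
  proof -
    interpret measure_preserving \<nu> "f 1" by (rule invariant_measure_preserving[OF \<nu> flow])
    have "(\<lambda>_. 0) \<in> finite_labellings \<nu>" by (simp add: finite_labellings_def)
    note upper = flow_entropy_upper[OF this, of f] and nonneg = entropy_wrt_partition_nonneg[OF finite_labelling_simple[OF this]]
    have "0 \<le> ereal (entropy_wrt_partition \<nu> (f 1) (\<lambda>_. 0))" using nonneg by simp
    then show ?thesis using upper by (rule order_trans)
  qed
  have Pfin: "?P \<noteq> - \<infinity>" using hpos[OF \<mu>i] unfolding P\<mu>[symmetric] measure_pressure_def by auto
  have "- \<infinity> < 2 * ?P" using Pfin by (cases ?P) auto
  \<comment> \<open>In particular \<open>B\<close> is nonempty under the assumption made for
    contradiction, since the empty set has pressure -\<infinity>.\<close>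
  then have "- \<infinity> < topological_pressure ?F B \<Phi>" using ge by (rule less_le_trans)
  then obtain \<nu> where \<nu>: "\<nu> \<in> invariant_measures ?F" "measure \<nu> B = 1"
    "topological_pressure ?F B \<Phi> \<le> measure_pressure ?F \<Phi> \<nu>"
    using pressure_attained[OF comp2 F c\<Phi> cB iB entropy_usc] by blast
  define \<nu>1 where "\<nu>1 = distr \<nu> borel fst"
  define \<nu>2 where "\<nu>2 = distr \<nu> borel snd"
  have inv: "\<nu>1 \<in> invariant_measures f" "\<nu>2 \<in> invariant_measures f"
    unfolding \<nu>1_def \<nu>2_def by (rule factor_invariant[OF flow _ F \<nu>(1)]; auto simp: c product_flow_def)+
  note b = invariant_measuresD(1)[OF \<nu>(1)]
  note m1 = continuous_borel_prob_measurable[OF c(1) b] and m2 = continuous_borel_prob_measurable[OF c(2) b]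
  have int: "(\<integral>z. \<Phi> z \<partial>\<nu>) = (\<integral>x. \<phi> x \<partial>\<nu>1) + (\<integral>x. \<phi> x \<partial>\<nu>2)"
  proof -
    have "continuous_on UNIV (\<lambda>z :: 'a \<times> 'a. \<phi> (fst z))" "continuous_on UNIV (\<lambda>z :: 'a \<times> 'a. \<phi> (snd z))"
      by (rule continuous_on_compose2[OF phi c(1)], simp, rule continuous_on_compose2[OF phi c(2)], simp)
    then have "(\<integral>z. \<phi> (fst z) + \<phi> (snd z) \<partial>\<nu>) = (\<integral>z. \<phi> (fst z) \<partial>\<nu>) + (\<integral>z. \<phi> (snd z) \<partial>\<nu>)"
      by (intro Bochner_Integration.integral_add continuous_borel_integrable[OF comp2 _ b])
    then show ?thesis
      unfolding \<nu>1_def \<nu>2_def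
      by (simp add: integral_distr[OF m1 borel_measurable_continuous_onI[OF phi]]
          integral_distr[OF m2 borel_measurable_continuous_onI[OF phi]] Phi_def case_prod_unfold)
  qed
  have "measure_pressure ?F \<Phi> \<nu> \<le> measure_pressure f \<phi> \<nu>1 + measure_pressure f \<phi> \<nu>2"
  proof -
    have "measure_pressure ?F \<Phi> \<nu> \<le> (flow_entropy f \<nu>1 + flow_entropy f \<nu>2) + ereal (\<integral>z. \<Phi> z \<partial>\<nu>)"
      unfolding measure_pressure_def \<nu>1_def \<nu>2_def
      by (intro add_right_mono joining_entropy_le[OF compact flow \<nu>(1)])
    also have "\<dots> = measure_pressure f \<phi> \<nu>1 + measure_pressure f \<phi> \<nu>2"
      by (simp add: measure_pressure_def int ac_simps flip: plus_ereal.simps(1))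
    finally show ?thesis .
  qed
  with ge \<nu>(3) have sum: "2 * ?P \<le> measure_pressure f \<phi> \<nu>1 + measure_pressure f \<phi> \<nu>2" by order
  note le = measure_pressure_le_topological_pressure[OF compact flow phi inv(1)]
    measure_pressure_le_topological_pressure[OF compact flow phi inv(2)]
  have eq: "\<nu>1 = \<mu> \<and> \<nu>2 = \<mu>"
  proof (cases "?P = \<infinity>")
    case True
    then show ?thesis using infinite_pressure_unique[OF compact flow equilibrium unique True] inv by blast
  next
    case False
    with Pfin obtain r where r: "?P = ereal r" by (cases ?P) auto
    have "measure_pressure f \<phi> \<nu>1 = ?P" "measure_pressure f \<phi> \<nu>2 = ?P"
      using sum le unfolding r
      by (cases "measure_pressure f \<phi> \<nu>1"; cases "measure_pressure f \<phi> \<nu>2"; auto)+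
    then show ?thesis using unique inv by (auto simp: equilibrium_state_def)
  qed
  interpret prob_space \<nu> by (rule borel_probD(1)[OF b])
  have Zb: "Z \<in> sets borel" using Z by auto
  have "1 \<le> measure \<nu> (fst -` Z \<union> snd -` Z)"
    unfolding \<nu>(2)[symmetric] using BA cA
    by (intro finite_measure_mono) (auto simp: A[symmetric] borel_probD[OF b])
  also have "\<dots> \<le> measure \<nu> (fst -` Z) + measure \<nu> (snd -` Z)"
    using Zc by (intro measure_Un_le) (auto simp: borel_probD[OF b])
  also have "measure \<nu> (fst -` Z) = measure \<mu> Z"
    using measure_distr[OF m1 Zb] eq by (simp add: \<nu>1_def borel_probD[OF b])
  also have "measure \<nu> (snd -` Z) = measure \<mu> Z"
    using measure_distr[OF m2 Zb] eq by (simp add: \<nu>2_def borel_probD[OF b])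
  finally show False using mu_zero by (simp add: Z_def)
qed

end
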